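(* Let $d\ge 2$ and $T>0$. With $\phi(T)$ the expected (Stratonovich) signature over $[0,T]$ of a standard $d$-dimensional Brownian motion, $\phi^{M}(T)$ the expected signature over $[0,T]$ of its piecewise linear interpolation with $M\ge 1$ equal steps, and $\pi_n$ the projection from the tensor algebra to $(\mathbb{R}^d)^{\otimes n}$, the following hold. (i) For every $M\ge 1$: $\pi_{2}(\phi(T)) = \pi_{2}(\phi^{M}(T))$, and $\pi_{2n-1}(\phi(T)) = \pi_{2n-1}(\phi^{M}(T)) = 0$ for all $n \geq 1$. (ii) For each $n \geq 2$, if $\mathbb{R}^{d}$ is endowed with the $\ell_{1}$ norm and $(\mathbb{R}^{d})^{\otimes 2n}$ is given the corresponding projective tensor norm $\|\cdot\|$, then $$\lim_{M \to +\infty} \frac{M}{T} \left\| \pi_{2n}(\phi(T)) - \pi_{2n}(\phi^{M}(T)) \right\| = \frac{d-1}{3 \cdot (n-2)!} \left(\frac{dT}{2} \right)^{n-1}.$$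
   Context: Let $(e_1,\dots,e_d)$ be the standard basis of $\mathbb{R}^d$ and $B_t=\sum_{j=1}^d B_t^j e_j$, where $B^1,\dots,B^d$ are independent standard one-dimensional Brownian motions started at $0$. A word of length $n$ is $w=e_{i_1}\cdots e_{i_n}$ with $1\le i_1,\dots,i_n\le d$; the words of length $n$ form a basis of $(\mathbb{R}^d)^{\otimes n}$ (identify $e_{i_1}\cdots e_{i_n}$ with $e_{i_1}\otimes\cdots\otimes e_{i_n}$). Signature: for a path $\gamma$ and $w=e_{i_1}\cdots e_{i_n}$, the coefficient of $w$ in the signature $X_{s,t}(\gamma)$ is $\int_{s<u_1<\cdots<u_n<t} \circ d\gamma^{i_1}_{u_1}\cdots\circ d\gamma^{i_n}_{u_n}$ (Stratonovich iterated integrals for $\gamma=B$; ordinary iterated integrals for piecewise linear $\gamma$), with value $1$ for the empty word. So $X_{s,t}(\gamma)$ is the formal series over all words $w$ of (coefficient of $w$) times $w$. $B^{(M)}$ is the piecewise linear path on $[0,T]$ that coincides with $B$ at the points $kT/M$, $k=0,\dots,M$, and is linear on each $[kT/M,(k+1)T/M]$. Set $\phi(T)=\mathbb{E}X_{0,T}(B)$ and $\phi^M(T)=\mathbb{E}X_{0,T}(B^{(M)})$, with expectations taken coefficientwise. Projective tensor norm on $(\mathbb{R}^d)^{\otimes n}$: $\|v\|=\inf\{\sum_i\|v_{1,i}\|\cdots\|v_{n,i}\| : v=\sum_i v_{1,i}\otimes\cdots\otimes v_{n,i}\}$ (finite sums), where $\mathbb{R}^d$ carries the $\ell_1$ norm.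 *)

theory Defs
  imports "HOL-Probability.Probability"
begin

text \<open>A process is only looked at on the time set [0, \<infinity>).\<close>

definition standard_BM :: "'a measure \<Rightarrow> (real \<Rightarrow> 'a \<Rightarrow> real) \<Rightarrow> bool" where
  "standard_BM P W \<longleftrightarrow>
     prob_space P \<and>
     (\<forall>t\<ge>0. W t \<in> borel_measurable P) \<and>
     (AE \<omega> in P. W 0 \<omega> = 0) \<and>
     (\<forall>s t. 0 \<le> s \<longrightarrow> s < t \<longrightarrow>
        distributed P lborel (\<lambda>\<omega>. W t \<omega> - W s \<omega>) (normal_density 0 (sqrt (t - s)))) \<and>
     (\<forall>(n::nat) (t :: nat \<Rightarrow> real). 0 \<le> t 0 \<longrightarrow> mono t \<longrightarrow>
        prob_space.indep_vars P (\<lambda>_. borel) (\<lambda>k \<omega>. W (t (Suc k)) \<omega> - W (t k) \<omega>) {..<n}) \<and>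
     (AE \<omega> in P. continuous_on {0..} (\<lambda>t. W t \<omega>))"

text \<open>Independence of the components is independence of whole processes, viewed as random
  elements of the product space of real-valued functions on [0, \<infinity>).\<close>

definition BM :: "'a measure \<Rightarrow> (real \<Rightarrow> 'a \<Rightarrow> real ^ 'd) \<Rightarrow> bool" where
  "BM P B \<longleftrightarrow>
     (\<forall>j. standard_BM P (\<lambda>t \<omega>. B t \<omega> $ j)) \<and>
     prob_space.indep_vars P (\<lambda>_. Pi\<^sub>M {0..} (\<lambda>_. borel))
       (\<lambda>j \<omega>. \<lambda>t\<in>{0..}. B t \<omega> $ j) UNIV"

definition is_partition :: "real \<Rightarrow> real \<Rightarrow> real list \<Rightarrow> bool" where
  "is_partition s t ts \<longleftrightarrow> ts \<noteq> [] \<and> hd ts = s \<and> last ts = t \<and> sorted ts"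

definition mesh_less :: "real list \<Rightarrow> real \<Rightarrow> bool" where
  "mesh_less ts \<delta> \<longleftrightarrow> (\<forall>k < length ts - 1. ts ! Suc k - ts ! k < \<delta>)"

definition stratonovich_sum ::
    "(real \<Rightarrow> 'a \<Rightarrow> real) \<Rightarrow> (real \<Rightarrow> 'a \<Rightarrow> real) \<Rightarrow> real list \<Rightarrow> 'a \<Rightarrow> real" where
  "stratonovich_sum Y X ts \<omega> =
     (\<Sum>k < length ts - 1. (Y (ts ! k) \<omega> + Y (ts ! Suc k) \<omega>) / 2 *
        (X (ts ! Suc k) \<omega> - X (ts ! k) \<omega>))"

text \<open>The Stratonovich integral is the limit in probability of the trapezoidal sums as the
  mesh of the partition tends to 0. It is determined up to almost sure equality, so
  \<open>stratonovich_integral\<close> below picks a version. Iterating is unambiguous up to almost sure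
  equality, because each trapezoidal sum evaluates the integrand at finitely many times only.\<close>

definition is_stratonovich_integral ::
    "'a measure \<Rightarrow> (real \<Rightarrow> 'a \<Rightarrow> real) \<Rightarrow> (real \<Rightarrow> 'a \<Rightarrow> real) \<Rightarrow> real \<Rightarrow> real \<Rightarrow> ('a \<Rightarrow> real) \<Rightarrow> bool"
  where
  "is_stratonovich_integral P Y X s t Z \<longleftrightarrow>
     Z \<in> borel_measurable P \<and>
     (\<forall>\<epsilon>>0. \<forall>\<eta>>0. \<exists>\<delta>>0. \<forall>ts. is_partition s t ts \<longrightarrow> mesh_less ts \<delta> \<longrightarrow>
        measure P {\<omega> \<in> space P. \<bar>stratonovich_sum Y X ts \<omega> - Z \<omega>\<bar> > \<epsilon>} < \<eta>)"

definition stratonovich_integral ::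
    "'a measure \<Rightarrow> (real \<Rightarrow> 'a \<Rightarrow> real) \<Rightarrow> (real \<Rightarrow> 'a \<Rightarrow> real) \<Rightarrow> real \<Rightarrow> real \<Rightarrow> 'a \<Rightarrow> real" where
  "stratonovich_integral P Y X s t = (SOME Z. is_stratonovich_integral P Y X s t Z)"

text \<open>Words over the basis of \<open>real ^ 'd\<close> are lists over \<open>'d\<close>, and a formal series of tensors is
  its family of coefficients, of type \<open>'d list \<Rightarrow> real\<close>. The iterated integrals are defined by
  recursion on the reversed word, whose head is the letter of the last (outermost) integration.\<close>

primrec stratonovich_iterated ::
    "'a measure \<Rightarrow> (real \<Rightarrow> 'a \<Rightarrow> real ^ 'd) \<Rightarrow> real \<Rightarrow> 'd list \<Rightarrow> real \<Rightarrow> 'a \<Rightarrow> real" where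
  "stratonovich_iterated P B s [] = (\<lambda>t \<omega>. 1)"
| "stratonovich_iterated P B s (i # v) =
     (\<lambda>t. stratonovich_integral P (stratonovich_iterated P B s v) (\<lambda>u \<omega>. B u \<omega> $ i) s t)"

definition stratonovich_signature ::
    "'a measure \<Rightarrow> (real \<Rightarrow> 'a \<Rightarrow> real ^ 'd) \<Rightarrow> real \<Rightarrow> real \<Rightarrow> 'a \<Rightarrow> 'd list \<Rightarrow> real" where
  "stratonovich_signature P B s t \<omega> w = stratonovich_iterated P B s (rev w) t \<omega>"

text \<open>For a piecewise linear path, integration against \<open>d\<gamma>\<^sup>i\<close> is integration against
  \<open>deriv \<gamma>\<^sup>i\<close>, which exists except at finitely many times.\<close>

primrec path_iterated :: "(real \<Rightarrow> real ^ 'd) \<Rightarrow> real \<Rightarrow> 'd list \<Rightarrow> real \<Rightarrow> real" where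
  "path_iterated \<gamma> s [] = (\<lambda>t. 1)"
| "path_iterated \<gamma> s (i # v) =
     (\<lambda>t. integral {s..t} (\<lambda>u. path_iterated \<gamma> s v u * deriv (\<lambda>r. \<gamma> r $ i) u))"

definition path_signature :: "(real \<Rightarrow> real ^ 'd) \<Rightarrow> real \<Rightarrow> real \<Rightarrow> 'd list \<Rightarrow> real" where
  "path_signature \<gamma> s t w = path_iterated \<gamma> s (rev w) t"

text \<open>At \<open>u = T\<close> the value is \<open>\<gamma> T\<close>, since the increment beyond \<open>T\<close> gets the factor 0.\<close>

definition pl_interpolation :: "real \<Rightarrow> nat \<Rightarrow> (real \<Rightarrow> real ^ 'd) \<Rightarrow> real \<Rightarrow> real ^ 'd" where
  "pl_interpolation T M \<gamma> u =
     (let x = u * real M / T; k = real_of_int \<lfloor>x\<rfloor>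
      in \<gamma> (k * T / real M) + (x - k) *\<^sub>R (\<gamma> ((k + 1) * T / real M) - \<gamma> (k * T / real M)))"

definition expected_signature ::
    "'a measure \<Rightarrow> (real \<Rightarrow> 'a \<Rightarrow> real ^ 'd) \<Rightarrow> real \<Rightarrow> 'd list \<Rightarrow> real" where
  "expected_signature P B T w = (\<integral>\<omega>. stratonovich_signature P B 0 T \<omega> w \<partial>P)"

definition expected_signature_pl ::
    "'a measure \<Rightarrow> (real \<Rightarrow> 'a \<Rightarrow> real ^ 'd) \<Rightarrow> nat \<Rightarrow> real \<Rightarrow> 'd list \<Rightarrow> real" where
  "expected_signature_pl P B M T w =
     (\<integral>\<omega>. path_signature (pl_interpolation T M (\<lambda>u. B u \<omega>)) 0 T w \<partial>P)"

definition tensor_proj :: "nat \<Rightarrow> ('d list \<Rightarrow> real) \<Rightarrow> 'd list \<Rightarrow> real" where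
  "tensor_proj n a = (\<lambda>w. if length w = n then a w else 0)"

definition pure_tensor :: "nat \<Rightarrow> (nat \<Rightarrow> real ^ 'd) \<Rightarrow> 'd list \<Rightarrow> real" where
  "pure_tensor n x = (\<lambda>w. if length w = n then (\<Prod>k<n. x k $ (w ! k)) else 0)"

definition l1_norm :: "real ^ 'd \<Rightarrow> real" where
  "l1_norm x = (\<Sum>i\<in>UNIV. \<bar>x $ i\<bar>)"

definition projective_norm :: "nat \<Rightarrow> ('d::finite list \<Rightarrow> real) \<Rightarrow> real" where
  "projective_norm n a =
     Inf {\<Sum>i<m. \<Prod>k<n. l1_norm (x i k) | (m::nat) (x :: nat \<Rightarrow> nat \<Rightarrow> real ^ 'd).
            a = (\<lambda>w. \<Sum>i<m. pure_tensor n (x i) w)}"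

end

theory Submission
  imports Defs
begin

text \<open>On the Brownian side, each iterated Stratonovich integral is realised as an Ito integral plus half
  a time integral, both obtained as \<open>L\<^sup>2\<close> limits of left-point sums of processes that are
  1/2-Hoelder in \<open>L\<^sup>2\<close>. The trapezoidal sums converge to it in \<open>L\<^sup>1\<close>, and taking means gives
  \<open>\<phi>(T) = exp (T / 2 * (\<Sum>i. e\<^sub>i \<otimes> e\<^sub>i))\<close>.

  On the piecewise linear side, Chen's identity and the independence of increments give
  \<open>\<phi>\<^sup>M(T)\<close> as the \<open>M\<close>-fold tensor power of the Gaussian mean of a segment exponential. In a word of
  length \<open>2n\<close> its coefficient is \<open>(T / M)\<^sup>n\<close> times a sum of binomials \<open>M choose j\<close>, weighted by the
  cuts of the word into \<open>j\<close> blocks. The terms \<open>j = n\<close> and \<open>j = n - 1\<close> determine the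
  coefficient of \<open>1 / M\<close>, where one block of four letters replaces two pairs.

  For the \<open>l\<^sub>1\<close> norm the projective norm is the sum of the absolute values of the coefficients, and the
  \<open>1 / M\<close> coefficients are summed by stripping two letters at a time.\<close>

section \<open>Square integrable random variables\<close>

text \<open>The limit is decided in degree four. There, in units of squared time, the Brownian
  series has coefficient 1/8 on every \<open>iijj\<close>, while one segment gives 1/8 on
  \<open>iiii\<close> but, for \<open>i\<close> different from \<open>j\<close>, only 1/24 on
  \<open>iijj\<close> and also 1/24 on \<open>ijij\<close> and \<open>ijji\<close>. The absolute
  errors 1/12, 1/24, 1/24 add up to 1/6 for each of the d(d-1) ordered pairs of distinct letters. A
  word of length 2n has n-1 places for such a block and the other n-2 pairs weigh d/2 each, so the
  total is (n-1) * d(d-1)/6 * (d/2)^(n-2) = (n-1) * (d-1)/3 * (d/2)^(n-1), to be multiplied by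
  T^(n-1)/(n-1)!.

  On the Brownian side the integral is given at each time separately and up to null sets. The proof
  therefore works without paths: a process is a family of L2 variables with adaptedness, an L2
  Hoelder bound and a one-step approximation \<open>Y1 s * inc s t j\<close> of its increments. This
  approximation determines the trapezoidal correction and is passed on from letter to letter.
  Orthogonality to the past replaces conditional expectations.\<close>

context prob_space
begin

definition sq_integrable :: "('a \<Rightarrow> real) \<Rightarrow> bool" where
  "sq_integrable X \<longleftrightarrow> X \<in> borel_measurable M \<and> integrable M (\<lambda>\<omega>. (X \<omega>)\<^sup>2)"

definition nrm :: "('a \<Rightarrow> real) \<Rightarrow> real" where
  "nrm X = sqrt (\<integral>\<omega>. (X \<omega>)\<^sup>2 \<partial>M)"

lemma sq_integrable_measurable [measurable_dest]: "sq_integrable X \<Longrightarrow> X \<in> borel_measurable M"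
  by (simp add: sq_integrable_def)

lemma sq_integrable_square: "sq_integrable X \<Longrightarrow> integrable M (\<lambda>\<omega>. (X \<omega>)\<^sup>2)"
  by (simp add: sq_integrable_def)

lemma sq_integrable_imp_integrable: "sq_integrable X \<Longrightarrow> integrable M X"
  by (auto simp: sq_integrable_def intro: square_integrable_imp_integrable)

lemma sq_integrable_mult:
  assumes "sq_integrable X" "sq_integrable Y"
  shows "integrable M (\<lambda>\<omega>. X \<omega> * Y \<omega>)"
proof (rule Bochner_Integration.integrable_bound)
  show "integrable M (\<lambda>\<omega>. (X \<omega>)\<^sup>2 + (Y \<omega>)\<^sup>2)"
    using assms by (intro Bochner_Integration.integrable_add sq_integrable_square)
  show "(\<lambda>\<omega>. X \<omega> * Y \<omega>) \<in> borel_measurable M"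
    using assms by (auto simp: sq_integrable_def)
  have "\<bar>x * y\<bar> \<le> \<bar>x\<^sup>2 + y\<^sup>2\<bar>" for x y :: real
  proof -
    have "2 * \<bar>x\<bar> * \<bar>y\<bar> \<le> x\<^sup>2 + y\<^sup>2"
      using sum_squares_bound[of "\<bar>x\<bar>" "\<bar>y\<bar>"] by simp
    moreover have "0 \<le> \<bar>x\<bar> * \<bar>y\<bar>" by simp
    ultimately show ?thesis unfolding abs_mult by linarith
  qed
  then show "AE \<omega> in M. norm (X \<omega> * Y \<omega>) \<le> norm ((X \<omega>)\<^sup>2 + (Y \<omega>)\<^sup>2)"
    by simp
qed

lemma sq_integrable_add [intro]:
  assumes "sq_integrable X" "sq_integrable Y"
  shows "sq_integrable (\<lambda>\<omega>. X \<omega> + Y \<omega>)"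
  using assms sq_integrable_mult[OF assms]
  by (auto simp: sq_integrable_def power2_sum mult.assoc intro!: Bochner_Integration.integrable_add)

lemma sq_integrable_cmult [intro]: "sq_integrable X \<Longrightarrow> sq_integrable (\<lambda>\<omega>. c * X \<omega>)"
  by (auto simp: sq_integrable_def power_mult_distrib)

lemma sq_integrable_const [intro, simp]: "sq_integrable (\<lambda>\<omega>. c)"
  by (auto simp: sq_integrable_def)

lemma sq_integrable_uminus [intro]: "sq_integrable X \<Longrightarrow> sq_integrable (\<lambda>\<omega>. - X \<omega>)"
  by (auto simp: sq_integrable_def)

lemma sq_integrable_diff [intro]:
  "sq_integrable X \<Longrightarrow> sq_integrable Y \<Longrightarrow> sq_integrable (\<lambda>\<omega>. X \<omega> - Y \<omega>)"
  using sq_integrable_add[of X "\<lambda>\<omega>. - Y \<omega>"] by auto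

lemma sq_integrable_sum [intro]:
  "(\<And>i. i \<in> I \<Longrightarrow> sq_integrable (X i)) \<Longrightarrow> sq_integrable (\<lambda>\<omega>. \<Sum>i\<in>I. X i \<omega>)"
  by (induction I rule: infinite_finite_induct) auto

lemma nrm_nonneg [simp]: "0 \<le> nrm X"
  by (simp add: nrm_def)

lemma nrm_square: "(nrm X)\<^sup>2 = (\<integral>\<omega>. (X \<omega>)\<^sup>2 \<partial>M)"
  by (simp add: nrm_def)

lemma nrm_cmult: "nrm (\<lambda>\<omega>. c * X \<omega>) = \<bar>c\<bar> * nrm X"
  by (simp add: nrm_def power_mult_distrib real_sqrt_mult)

lemma nrm_uminus: "nrm (\<lambda>\<omega>. - X \<omega>) = nrm X"
  by (simp add: nrm_def)

lemma nrm_diff_commute: "nrm (\<lambda>\<omega>. X \<omega> - Y \<omega>) = nrm (\<lambda>\<omega>. Y \<omega> - X \<omega>)"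
  by (simp add: nrm_def power2_commute)

lemma nrm_const: "nrm (\<lambda>\<omega>. c) = \<bar>c\<bar>"
  by (simp add: nrm_def prob_space)

text \<open>The absolute value stays inside the integral because the trapezoidal error contains
  products of two L2 variables, which are controlled in L1 only.\<close>

lemma Cauchy_Schwarz_nrm:
  assumes "sq_integrable X" "sq_integrable Y"
  shows "(\<integral>\<omega>. \<bar>X \<omega> * Y \<omega>\<bar> \<partial>M) \<le> nrm X * nrm Y"
proof -
  have [measurable]: "X \<in> borel_measurable M" "Y \<in> borel_measurable M"
    using assms by (auto simp: sq_integrable_def)
  have "(\<integral>\<^sup>+\<omega>. ennreal \<bar>X \<omega>\<bar> * ennreal \<bar>Y \<omega>\<bar> \<partial>M)\<^sup>2 \<le>
      (\<integral>\<^sup>+\<omega>. (ennreal \<bar>X \<omega>\<bar>)\<^sup>2 \<partial>M) * (\<integral>\<^sup>+\<omega>. (ennreal \<bar>Y \<omega>\<bar>)\<^sup>2 \<partial>M)"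
    by (rule Cauchy_Schwarz_nn_integral) measurable
  also have "(\<lambda>\<omega>. (ennreal \<bar>X \<omega>\<bar>)\<^sup>2) = (\<lambda>\<omega>. ennreal ((X \<omega>)\<^sup>2))"
    by (simp add: ennreal_power)
  also have "(\<lambda>\<omega>. (ennreal \<bar>Y \<omega>\<bar>)\<^sup>2) = (\<lambda>\<omega>. ennreal ((Y \<omega>)\<^sup>2))"
    by (simp add: ennreal_power)
  also have "(\<lambda>\<omega>. ennreal \<bar>X \<omega>\<bar> * ennreal \<bar>Y \<omega>\<bar>) = (\<lambda>\<omega>. ennreal \<bar>X \<omega> * Y \<omega>\<bar>)"
    by (simp add: abs_mult ennreal_mult)
  also have "(\<integral>\<^sup>+\<omega>. ennreal ((X \<omega>)\<^sup>2) \<partial>M) = ennreal (\<integral>\<omega>. (X \<omega>)\<^sup>2 \<partial>M)"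
    by (rule nn_integral_eq_integral) (use assms in \<open>auto simp: sq_integrable_def\<close>)
  also have "(\<integral>\<^sup>+\<omega>. ennreal ((Y \<omega>)\<^sup>2) \<partial>M) = ennreal (\<integral>\<omega>. (Y \<omega>)\<^sup>2 \<partial>M)"
    by (rule nn_integral_eq_integral) (use assms in \<open>auto simp: sq_integrable_def\<close>)
  also have "(\<integral>\<^sup>+\<omega>. ennreal \<bar>X \<omega> * Y \<omega>\<bar> \<partial>M) = ennreal (\<integral>\<omega>. \<bar>X \<omega> * Y \<omega>\<bar> \<partial>M)"
    by (rule nn_integral_eq_integral) (use sq_integrable_mult[OF assms] in auto)
  finally have "(\<integral>\<omega>. \<bar>X \<omega> * Y \<omega>\<bar> \<partial>M)\<^sup>2 \<le> (\<integral>\<omega>. (X \<omega>)\<^sup>2 \<partial>M) * (\<integral>\<omega>. (Y \<omega>)\<^sup>2 \<partial>M)"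
    by (simp add: ennreal_power flip: ennreal_mult)
  also have "\<dots> = (nrm X * nrm Y)\<^sup>2"
    by (simp add: power_mult_distrib nrm_square)
  finally show ?thesis
    by (rule power2_le_imp_le) simp
qed

lemma abs_integral_mult_le:
  assumes "sq_integrable X" "sq_integrable Y"
  shows "\<bar>\<integral>\<omega>. X \<omega> * Y \<omega> \<partial>M\<bar> \<le> nrm X * nrm Y"
  using integral_abs_bound[of M "\<lambda>\<omega>. X \<omega> * Y \<omega>"] Cauchy_Schwarz_nrm[OF assms] by linarith

lemma integral_abs_le_nrm:
  assumes "sq_integrable X"
  shows "(\<integral>\<omega>. \<bar>X \<omega>\<bar> \<partial>M) \<le> nrm X"
  using Cauchy_Schwarz_nrm[OF assms, of "\<lambda>_. 1"] by (simp add: nrm_const)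

lemma abs_integral_le_nrm:
  assumes "sq_integrable X"
  shows "\<bar>\<integral>\<omega>. X \<omega> \<partial>M\<bar> \<le> nrm X"
  using abs_integral_mult_le[OF assms, of "\<lambda>_. 1"] by (simp add: nrm_const)

lemma nrm_triangle:
  assumes "sq_integrable X" "sq_integrable Y"
  shows "nrm (\<lambda>\<omega>. X \<omega> + Y \<omega>) \<le> nrm X + nrm Y"
proof (rule power2_le_imp_le)
  have "(nrm (\<lambda>\<omega>. X \<omega> + Y \<omega>))\<^sup>2 = (\<integral>\<omega>. ((X \<omega>)\<^sup>2 + (Y \<omega>)\<^sup>2) + 2 * (X \<omega> * Y \<omega>) \<partial>M)"
    by (simp add: nrm_square power2_sum mult.assoc)
  also have "\<dots> = (nrm X)\<^sup>2 + (nrm Y)\<^sup>2 + 2 * (\<integral>\<omega>. X \<omega> * Y \<omega> \<partial>M)"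
    using assms sq_integrable_mult[OF assms] by (simp add: nrm_square sq_integrable_square)
  also have "\<dots> \<le> (nrm X)\<^sup>2 + (nrm Y)\<^sup>2 + 2 * (nrm X * nrm Y)"
    using abs_integral_mult_le[OF assms] by linarith
  finally show "(nrm (\<lambda>\<omega>. X \<omega> + Y \<omega>))\<^sup>2 \<le> (nrm X + nrm Y)\<^sup>2"
    by (simp add: power2_sum)
qed simp

lemma nrm_triangle_diff:
  assumes "sq_integrable X" "sq_integrable Y"
  shows "nrm (\<lambda>\<omega>. X \<omega> - Y \<omega>) \<le> nrm X + nrm Y"
  using nrm_triangle[OF assms(1) sq_integrable_uminus[OF assms(2)]] by (simp add: nrm_uminus)

lemma nrm_sum_le:
  assumes "finite I" "\<And>i. i \<in> I \<Longrightarrow> sq_integrable (X i)"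
  shows "nrm (\<lambda>\<omega>. \<Sum>i\<in>I. X i \<omega>) \<le> (\<Sum>i\<in>I. nrm (X i))"
  using assms
proof (induction I rule: finite_induct)
  case (insert i I)
  have "nrm (\<lambda>\<omega>. \<Sum>i\<in>insert i I. X i \<omega>) = nrm (\<lambda>\<omega>. X i \<omega> + (\<Sum>i\<in>I. X i \<omega>))"
    using insert by simp
  also have "\<dots> \<le> nrm (X i) + nrm (\<lambda>\<omega>. \<Sum>i\<in>I. X i \<omega>)"
    using insert by (intro nrm_triangle) auto
  finally show ?case using insert by force
qed (simp add: nrm_const)

lemma nrm_le_iff: "0 \<le> c \<Longrightarrow> nrm X \<le> c \<longleftrightarrow> (\<integral>\<omega>. (X \<omega>)\<^sup>2 \<partial>M) \<le> c\<^sup>2"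
  by (metis nrm_square nrm_nonneg power2_le_imp_le power_mono)

text \<open>Membership of the limit in L2 and the bound on its norm come from the same finite lower
  limit, so they are obtained together.\<close>

lemma sq_integrable_Fatou:
  assumes X: "\<And>n. sq_integrable (X n)" and Y: "Y \<in> borel_measurable M"
    and lim: "AE \<omega> in M. (\<lambda>n. X n \<omega>) \<longlonglongrightarrow> Y \<omega>"
    and bound: "\<And>n. nrm (X n) \<le> C"
  shows "sq_integrable Y \<and> nrm Y \<le> C"
proof -
  have C: "0 \<le> C" using bound[of 0] nrm_nonneg[of "X 0"] by linarith
  have [measurable]: "X n \<in> borel_measurable M" for n using X by (auto simp: sq_integrable_def)
  have "(\<integral>\<^sup>+\<omega>. ennreal ((Y \<omega>)\<^sup>2) \<partial>M) = (\<integral>\<^sup>+\<omega>. liminf (\<lambda>n. ennreal ((X n \<omega>)\<^sup>2)) \<partial>M)"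
  proof (rule nn_integral_cong_AE)
    show "AE \<omega> in M. ennreal ((Y \<omega>)\<^sup>2) = liminf (\<lambda>n. ennreal ((X n \<omega>)\<^sup>2))"
      using lim
    proof eventually_elim
      case (elim \<omega>)
      then have "(\<lambda>n. ennreal ((X n \<omega>)\<^sup>2)) \<longlonglongrightarrow> ennreal ((Y \<omega>)\<^sup>2)"
        by (intro tendsto_ennrealI tendsto_power)
      then show ?case
        by (intro lim_imp_Liminf[symmetric]) auto
    qed
  qed
  also have "\<dots> \<le> liminf (\<lambda>n. \<integral>\<^sup>+\<omega>. ennreal ((X n \<omega>)\<^sup>2) \<partial>M)"
    by (rule nn_integral_liminf) measurable
  also have "\<dots> \<le> liminf (\<lambda>n. ennreal (C\<^sup>2))"
  proof (rule Liminf_mono, rule always_eventually, rule allI)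
    fix n
    have "(\<integral>\<^sup>+\<omega>. ennreal ((X n \<omega>)\<^sup>2) \<partial>M) = ennreal (\<integral>\<omega>. (X n \<omega>)\<^sup>2 \<partial>M)"
      by (rule nn_integral_eq_integral) (use X in \<open>auto simp: sq_integrable_def\<close>)
    then show "(\<integral>\<^sup>+\<omega>. ennreal ((X n \<omega>)\<^sup>2) \<partial>M) \<le> ennreal (C\<^sup>2)"
      using bound[of n] C by (simp add: nrm_le_iff ennreal_leI)
  qed
  finally have le: "(\<integral>\<^sup>+\<omega>. ennreal ((Y \<omega>)\<^sup>2) \<partial>M) \<le> ennreal (C\<^sup>2)"
    by (simp add: Liminf_const)
  then have "(\<integral>\<^sup>+\<omega>. ennreal (norm ((Y \<omega>)\<^sup>2)) \<partial>M) < \<infinity>"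
    by (auto intro: le_less_trans)
  then have int: "integrable M (\<lambda>\<omega>. (Y \<omega>)\<^sup>2)"
    using Y by (auto simp: integrable_iff_bounded)
  then have "ennreal (\<integral>\<omega>. (Y \<omega>)\<^sup>2 \<partial>M) \<le> ennreal (C\<^sup>2)"
    using le by (subst nn_integral_eq_integral[symmetric]) auto
  then have "(\<integral>\<omega>. (Y \<omega>)\<^sup>2 \<partial>M) \<le> C\<^sup>2" by simp
  then show ?thesis using int Y C by (auto simp: sq_integrable_def nrm_le_iff)
qed

text \<open>Riesz-Fischer for a rapidly converging sequence. The sub-sigma-algebra \<open>F\<close>
  is carried along so that integrals built as limits remain adapted.\<close>

lemma sq_integrable_complete:
  assumes X: "\<And>n. sq_integrable (X n)"
    and F: "subalgebra M F" "\<And>n. X n \<in> borel_measurable F"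
    and a: "\<And>n. nrm (\<lambda>\<omega>. X (Suc n) \<omega> - X n \<omega>) \<le> a n" "summable a"
  shows "\<exists>Z. Z \<in> borel_measurable F \<and> sq_integrable Z \<and> (\<lambda>n. nrm (\<lambda>\<omega>. Z \<omega> - X n \<omega>)) \<longlonglongrightarrow> 0"
proof -
  \<comment> \<open>\<open>lim\<close> has a value at every point, so \<open>Z\<close> is
    \<open>F\<close>-measurable although convergence holds only almost surely.\<close>
  define Z where "Z = (\<lambda>\<omega>. lim (\<lambda>n. X n \<omega>))"
  have ZF: "Z \<in> borel_measurable F"
    unfolding Z_def by (rule borel_measurable_lim_metric) (rule F)
  have D: "sq_integrable (\<lambda>\<omega>. X m \<omega> - X n \<omega>)" for m n using X by auto
  have a0: "0 \<le> a n" for n using a(1)[of n] nrm_nonneg order_trans by blast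
  have "summable (\<lambda>n. \<integral>\<omega>. norm (X (Suc n) \<omega> - X n \<omega>) \<partial>M)"
  proof (rule summable_comparison_test[OF _ a(2)], intro exI allI impI)
    fix n
    show "norm (\<integral>\<omega>. norm (X (Suc n) \<omega> - X n \<omega>) \<partial>M) \<le> a n"
      using integral_abs_le_nrm[OF D[of "Suc n" n]] a(1)[of n] by simp
  qed
  moreover have "integrable M (\<lambda>\<omega>. X (Suc n) \<omega> - X n \<omega>)" for n
    using D by (rule sq_integrable_imp_integrable)
  ultimately have conv: "AE \<omega> in M. summable (\<lambda>n. norm (X (Suc n) \<omega> - X n \<omega>))"
  proof -
    assume sm: "summable (\<lambda>n. \<integral>\<omega>. norm (X (Suc n) \<omega> - X n \<omega>) \<partial>M)"
      and int: "\<And>n. integrable M (\<lambda>\<omega>. X (Suc n) \<omega> - X n \<omega>)"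
    have [measurable]: "X n \<in> borel_measurable M" for n using X by (auto simp: sq_integrable_def)
    have "(\<integral>\<^sup>+\<omega>. (\<Sum>n. ennreal (norm (X (Suc n) \<omega> - X n \<omega>))) \<partial>M)
        = (\<Sum>n. \<integral>\<^sup>+\<omega>. ennreal (norm (X (Suc n) \<omega> - X n \<omega>)) \<partial>M)"
      by (rule nn_integral_suminf) measurable
    also have "\<dots> = (\<Sum>n. ennreal (\<integral>\<omega>. norm (X (Suc n) \<omega> - X n \<omega>) \<partial>M))"
      using int by (intro arg_cong[of _ _ suminf] ext nn_integral_eq_integral) auto
    also have "\<dots> = ennreal (\<Sum>n. \<integral>\<omega>. norm (X (Suc n) \<omega> - X n \<omega>) \<partial>M)"
      by (rule suminf_ennreal2) (use sm in auto)
    finally have "(\<integral>\<^sup>+\<omega>. (\<Sum>n. ennreal (norm (X (Suc n) \<omega> - X n \<omega>))) \<partial>M) \<noteq> \<infinity>"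
      by simp
    then have "AE \<omega> in M. (\<Sum>n. ennreal (norm (X (Suc n) \<omega> - X n \<omega>))) \<noteq> \<infinity>"
      by (intro nn_integral_noteq_infinite) measurable
    then show ?thesis
      by eventually_elim (auto intro!: summable_suminf_not_top)
  qed
  have lim: "AE \<omega> in M. (\<lambda>n. X n \<omega>) \<longlonglongrightarrow> Z \<omega>"
    using conv
  proof eventually_elim
    case (elim \<omega>)
    then have "summable (\<lambda>n. X (Suc n) \<omega> - X n \<omega>)" by (rule summable_norm_cancel)
    then have "(\<lambda>n. X 0 \<omega> + (\<Sum>k<n. X (Suc k) \<omega> - X k \<omega>)) \<longlonglongrightarrow> X 0 \<omega> + (\<Sum>k. X (Suc k) \<omega> - X k \<omega>)"
      by (intro tendsto_add tendsto_const summable_LIMSEQ)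
    moreover have "X 0 \<omega> + (\<Sum>k<n. X (Suc k) \<omega> - X k \<omega>) = X n \<omega>" for n
      using sum_lessThan_telescope[of "\<lambda>k. X k \<omega>" n] by simp
    ultimately have "convergent (\<lambda>n. X n \<omega>)"
      unfolding convergent_def by auto
    then show ?case by (simp add: Z_def convergent_LIMSEQ_iff)
  qed
  have Z: "Z \<in> borel_measurable M" using ZF F(1) by (metis measurable_from_subalg)
  have tail: "nrm (\<lambda>\<omega>. X (n + m) \<omega> - X n \<omega>) \<le> (\<Sum>k. a (k + n))" for n m
  proof -
    have "(\<lambda>\<omega>. X (n + m) \<omega> - X n \<omega>) = (\<lambda>\<omega>. \<Sum>k<m. X (Suc (k + n)) \<omega> - X (k + n) \<omega>)"
      using sum_lessThan_telescope[of "\<lambda>k. X (k + n) _" m] by (simp add: add.commute)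
    then have "nrm (\<lambda>\<omega>. X (n + m) \<omega> - X n \<omega>) \<le> (\<Sum>k<m. nrm (\<lambda>\<omega>. X (Suc (k + n)) \<omega> - X (k + n) \<omega>))"
      using D by (simp only:, intro nrm_sum_le) auto
    also have "\<dots> \<le> (\<Sum>k<m. a (k + n))" by (intro sum_mono a)
    also have "\<dots> \<le> (\<Sum>k. a (k + n))"
      using a0 a(2) by (intro sum_le_suminf) auto
    finally show ?thesis .
  qed
  \<comment> \<open>Fatou along \<open>m\<close> with \<open>n\<close> fixed, which turns the tail
    bound for differences into one for the distance to the limit.\<close>
  have fat: "sq_integrable (\<lambda>\<omega>. Z \<omega> - X n \<omega>) \<and> nrm (\<lambda>\<omega>. Z \<omega> - X n \<omega>) \<le> (\<Sum>k. a (k + n))" for n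
  proof (rule sq_integrable_Fatou)
    show "sq_integrable (\<lambda>\<omega>. X (n + m) \<omega> - X n \<omega>)" for m by (rule D)
    show "AE \<omega> in M. (\<lambda>m. X (n + m) \<omega> - X n \<omega>) \<longlonglongrightarrow> Z \<omega> - X n \<omega>"
      using lim
    proof eventually_elim
      case (elim \<omega>)
      then have "(\<lambda>m. X (m + n) \<omega>) \<longlonglongrightarrow> Z \<omega>" by (rule LIMSEQ_ignore_initial_segment)
      then show ?case by (intro tendsto_diff tendsto_const) (simp add: add.commute)
    qed
    show "(\<lambda>\<omega>. Z \<omega> - X n \<omega>) \<in> borel_measurable M"
      using Z X by (intro borel_measurable_diff) (auto simp: sq_integrable_def)
  qed (rule tail)
  have "sq_integrable Z"
    using sq_integrable_add[OF conjunct1[OF fat[of 0]] X[of 0]] by simp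
  moreover have "(\<lambda>n. nrm (\<lambda>\<omega>. Z \<omega> - X n \<omega>)) \<longlonglongrightarrow> 0"
  proof (rule tendsto_sandwich[OF _ _ tendsto_const])
    show "(\<lambda>n. \<Sum>k. a (k + n)) \<longlonglongrightarrow> 0" by (rule suminf_exist_split2[OF a(2)])
    show "\<forall>\<^sub>F n in sequentially. nrm (\<lambda>\<omega>. Z \<omega> - X n \<omega>) \<le> (\<Sum>k. a (k + n))"
      using fat by auto
  qed simp
  ultimately show ?thesis using ZF by blast
qed

lemma nrm_lim_le:
  assumes "\<And>n. sq_integrable (X n)" "sq_integrable Z"
    and "(\<lambda>n. nrm (\<lambda>\<omega>. Z \<omega> - X n \<omega>)) \<longlonglongrightarrow> 0"
    and "\<And>n. nrm (X n) \<le> b n" "b \<longlonglongrightarrow> B"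
  shows "nrm Z \<le> B"
proof (rule LIMSEQ_le_const)
  show "(\<lambda>n. nrm (\<lambda>\<omega>. Z \<omega> - X n \<omega>) + b n) \<longlonglongrightarrow> B"
    using tendsto_add[OF assms(3,5)] by simp
  have "nrm Z \<le> nrm (\<lambda>\<omega>. Z \<omega> - X n \<omega>) + b n" for n
    using nrm_triangle[of "\<lambda>\<omega>. Z \<omega> - X n \<omega>" "X n"] assms(1)[of n] assms(2) assms(4)[of n] by force
  then show "\<exists>N. \<forall>n\<ge>N. nrm Z \<le> nrm (\<lambda>\<omega>. Z \<omega> - X n \<omega>) + b n" by blast
qed

end

section \<open>Independence of Brownian increments from the past\<close>

locale brownian = prob_space P for P :: "'a measure" +
  fixes B :: "real \<Rightarrow> 'a \<Rightarrow> real ^ 'd"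
  assumes BM: "BM P B"
begin

definition inc :: "real \<Rightarrow> real \<Rightarrow> 'd \<Rightarrow> 'a \<Rightarrow> real" where
  "inc s t j \<omega> = B t \<omega> $ j - B s \<omega> $ j"

lemma standard_BM_component: "standard_BM P (\<lambda>t \<omega>. B t \<omega> $ j)"
  using BM by (auto simp: BM_def)

lemma component_measurable: "0 \<le> t \<Longrightarrow> (\<lambda>\<omega>. B t \<omega> $ j) \<in> borel_measurable P"
  using standard_BM_component[of j] by (auto simp: standard_BM_def)

lemma inc_measurable: "0 \<le> s \<Longrightarrow> 0 \<le> t \<Longrightarrow> inc s t j \<in> borel_measurable P"
  unfolding inc_def[abs_def] by (intro borel_measurable_diff component_measurable)

lemma indep_vars_components:
  "indep_vars (\<lambda>_. Pi\<^sub>M {0..} (\<lambda>_. borel)) (\<lambda>j \<omega>. \<lambda>t\<in>{0..}. B t \<omega> $ j) UNIV"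
  using BM by (auto simp: BM_def)

lemma indep_vars_inc_single:
  "0 \<le> t 0 \<Longrightarrow> mono t \<Longrightarrow> indep_vars (\<lambda>_. borel) (\<lambda>k. inc (t k) (t (Suc k)) j) {..<n::nat}"
  using standard_BM_component[of j] unfolding standard_BM_def inc_def[abs_def] by blast

text \<open>\<open>BM\<close> offers independence of the components as whole processes and
  independence of increments inside one component. The joint law factorises in that order, over
  \<open>j\<close> by events on paths and then over \<open>k\<close>.\<close>

lemma indep_vars_inc:
  fixes t :: "nat \<Rightarrow> real"
  assumes t: "0 \<le> t 0" "mono t"
  shows "indep_vars (\<lambda>_. borel) (\<lambda>(k, j). inc (t k) (t (Suc k)) j) ({..<n} \<times> UNIV)"
proof (cases "n = 0")
  case True
  then show ?thesis by (simp add: indep_vars_def2 indep_sets_def)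
next
  case False
  have t0: "0 \<le> t k" for k using t by (metis monoD order_trans zero_le)
  let ?F = "\<lambda>p. {(case p of (k, j) \<Rightarrow> inc (t k) (t (Suc k)) j) -` A \<inter> space P |A. A \<in> sets borel}"
  have rv: "inc (t k) (t (Suc k)) j \<in> borel_measurable P" for k j
    by (rule inc_measurable) (rule t0)+
  have "prob (\<Inter>p\<in>{..<n} \<times> UNIV. A p) = (\<Prod>p\<in>{..<n} \<times> UNIV. prob (A p))"
    if A: "A \<in> Pi ({..<n} \<times> UNIV) ?F" for A
  proof -
    have "\<forall>p\<in>{..<n} \<times> UNIV. \<exists>E. E \<in> sets borel \<and>
        A p = (case p of (k, j) \<Rightarrow> inc (t k) (t (Suc k)) j) -` E \<inter> space P"
    proof
      fix p :: "nat \<times> 'd" assume "p \<in> {..<n} \<times> UNIV"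
      then have "A p \<in> ?F p" using A by (rule Pi_mem[rotated])
      then show "\<exists>E. E \<in> sets borel \<and>
          A p = (case p of (k, j) \<Rightarrow> inc (t k) (t (Suc k)) j) -` E \<inter> space P" by blast
    qed
    then obtain E where E: "\<And>k j. k < n \<Longrightarrow> E (k, j) \<in> sets borel"
      and AE: "\<And>k j. k < n \<Longrightarrow> A (k, j) = inc (t k) (t (Suc k)) j -` E (k, j) \<inter> space P"
      unfolding bchoice_iff by (metis (no_types, lifting) SigmaI UNIV_I case_prod_conv lessThan_iff)
    \<comment> \<open>The events on the increments of component \<open>j\<close>, recast as one
      measurable set of paths, since \<open>indep_vars_components\<close> speaks about
      paths.\<close>
    define S where "S j = (\<Inter>k\<in>{..<n}. (\<lambda>f. f (t (Suc k)) - f (t k)) -` E (k, j) \<inter>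
        space (Pi\<^sub>M {0..} (\<lambda>_. borel :: real measure)))" for j
    have S: "S j \<in> sets (Pi\<^sub>M {0..} (\<lambda>_. borel))" for j
      unfolding S_def
    proof (rule sets.finite_INT)
      fix k assume "k \<in> {..<n}"
      show "(\<lambda>f. f (t (Suc k)) - f (t k)) -` E (k, j) \<inter> space (Pi\<^sub>M {0..} (\<lambda>_. borel))
          \<in> sets (Pi\<^sub>M {0..} (\<lambda>_. borel))"
        using \<open>k \<in> {..<n}\<close> t0
        by (intro measurable_sets[OF _ E] borel_measurable_diff measurable_component_singleton) auto
    qed (use False in auto)
    have eq: "(\<lambda>\<omega>. \<lambda>t\<in>{0..}. B t \<omega> $ j) -` S j \<inter> space P = (\<Inter>k\<in>{..<n}. A (k, j))" for j
      using False t0 by (auto simp: S_def AE space_PiM inc_def split: if_splits)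
    have "(\<Inter>p\<in>{..<n} \<times> UNIV. A p) = (\<Inter>j\<in>UNIV. (\<lambda>\<omega>. \<lambda>t\<in>{0..}. B t \<omega> $ j) -` S j \<inter> space P)"
      unfolding eq by auto
    also have "prob \<dots> = (\<Prod>j\<in>UNIV. prob (\<Inter>k\<in>{..<n}. A (k, j)))"
      unfolding eq[symmetric] by (rule indep_varsD_finite[OF indep_vars_components]) (auto simp: S)
    also have "\<dots> = (\<Prod>j\<in>UNIV. \<Prod>k\<in>{..<n}. prob (A (k, j)))"
    proof (rule prod.cong[OF refl])
      fix j
      have "prob (\<Inter>k\<in>{..<n}. inc (t k) (t (Suc k)) j -` E (k, j) \<inter> space P) =
          (\<Prod>k\<in>{..<n}. prob (inc (t k) (t (Suc k)) j -` E (k, j) \<inter> space P))"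
        using False E by (intro indep_varsD_finite[OF indep_vars_inc_single[OF t]]) auto
      then show "prob (\<Inter>k\<in>{..<n}. A (k, j)) = (\<Prod>k\<in>{..<n}. prob (A (k, j)))"
        by (simp add: AE)
    qed
    also have "\<dots> = (\<Prod>p\<in>{..<n} \<times> UNIV. prob (A p))"
      by (subst prod.swap) (simp add: prod.cartesian_product)
    finally show ?thesis .
  qed
  then show ?thesis
    using False rv unfolding indep_vars_def2
    by (subst indep_sets_finite) (auto intro: exI[of _ UNIV])
qed

text \<open>The past is generated by the increments from time 0, because \<open>B 0 = 0\<close> holds almost surely only.\<close>

definition past_gen :: "real \<Rightarrow> 'a set set" where
  "past_gen t = {{\<omega> \<in> space P. \<forall>p\<in>J. inc 0 (fst p) (snd p) \<omega> \<in> E p} | J E.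
     finite J \<and> J \<subseteq> {0..t} \<times> UNIV \<and> (\<forall>p. E p \<in> sets borel)}"

definition past :: "real \<Rightarrow> 'a measure" where
  "past t = sigma (space P) (past_gen t)"

lemma past_gen_Pow: "past_gen t \<subseteq> Pow (space P)"
  by (auto simp: past_gen_def)

lemma space_past [simp]: "space (past t) = space P"
  unfolding past_def by (simp add: past_gen_Pow)

lemma sets_past: "sets (past t) = sigma_sets (space P) (past_gen t)"
  unfolding past_def by (simp add: past_gen_Pow)

lemma past_gen_events: "past_gen t \<subseteq> events"
proof
  fix A assume "A \<in> past_gen t"
  then obtain J E where A: "A = {\<omega> \<in> space P. \<forall>p\<in>J. inc 0 (fst p) (snd p) \<omega> \<in> E p}"
    and J: "finite J" "J \<subseteq> {0..t} \<times> UNIV" and E: "\<And>p. E p \<in> sets borel"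
    unfolding past_gen_def by blast
  have "{\<omega> \<in> space P. inc 0 (fst p) (snd p) \<omega> \<in> E p} \<in> events" if "p \<in> J" for p
  proof -
    have "inc 0 (fst p) (snd p) -` E p \<inter> space P \<in> events"
      using that J E by (intro measurable_sets[OF inc_measurable]) auto
    then show ?thesis by (simp add: vimage_def Int_def conj_commute)
  qed
  then show "A \<in> events" unfolding A using J(1) by (intro sets.sets_Collect_finite_All) auto
qed

lemma subalgebra_past: "subalgebra P (past t)"
  unfolding subalgebra_def sets_past
  using past_gen_events by (auto intro!: sets.sigma_sets_subset)

lemma past_measurable: "X \<in> borel_measurable (past t) \<Longrightarrow> X \<in> borel_measurable P"
  using measurable_from_subalg[OF subalgebra_past] by blast

lemma past_mono: "s \<le> t \<Longrightarrow> sets (past s) \<subseteq> sets (past t)"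
proof -
  assume "s \<le> t"
  then have "J \<subseteq> {0..s} \<times> UNIV \<Longrightarrow> J \<subseteq> {0..t} \<times> UNIV" for J :: "(real \<times> 'd) set" by force
  then have "past_gen s \<subseteq> past_gen t" unfolding past_gen_def by blast
  then show ?thesis unfolding sets_past by (rule sigma_sets_mono')
qed

lemma measurable_past_mono:
  "X \<in> borel_measurable (past s) \<Longrightarrow> s \<le> t \<Longrightarrow> X \<in> borel_measurable (past t)"
  using past_mono[of s t] unfolding measurable_def by auto

lemma inc0_past:
  assumes "0 \<le> r" "r \<le> t"
  shows "inc 0 r j \<in> borel_measurable (past t)"
proof (rule measurableI)
  fix A :: "real set" assume A: "A \<in> sets borel"
  have "{\<omega> \<in> space P. \<forall>p\<in>{(r, j)}. inc 0 (fst p) (snd p) \<omega> \<in> A} \<in> past_gen t"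
    unfolding past_gen_def using A assms
    by (intro CollectI exI[of _ "{(r, j)}"] exI[of _ "\<lambda>_. A"]) auto
  then show "inc 0 r j -` A \<inter> space (past t) \<in> sets (past t)"
    unfolding sets_past by (auto simp: vimage_def Int_def conj_commute intro: sigma_sets.Basic)
qed simp

lemma inc_past:
  assumes "0 \<le> r" "r \<le> t" "0 \<le> s" "s \<le> t"
  shows "inc r s j \<in> borel_measurable (past t)"
proof -
  have "inc r s j = (\<lambda>\<omega>. inc 0 s j \<omega> - inc 0 r j \<omega>)" by (auto simp: inc_def)
  then show ?thesis using assms by (auto intro!: borel_measurable_diff inc0_past)
qed

text \<open>Closure under intersection is what lets independence pass from the generator to the
  generated sigma-algebra.\<close>

lemma Int_stable_past_gen: "Int_stable (past_gen t)"
proof (rule Int_stableI)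
  fix a b assume "a \<in> past_gen t" "b \<in> past_gen t"
  then obtain J E K F where a: "a = {\<omega> \<in> space P. \<forall>p\<in>J. inc 0 (fst p) (snd p) \<omega> \<in> E p}"
    and J: "finite J" "J \<subseteq> {0..t} \<times> UNIV" "\<And>p. E p \<in> sets borel"
    and b: "b = {\<omega> \<in> space P. \<forall>p\<in>K. inc 0 (fst p) (snd p) \<omega> \<in> F p}"
    and K: "finite K" "K \<subseteq> {0..t} \<times> UNIV" "\<And>p. F p \<in> sets borel"
    unfolding past_gen_def by blast
  show "a \<inter> b \<in> past_gen t"
    unfolding past_gen_def using J K
    by (intro CollectI exI[of _ "J \<union> K"]
        exI[of _ "\<lambda>p. (if p \<in> J then E p else UNIV) \<inter> (if p \<in> K then F p else UNIV)"])
      (auto simp: a b split: if_splits)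
qed

lemma inc_telescope:
  "(\<Sum>k<i. inc (t k) (t (Suc k)) j \<omega>) = inc (t 0) (t i) j \<omega>"
  using sum_lessThan_telescope[of "\<lambda>k. B (t k) \<omega> $ j" i] by (simp add: inc_def)

text \<open>An event of the generator involves finitely many times. On a grid through them every
  \<open>inc 0 r j\<close> with \<open>r\<close> at most \<open>s\<close> is a partial sum of
  increments before \<open>s\<close>, and these are independent of the increment over the final
  cell.\<close>

lemma indep_set_past_gen:
  assumes "0 \<le> s" "s \<le> u"
  shows "indep_set (past_gen s)
    {(\<lambda>\<omega> j. inc s u j \<omega>) -` C \<inter> space P |C. C \<in> sets (Pi\<^sub>M UNIV (\<lambda>_. borel))}"
proof (rule indep_setI)
  show "past_gen s \<subseteq> events" by (rule past_gen_events)
  have X: "(\<lambda>\<omega> j. inc s u j \<omega>) \<in> measurable P (Pi\<^sub>M UNIV (\<lambda>_. borel))"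
    using assms inc_measurable by (intro measurable_PiM_single') (auto simp: space_PiM)
  then show "{(\<lambda>\<omega> j. inc s u j \<omega>) -` C \<inter> space P |C. C \<in> sets (Pi\<^sub>M UNIV (\<lambda>_. borel))} \<subseteq> events"
    by (auto intro: measurable_sets)
  fix a b assume "a \<in> past_gen s"
    and "b \<in> {(\<lambda>\<omega> j. inc s u j \<omega>) -` C \<inter> space P |C. C \<in> sets (Pi\<^sub>M UNIV (\<lambda>_. borel))}"
  then obtain J E C where a: "a = {\<omega> \<in> space P. \<forall>p\<in>J. inc 0 (fst p) (snd p) \<omega> \<in> E p}"
    and J: "finite J" "J \<subseteq> {0..s} \<times> UNIV" "\<And>p. E p \<in> sets borel"
    and b: "b = (\<lambda>\<omega> j. inc s u j \<omega>) -` C \<inter> space P" and C: "C \<in> sets (Pi\<^sub>M UNIV (\<lambda>_. borel))"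
    unfolding past_gen_def by blast
  \<comment> \<open>Adding 0 and \<open>s\<close> makes the grid start at 0, so that partial sums
    are \<open>inc 0 r\<close>, and makes \<open>s\<close> its last past point.\<close>
  define R where "R = insert 0 (insert s (fst ` J))"
  have R: "finite R" "0 \<in> R" "s \<in> R" "R \<subseteq> {0..s}"
    using J assms by (auto simp: R_def)
  define L where "L = sorted_list_of_set R"
  have L: "set L = R" "sorted L" "distinct L" using R by (auto simp: L_def)
  define m where "m = length L - 1"
  have len: "length L = Suc m" using L(1) R(2) by (cases L) (auto simp: m_def)
  have idx: "\<exists>i\<le>m. L ! i = r" if "r \<in> R" for r
    using that L(1) len by (metis in_set_conv_nth less_Suc_eq_le)
  have L0: "L ! 0 = 0"
  proof -
    obtain i where "i \<le> m" "L ! i = 0" using idx R(2) by blast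
    then have "L ! 0 \<le> 0" using sorted_nth_mono[OF L(2), of 0 i] len by auto
    moreover have "L ! 0 \<in> R" using L(1) len by (metis nth_mem zero_less_Suc)
    ultimately show ?thesis using R(4) by auto
  qed
  have Lm: "L ! m = s"
  proof -
    obtain i where "i \<le> m" "L ! i = s" using idx R(3) by blast
    then have "s \<le> L ! m" using sorted_nth_mono[OF L(2), of i m] len by auto
    moreover have "L ! m \<in> R" using L(1) len by (metis nth_mem lessI)
    ultimately show ?thesis using R(4) by auto
  qed
  \<comment> \<open>Constant \<open>u\<close> beyond index \<open>m\<close>: cell \<open>m\<close>
    then runs from \<open>s\<close> to \<open>u\<close>, and \<open>t\<close> is monotone on all
    naturals, as \<open>indep_vars_inc\<close> asks.\<close>
  define t where "t k = (if k \<le> m then L ! k else u)" for k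
  have t: "t 0 = 0" "t m = s" "t (Suc m) = u" using L0 Lm by (auto simp: t_def)
  have "mono t"
  proof (rule monoI)
    fix x y :: nat assume "x \<le> y"
    have "L ! x \<le> s" if "x \<le> m" for x
      using that Lm sorted_nth_mono[OF L(2), of x m] len by auto
    then show "t x \<le> t y"
      using \<open>x \<le> y\<close> assms sorted_nth_mono[OF L(2) \<open>x \<le> y\<close>] len
      by (auto simp: t_def intro: order_trans)
  qed
  obtain i where i: "\<And>r. r \<in> R \<Longrightarrow> i r \<le> m \<and> t (i r) = r"
    using idx unfolding t_def by metis
  let ?X = "\<lambda>(k, j). inc (t k) (t (Suc k)) j"
  have iv: "indep_vars (\<lambda>_. borel) ?X ({..<Suc m} \<times> UNIV)"
    by (rule indep_vars_inc) (use t \<open>mono t\<close> in auto)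
  let ?A = "{..<m} \<times> (UNIV :: 'd set)" and ?B = "{m} \<times> (UNIV :: 'd set)"
  have ind: "indep_var (Pi\<^sub>M ?A (\<lambda>_. borel)) (\<lambda>\<omega>. restrict (\<lambda>p. ?X p \<omega>) ?A)
      (Pi\<^sub>M ?B (\<lambda>_. borel)) (\<lambda>\<omega>. restrict (\<lambda>p. ?X p \<omega>) ?B)"
    by (rule indep_var_restrict[OF iv]) auto
  define SA where "SA = {f \<in> space (Pi\<^sub>M ?A (\<lambda>_. borel)). \<forall>p\<in>J. (\<Sum>k<i (fst p). f (k, snd p)) \<in> E p}"
  have iJ: "i (fst p) \<le> m \<and> t (i (fst p)) = fst p" if "p \<in> J" for p
    using i that by (auto simp: R_def)
  have SA: "SA \<in> sets (Pi\<^sub>M ?A (\<lambda>_. borel))"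
    unfolding SA_def
  proof (rule sets.sets_Collect_finite_All)
    fix p assume p: "p \<in> J"
    have "(\<lambda>f. \<Sum>k<i (fst p). f (k, snd p) :: real) \<in> borel_measurable (Pi\<^sub>M ?A (\<lambda>_. borel))"
      using iJ[OF p] by (intro borel_measurable_sum measurable_component_singleton) auto
    then have "(\<lambda>f. \<Sum>k<i (fst p). f (k, snd p)) -` E p \<inter> space (Pi\<^sub>M ?A (\<lambda>_. borel))
        \<in> sets (Pi\<^sub>M ?A (\<lambda>_. borel))"
      using J(3) by (rule measurable_sets)
    then show "{f \<in> space (Pi\<^sub>M ?A (\<lambda>_. borel)). (\<Sum>k<i (fst p). f (k, snd p)) \<in> E p}
        \<in> sets (Pi\<^sub>M ?A (\<lambda>_. borel))"
      by (simp add: vimage_def Int_def conj_commute)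
  qed (rule J(1))
  define SB where "SB = (\<lambda>f j. f (m, j)) -` C \<inter> space (Pi\<^sub>M ?B (\<lambda>_. borel))"
  have SB: "SB \<in> sets (Pi\<^sub>M ?B (\<lambda>_. borel))"
    unfolding SB_def
    by (rule measurable_sets[OF _ C], rule measurable_PiM_single')
      (auto simp: space_PiM intro!: measurable_component_singleton)
  have sumX: "(\<Sum>k<i (fst p). restrict (\<lambda>p. ?X p \<omega>) ?A (k, snd p)) = inc 0 (fst p) (snd p) \<omega>"
    if "p \<in> J" for p \<omega>
    using iJ[OF that] inc_telescope[of t "snd p" \<omega> "i (fst p)"] t(1) by simp
  have a': "(\<lambda>\<omega>. restrict (\<lambda>p. ?X p \<omega>) ?A) -` SA \<inter> space P = a"
    unfolding a SA_def using sumX by (auto simp: space_PiM)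
  have b': "(\<lambda>\<omega>. restrict (\<lambda>p. ?X p \<omega>) ?B) -` SB \<inter> space P = b"
    unfolding b SB_def using t by (auto simp: space_PiM)
  have "prob (a \<inter> b) = prob ((\<lambda>\<omega>. (restrict (\<lambda>p. ?X p \<omega>) ?A, restrict (\<lambda>p. ?X p \<omega>) ?B)) -` (SA \<times> SB) \<inter> space P)"
    by (rule arg_cong[of _ _ prob]) (unfold a'[symmetric] b'[symmetric], blast)
  also have "\<dots> = prob a * prob b"
    using indep_varD[OF ind SA SB] unfolding a' b' .
  finally show "prob (a \<inter> b) = prob a * prob b" .
qed

text \<open>\<open>g\<close> takes the whole vector of components because covariations and the
  products over a block mix several of them.\<close>

lemma indep_var_past:
  assumes "0 \<le> s" "s \<le> u" and Y: "Y \<in> borel_measurable (past s)"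
    and g: "g \<in> borel_measurable (Pi\<^sub>M UNIV (\<lambda>_. borel))"
  shows "indep_var borel Y borel (\<lambda>\<omega>. g (\<lambda>j. inc s u j \<omega>) :: real)"
proof -
  let ?X = "\<lambda>\<omega> j. inc s u j \<omega>"
  let ?G = "{?X -` C \<inter> space P |C. C \<in> sets (Pi\<^sub>M UNIV (\<lambda>_. borel))}"
  have X: "?X \<in> measurable P (Pi\<^sub>M UNIV (\<lambda>_. borel))"
    using assms inc_measurable by (intro measurable_PiM_single') (auto simp: space_PiM)
  have "Int_stable ?G"
  proof (rule Int_stableI, clarify)
    fix C D :: "('d \<Rightarrow> real) set"
    assume "C \<in> sets (Pi\<^sub>M UNIV (\<lambda>_. borel))" "D \<in> sets (Pi\<^sub>M UNIV (\<lambda>_. borel))"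
    then show "\<exists>E. (?X -` C \<inter> space P) \<inter> (?X -` D \<inter> space P) = ?X -` E \<inter> space P \<and>
        E \<in> sets (Pi\<^sub>M UNIV (\<lambda>_. borel))"
      by (intro exI[of _ "C \<inter> D"]) auto
  qed
  then have ind: "indep_set (sets (past s)) (sigma_sets (space P) ?G)"
    unfolding sets_past
    by (intro indep_set_sigma_sets indep_set_past_gen Int_stable_past_gen assms)
  have 1: "sigma_sets (space P) {Y -` A \<inter> space P |A. A \<in> sets borel} \<subseteq> sets (past s)"
    using sets.sigma_sets_subset[of "{Y -` A \<inter> space P |A. A \<in> sets borel}" "past s"]
      measurable_sets[OF Y] by auto
  have 2: "sigma_sets (space P) {(\<lambda>\<omega>. g (?X \<omega>)) -` A \<inter> space P |A. A \<in> sets borel}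
      \<subseteq> sigma_sets (space P) ?G"
  proof (rule sigma_sets_mono', clarify)
    fix A :: "real set" assume "A \<in> sets borel"
    then show "\<exists>C. (\<lambda>\<omega>. g (?X \<omega>)) -` A \<inter> space P = ?X -` C \<inter> space P \<and>
        C \<in> sets (Pi\<^sub>M UNIV (\<lambda>_. borel))"
      using measurable_sets[OF g, of A]
      by (intro exI[of _ "g -` A \<inter> space (Pi\<^sub>M UNIV (\<lambda>_. borel))"]) (auto simp: space_PiM)
  qed
  have "(\<lambda>\<omega>. g (?X \<omega>)) \<in> borel_measurable P"
    using measurable_compose[OF X g] .
  moreover have "indep_set (sigma_sets (space P) {Y -` A \<inter> space P |A. A \<in> sets borel})
      (sigma_sets (space P) {(\<lambda>\<omega>. g (?X \<omega>)) -` A \<inter> space P |A. A \<in> sets borel})"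
    using ind 1 2 unfolding indep_sets2_eq by blast
  ultimately show ?thesis
    unfolding indep_var_eq using past_measurable[OF Y] by blast
qed

end

section \<open>Gaussian moments of words\<close>

definition gauss_moment :: "nat \<Rightarrow> real" where
  "gauss_moment k = (if even k then fact k / (2 ^ (k div 2) * fact (k div 2)) else 0)"

text \<open>Mean of the product of standard normals named by the letters, where equal letters denote
  the same variable and different letters independent ones.\<close>

definition word_moment :: "'d::finite list \<Rightarrow> real" where
  "word_moment x = (\<Prod>j\<in>UNIV. gauss_moment (count_list x j))"

lemma prod_list_map_count:
  fixes f :: "'d::finite \<Rightarrow> 'b::comm_monoid_mult"
  shows "prod_list (map f x) = (\<Prod>j\<in>UNIV. f j ^ count_list x j)"
proof (induction x)
  case (Cons a x)
  have "(\<Prod>j\<in>UNIV. f j ^ count_list (a # x) j) = (\<Prod>j\<in>UNIV. (if a = j then f j else 1) * f j ^ count_list x j)"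
    by (intro prod.cong) auto
  also have "\<dots> = f a * (\<Prod>j\<in>UNIV. f j ^ count_list x j)"
    by (simp add: prod.distrib)
  finally show ?case using Cons.IH by simp
qed simp

lemma sum_count_list_UNIV: "(\<Sum>j\<in>UNIV. count_list x j) = length (x :: 'd::finite list)"
  using sum_count_set[of x UNIV] by simp

lemma word_moment_zero: "odd (count_list x j) \<Longrightarrow> word_moment x = 0"
  unfolding word_moment_def by (intro prod_zero) (auto simp: gauss_moment_def)

lemma word_moment_odd: "odd (length x) \<Longrightarrow> word_moment x = 0"
  using dvd_sum[of UNIV 2 "count_list x"] word_moment_zero[of x] by (auto simp: sum_count_list_UNIV)

lemma word_moment_pair: "word_moment [i, j] = (if i = j then 1 else 0)"
proof (cases "i = j")
  case True
  then show ?thesis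
    unfolding word_moment_def by (auto simp: gauss_moment_def intro!: prod.neutral)
qed (use word_moment_zero[of "[i, j]" i] in simp)

lemma word_moment_quad: "word_moment [i, i, j, j] = (if i = j then 3 else 1)"
proof -
  have "word_moment [i, i, j, j] = (\<Prod>k\<in>UNIV. if k = i \<and> i = j then 3 else 1)"
    unfolding word_moment_def by (intro prod.cong) (auto simp: gauss_moment_def fact_numeral)
  then show ?thesis by (cases "i = j") auto
qed

context brownian
begin

lemma inc_moment:
  assumes "0 \<le> s" "s \<le> u"
  shows "integrable P (\<lambda>\<omega>. inc s u j \<omega> ^ k)" (is ?int)
    and "(\<integral>\<omega>. inc s u j \<omega> ^ k \<partial>P) = (if even k then (u - s) ^ (k div 2) else 0) * gauss_moment k" (is ?eq)
proof -
  have "?int \<and> ?eq"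
  proof (cases "s = u")
    \<comment> \<open>\<open>standard_BM\<close> prescribes no density for a null interval; the
      increment is 0 there and only the power \<open>k = 0\<close> has a nonzero mean.\<close>
    case True
    then show ?thesis
      by (auto simp: inc_def power_0_left gauss_moment_def prob_space elim!: evenE)
  next
    case False
    then have su: "s < u" using assms by simp
    let ?\<sigma> = "sqrt (u - s)"
    have \<sigma>: "0 < ?\<sigma>" using su by simp
    have D: "distributed P lborel (inc s u j) (normal_density 0 ?\<sigma>)"
      using standard_BM_component[of j] assms su
      unfolding standard_BM_def inc_def[abs_def] by blast
    have "integrable lborel (\<lambda>x. normal_density 0 ?\<sigma> x * x ^ k)"
      using integrable_normal_moment[OF \<sigma>, of 0 k] by simp
    then have "integrable P (\<lambda>\<omega>. inc s u j \<omega> ^ k)"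
      by (subst distributed_integrable[OF D, symmetric]) auto
    moreover have "(\<integral>\<omega>. inc s u j \<omega> ^ k \<partial>P) = (\<integral>x. normal_density 0 ?\<sigma> x * x ^ k \<partial>lborel)"
      by (rule distributed_integral[OF D, symmetric]) auto
    moreover have "\<dots> = (if even k then (u - s) ^ (k div 2) else 0) * gauss_moment k"
    proof (cases "even k")
      case True
      then obtain m where k: "k = 2 * m" by (elim evenE)
      show ?thesis
        using integral_normal_moment_even[OF \<sigma>, of 0 m] su
        by (simp add: k gauss_moment_def power_divide field_simps)
    next
      case False
      then obtain m where k: "k = 2 * m + 1" by (elim oddE)
      show ?thesis
        using integral_normal_moment_odd[OF \<sigma>, of 0 m] by (simp add: k gauss_moment_def)
    qed
    ultimately show ?thesis by simp
  qed
  then show ?int ?eq by auto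
qed

lemma indep_vars_inc_components:
  assumes "0 \<le> s" "s \<le> u"
  shows "indep_vars (\<lambda>_. borel) (\<lambda>j. inc s u j) UNIV"
proof -
  have "indep_vars (\<lambda>_. borel) (\<lambda>j \<omega>. (\<lambda>f. f u - f s) (\<lambda>t\<in>{0..}. B t \<omega> $ j)) UNIV"
    by (rule indep_vars_compose2[OF indep_vars_components])
      (use assms in \<open>auto intro!: borel_measurable_diff measurable_component_singleton\<close>)
  then show ?thesis using assms by (simp add: inc_def[abs_def])
qed

text \<open>Sorting the letters by component leaves a product of powers of independent variables.
  The rounding in \<open>length x div 2\<close> is harmless, as \<open>word_moment\<close> vanishes
  on odd lengths.\<close>

lemma inc_word_moment:
  assumes "0 \<le> s" "s \<le> u"
  shows "integrable P (\<lambda>\<omega>. prod_list (map (\<lambda>l. inc s u l \<omega>) x))"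
    and "expectation (\<lambda>\<omega>. prod_list (map (\<lambda>l. inc s u l \<omega>) x)) = (u - s) ^ (length x div 2) * word_moment x"
proof -
  have iv: "indep_vars (\<lambda>_. borel) (\<lambda>j \<omega>. inc s u j \<omega> ^ count_list x j) UNIV"
    by (rule indep_vars_compose2[OF indep_vars_inc_components[OF assms]]) auto
  show "integrable P (\<lambda>\<omega>. prod_list (map (\<lambda>l. inc s u l \<omega>) x))"
    unfolding prod_list_map_count
    by (rule indep_vars_integrable[OF _ iv]) (auto intro: inc_moment assms)
  have "expectation (\<lambda>\<omega>. prod_list (map (\<lambda>l. inc s u l \<omega>) x))
      = (\<Prod>j\<in>UNIV. (if even (count_list x j) then (u - s) ^ (count_list x j div 2) else 0) *
            gauss_moment (count_list x j))"
    unfolding prod_list_map_count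
    by (subst indep_vars_lebesgue_integral[OF _ iv]) (auto simp: inc_moment[OF assms])
  also have "\<dots> = (u - s) ^ (length x div 2) * word_moment x"
  proof (cases "\<forall>j. even (count_list x j)")
    case True
    then have "(\<Prod>j\<in>UNIV. (if even (count_list x j) then (u - s) ^ (count_list x j div 2) else 0)) =
        (u - s) ^ (\<Sum>j\<in>UNIV. count_list x j div 2)"
      by (simp add: power_sum)
    also have "2 * (\<Sum>j\<in>UNIV. count_list x j div 2) = length x"
      using True by (simp add: sum_distrib_left flip: sum_count_list_UNIV)
    then have "(\<Sum>j\<in>UNIV. count_list x j div 2) = length x div 2" by simp
    finally show ?thesis by (simp add: prod.distrib word_moment_def)
  next
    case False
    then obtain j where j: "odd (count_list x j)" by blast
    then have "word_moment x = 0" by (rule word_moment_zero)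
    moreover have "(\<Prod>j\<in>UNIV. (if even (count_list x j) then (u - s) ^ (count_list x j div 2) else 0) *
            gauss_moment (count_list x j)) = 0"
      using j by (intro prod_zero) (auto simp: gauss_moment_def)
    ultimately show ?thesis by simp
  qed
  finally show "expectation (\<lambda>\<omega>. prod_list (map (\<lambda>l. inc s u l \<omega>) x)) = (u - s) ^ (length x div 2) * word_moment x" .
qed

text \<open>This factorisation takes the place of conditioning on the past.\<close>

lemma past_mult_inc:
  fixes g :: "('d \<Rightarrow> real) \<Rightarrow> real"
  assumes "0 \<le> s" "s \<le> u" "H \<in> borel_measurable (past s)" "integrable P H"
    and "g \<in> borel_measurable (Pi\<^sub>M UNIV (\<lambda>_. borel))" "integrable P (\<lambda>\<omega>. g (\<lambda>j. inc s u j \<omega>))"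
  shows "integrable P (\<lambda>\<omega>. H \<omega> * g (\<lambda>j. inc s u j \<omega>))" (is ?int)
    and "(\<integral>\<omega>. H \<omega> * g (\<lambda>j. inc s u j \<omega>) \<partial>P) = expectation H * (\<integral>\<omega>. g (\<lambda>j. inc s u j \<omega>) \<partial>P)" (is ?eq)
proof -
  have "indep_var borel H borel (\<lambda>\<omega>. g (\<lambda>j. inc s u j \<omega>))"
    by (rule indep_var_past[OF assms(1,2,3,5)])
  then show ?int ?eq
    by (rule indep_var_integrable[OF _ assms(4,6)], rule indep_var_lebesgue_integral[OF _ assms(4,6)])
qed

section \<open>Martingale differences and orthogonal sums\<close>

definition past_sq :: "real \<Rightarrow> ('a \<Rightarrow> real) \<Rightarrow> bool" where
  "past_sq t Y \<longleftrightarrow> Y \<in> borel_measurable (past t) \<and> sq_integrable Y"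

lemma past_sqD: "past_sq t Y \<Longrightarrow> sq_integrable Y" "past_sq t Y \<Longrightarrow> Y \<in> borel_measurable (past t)"
  by (auto simp: past_sq_def)

lemma past_sq_mono: "past_sq s Y \<Longrightarrow> s \<le> t \<Longrightarrow> past_sq t Y"
  using measurable_past_mono by (auto simp: past_sq_def)

lemma past_sq_const [simp]: "past_sq t (\<lambda>\<omega>. c)"
  by (auto simp: past_sq_def)

lemma past_sq_add: "past_sq t X \<Longrightarrow> past_sq t Y \<Longrightarrow> past_sq t (\<lambda>\<omega>. X \<omega> + Y \<omega>)"
  by (auto simp: past_sq_def)

lemma past_sq_diff: "past_sq t X \<Longrightarrow> past_sq t Y \<Longrightarrow> past_sq t (\<lambda>\<omega>. X \<omega> - Y \<omega>)"
  by (auto simp: past_sq_def)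

lemma past_sq_cmult: "past_sq t X \<Longrightarrow> past_sq t (\<lambda>\<omega>. c * X \<omega>)"
  by (auto simp: past_sq_def)

lemma past_sq_sum: "(\<And>i. i \<in> I \<Longrightarrow> past_sq t (X i)) \<Longrightarrow> past_sq t (\<lambda>\<omega>. \<Sum>i\<in>I. X i \<omega>)"
  by (auto simp: past_sq_def intro!: borel_measurable_sum)

text \<open>Martingale differences, as orthogonality to the past.\<close>

definition mdiff :: "real \<Rightarrow> real \<Rightarrow> ('a \<Rightarrow> real) \<Rightarrow> bool" where
  "mdiff s t U \<longleftrightarrow> past_sq t U \<and> (\<forall>H. past_sq s H \<longrightarrow> (\<integral>\<omega>. H \<omega> * U \<omega> \<partial>P) = 0)"

lemma mdiffD: "mdiff s t U \<Longrightarrow> past_sq t U" "mdiff s t U \<Longrightarrow> past_sq s H \<Longrightarrow> (\<integral>\<omega>. H \<omega> * U \<omega> \<partial>P) = 0"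
  by (auto simp: mdiff_def)

lemma mdiff_mono: "mdiff s t U \<Longrightarrow> s' \<le> s \<Longrightarrow> t \<le> t' \<Longrightarrow> mdiff s' t' U"
  unfolding mdiff_def using past_sq_mono by blast

lemma mdiff_integral: "mdiff s t U \<Longrightarrow> expectation U = 0"
  using mdiffD(2)[of s t U "\<lambda>_. 1"] by simp

lemma mdiff_sum:
  assumes "\<And>i. i \<in> I \<Longrightarrow> mdiff s t (U i)"
  shows "mdiff s t (\<lambda>\<omega>. \<Sum>i\<in>I. U i \<omega>)"
  unfolding mdiff_def
proof (intro conjI allI impI past_sq_sum)
  fix H assume H: "past_sq s H"
  have "integrable P (\<lambda>\<omega>. H \<omega> * U i \<omega>)" if "i \<in> I" for i
    using assms[OF that] H by (intro sq_integrable_mult) (auto simp: mdiff_def past_sq_def)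
  then show "(\<integral>\<omega>. H \<omega> * (\<Sum>i\<in>I. U i \<omega>) \<partial>P) = 0"
    using mdiffD(2)[OF assms H] by (simp add: sum_distrib_left)
qed (use assms in \<open>auto simp: mdiff_def\<close>)

lemma mdiff_diff:
  assumes "mdiff s t U" "mdiff s t V"
  shows "mdiff s t (\<lambda>\<omega>. U \<omega> - V \<omega>)"
  unfolding mdiff_def
proof (intro conjI allI impI past_sq_diff)
  fix H assume H: "past_sq s H"
  have "integrable P (\<lambda>\<omega>. H \<omega> * U \<omega>)" "integrable P (\<lambda>\<omega>. H \<omega> * V \<omega>)"
    using assms H by (auto intro!: sq_integrable_mult simp: mdiff_def past_sq_def)
  then show "(\<integral>\<omega>. H \<omega> * (U \<omega> - V \<omega>) \<partial>P) = 0"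
    using mdiffD(2)[OF assms(1) H] mdiffD(2)[OF assms(2) H] by (simp add: right_diff_distrib)
qed (use assms in \<open>auto simp: mdiff_def\<close>)

text \<open>Testing against a fixed \<open>H\<close> in L2 is continuous in L2, so orthogonality to
  the past survives limits. This is how the Ito integral inherits it from its sums.\<close>

lemma mdiff_lim:
  assumes U: "\<And>n. mdiff s t (U n)" and Z: "past_sq t Z"
    and lim: "(\<lambda>n. nrm (\<lambda>\<omega>. Z \<omega> - U n \<omega>)) \<longlonglongrightarrow> 0"
  shows "mdiff s t Z"
  unfolding mdiff_def
proof (intro conjI allI impI Z)
  fix H assume H: "past_sq s H"
  have "\<bar>\<integral>\<omega>. H \<omega> * Z \<omega> \<partial>P\<bar> \<le> nrm H * nrm (\<lambda>\<omega>. Z \<omega> - U n \<omega>)" for n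
  proof -
    have sq: "sq_integrable H" "sq_integrable Z" "sq_integrable (U n)"
      using H Z U[of n] by (auto simp: mdiff_def past_sq_def)
    have "(\<integral>\<omega>. H \<omega> * (Z \<omega> - U n \<omega>) \<partial>P) = (\<integral>\<omega>. H \<omega> * Z \<omega> \<partial>P)"
      using sq_integrable_mult[OF sq(1,2)] sq_integrable_mult[OF sq(1,3)] mdiffD(2)[OF U H]
      by (simp add: right_diff_distrib)
    then show ?thesis using abs_integral_mult_le[OF sq(1) sq_integrable_diff[OF sq(2,3)]] by simp
  qed
  moreover have "(\<lambda>n. nrm H * nrm (\<lambda>\<omega>. Z \<omega> - U n \<omega>)) \<longlonglongrightarrow> nrm H * 0"
    by (intro tendsto_mult tendsto_const lim)
  ultimately have "\<bar>\<integral>\<omega>. H \<omega> * Z \<omega> \<partial>P\<bar> \<le> nrm H * 0"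
    by (intro LIMSEQ_le_const) auto
  then show "(\<integral>\<omega>. H \<omega> * Z \<omega> \<partial>P) = 0" by simp
qed

text \<open>Pythagoras: the partial sum up to \<open>n\<close> belongs to the past at
  \<open>r n\<close> and is thus itself an admissible test variable for \<open>U n\<close>.\<close>

lemma mdiff_orthogonal:
  assumes "mono r" "\<And>k. k < n \<Longrightarrow> mdiff (r k) (r (Suc k)) (U k)"
  shows "past_sq (r n) (\<lambda>\<omega>. \<Sum>k<n. U k \<omega>) \<and> (nrm (\<lambda>\<omega>. \<Sum>k<n. U k \<omega>))\<^sup>2 = (\<Sum>k<n. (nrm (U k))\<^sup>2)"
  using assms(2)
proof (induction n)
  case 0
  then show ?case by (simp add: nrm_const)
next
  case (Suc n)
  let ?S = "\<lambda>\<omega>. \<Sum>k<n. U k \<omega>"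
  have IH: "past_sq (r n) ?S" "(nrm ?S)\<^sup>2 = (\<Sum>k<n. (nrm (U k))\<^sup>2)" using Suc by auto
  have U: "mdiff (r n) (r (Suc n)) (U n)" using Suc.prems by simp
  have sq: "sq_integrable ?S" "sq_integrable (U n)" using IH(1) mdiffD(1)[OF U] by (auto dest: past_sqD)
  have "(nrm (\<lambda>\<omega>. ?S \<omega> + U n \<omega>))\<^sup>2 = (\<integral>\<omega>. ((?S \<omega>)\<^sup>2 + (U n \<omega>)\<^sup>2) + 2 * (?S \<omega> * U n \<omega>) \<partial>P)"
    by (simp add: nrm_square power2_sum mult.assoc)
  also have "\<dots> = (nrm ?S)\<^sup>2 + (nrm (U n))\<^sup>2 + 2 * (\<integral>\<omega>. ?S \<omega> * U n \<omega> \<partial>P)"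
    using sq sq_integrable_mult[OF sq] by (simp add: nrm_square sq_integrable_square)
  also have "(\<integral>\<omega>. ?S \<omega> * U n \<omega> \<partial>P) = 0" by (rule mdiffD(2)[OF U IH(1)])
  finally have "(nrm (\<lambda>\<omega>. ?S \<omega> + U n \<omega>))\<^sup>2 = (nrm ?S)\<^sup>2 + (nrm (U n))\<^sup>2" by simp
  moreover have "past_sq (r (Suc n)) (\<lambda>\<omega>. ?S \<omega> + U n \<omega>)"
    using past_sq_mono[OF IH(1), of "r (Suc n)"] \<open>mono r\<close> mdiffD(1)[OF U]
    by (intro past_sq_add) (auto simp: monoD)
  ultimately show ?case using IH(2) by simp
qed

text \<open>Independence makes the second moment of the product equal to the product of the second
  moments, so multiplying an L2 variable of the past by a square integrable function of the next
  increment does not lead out of L2.\<close>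

lemma mdiff_mult_inc:
  assumes su: "0 \<le> s" "s \<le> u" and H: "past_sq s H"
    and g: "g \<in> borel_measurable (Pi\<^sub>M UNIV (\<lambda>_. borel))"
    and sq: "integrable P (\<lambda>\<omega>. (g (\<lambda>j. inc s u j \<omega>))\<^sup>2)" and mean: "(\<integral>\<omega>. g (\<lambda>j. inc s u j \<omega>) \<partial>P) = 0"
  shows "mdiff s u (\<lambda>\<omega>. H \<omega> * g (\<lambda>j. inc s u j \<omega>))"
    and "(nrm (\<lambda>\<omega>. H \<omega> * g (\<lambda>j. inc s u j \<omega>)))\<^sup>2 = (nrm H)\<^sup>2 * (\<integral>\<omega>. (g (\<lambda>j. inc s u j \<omega>))\<^sup>2 \<partial>P)"
proof -
  let ?g = "\<lambda>\<omega>. g (\<lambda>j. inc s u j \<omega>)"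
  have "(\<lambda>\<omega> j. inc s u j \<omega>) \<in> measurable (past u) (Pi\<^sub>M UNIV (\<lambda>_. borel))"
    using su by (intro measurable_PiM_single') (auto simp: space_PiM intro!: inc_past)
  then have gm: "?g \<in> borel_measurable (past u)" by (rule measurable_compose[OF _ g])
  have Hm: "H \<in> borel_measurable (past s)" "sq_integrable H" using H by (auto simp: past_sq_def)
  have gint: "integrable P ?g"
    using square_integrable_imp_integrable[OF past_measurable[OF gm] sq] .
  have g2: "(\<lambda>x. (g x)\<^sup>2) \<in> borel_measurable (Pi\<^sub>M UNIV (\<lambda>_. borel))" using g by simp
  have H2: "(\<lambda>\<omega>. (H \<omega>)\<^sup>2) \<in> borel_measurable (past s)" "integrable P (\<lambda>\<omega>. (H \<omega>)\<^sup>2)"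
    using Hm by (auto intro: sq_integrable_square)
  note m2 = past_mult_inc[OF su H2 g2 sq]
  have "(\<lambda>\<omega>. H \<omega> * ?g \<omega>) \<in> borel_measurable (past u)"
    using measurable_past_mono[OF Hm(1) su(2)] gm by simp
  then have past: "past_sq u (\<lambda>\<omega>. H \<omega> * ?g \<omega>)"
    using m2(1) past_measurable by (auto simp: past_sq_def sq_integrable_def power_mult_distrib)
  show "mdiff s u (\<lambda>\<omega>. H \<omega> * ?g \<omega>)"
    unfolding mdiff_def
  proof (intro conjI allI impI past)
    fix K assume K: "past_sq s K"
    have KH: "(\<lambda>\<omega>. K \<omega> * H \<omega>) \<in> borel_measurable (past s)" "integrable P (\<lambda>\<omega>. K \<omega> * H \<omega>)"
      using K Hm by (auto simp: past_sq_def intro!: sq_integrable_mult)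
    show "(\<integral>\<omega>. K \<omega> * (H \<omega> * ?g \<omega>) \<partial>P) = 0"
      using past_mult_inc(2)[OF su KH g gint] mean by (simp add: mult.assoc)
  qed
  show "(nrm (\<lambda>\<omega>. H \<omega> * ?g \<omega>))\<^sup>2 = (nrm H)\<^sup>2 * (\<integral>\<omega>. (?g \<omega>)\<^sup>2 \<partial>P)"
    using m2(2) by (simp add: nrm_square power_mult_distrib)
qed

lemma inc_mean: "0 \<le> s \<Longrightarrow> s \<le> u \<Longrightarrow> (\<integral>\<omega>. inc s u j \<omega> \<partial>P) = 0"
  using inc_moment(2)[of s u j 1] by (simp add: gauss_moment_def)

lemma inc_variance: "0 \<le> s \<Longrightarrow> s \<le> u \<Longrightarrow> (\<integral>\<omega>. (inc s u j \<omega>)\<^sup>2 \<partial>P) = u - s"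
  using inc_moment(2)[of s u j 2] by (simp add: gauss_moment_def)

lemma mdiff_mult_inc1:
  assumes su: "0 \<le> s" "s \<le> u" and H: "past_sq s H"
  shows "mdiff s u (\<lambda>\<omega>. H \<omega> * inc s u j \<omega>)" (is ?md)
    and "(nrm (\<lambda>\<omega>. H \<omega> * inc s u j \<omega>))\<^sup>2 = (nrm H)\<^sup>2 * (u - s)" (is ?nrm)
proof -
  have g: "(\<lambda>x. x j :: real) \<in> borel_measurable (Pi\<^sub>M UNIV (\<lambda>_. borel))"
    by (rule measurable_component_singleton) simp
  show ?md ?nrm
    using mdiff_mult_inc[OF su H g] inc_moment(1)[OF su, of j 2] inc_mean[OF su] inc_variance[OF su]
    by auto
qed

text \<open>The second moment is (3 - 1) times \<open>(u - s)\<^sup>2\<close> for equal components,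
  by the fourth Gaussian moment, and once \<open>(u - s)\<^sup>2\<close> for distinct ones; the
  factor 2 bounds both.\<close>

lemma inc_covariation:
  assumes su: "0 \<le> s" "s \<le> u"
  shows "(\<integral>\<omega>. inc s u i \<omega> * inc s u j \<omega> - (if i = j then u - s else 0) \<partial>P) = 0"
    and "integrable P (\<lambda>\<omega>. (inc s u i \<omega> * inc s u j \<omega> - (if i = j then u - s else 0))\<^sup>2)"
    and "(\<integral>\<omega>. (inc s u i \<omega> * inc s u j \<omega> - (if i = j then u - s else 0))\<^sup>2 \<partial>P) \<le> 2 * (u - s)\<^sup>2"
proof -
  let ?d = "if i = j then u - s else 0 :: real"
  have m2: "integrable P (\<lambda>\<omega>. inc s u i \<omega> * inc s u j \<omega>)"
    "(\<integral>\<omega>. inc s u i \<omega> * inc s u j \<omega> \<partial>P) = ?d"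
  proof -
    show "integrable P (\<lambda>\<omega>. inc s u i \<omega> * inc s u j \<omega>)"
      "(\<integral>\<omega>. inc s u i \<omega> * inc s u j \<omega> \<partial>P) = ?d"
      using inc_word_moment[OF su, of "[i, j]"] by (auto simp: word_moment_pair)
  qed
  then show "(\<integral>\<omega>. inc s u i \<omega> * inc s u j \<omega> - ?d \<partial>P) = 0"
    by (simp add: prob_space)
  have m4: "integrable P (\<lambda>\<omega>. (inc s u i \<omega> * inc s u j \<omega>)\<^sup>2)"
    "(\<integral>\<omega>. (inc s u i \<omega> * inc s u j \<omega>)\<^sup>2 \<partial>P) = (u - s)\<^sup>2 * word_moment [i, i, j, j]"
    using inc_word_moment[OF su, of "[i, i, j, j]"] by (auto simp: power2_eq_square ac_simps)
  have eq: "(inc s u i \<omega> * inc s u j \<omega> - ?d)\<^sup>2 =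
      (inc s u i \<omega> * inc s u j \<omega>)\<^sup>2 + (?d\<^sup>2 - 2 * ?d * (inc s u i \<omega> * inc s u j \<omega>))" for \<omega>
    by (simp add: power2_diff)
  show "integrable P (\<lambda>\<omega>. (inc s u i \<omega> * inc s u j \<omega> - ?d)\<^sup>2)"
    unfolding eq using m2 m4 by (intro Bochner_Integration.integrable_add Bochner_Integration.integrable_diff
      integrable_mult_right) auto
  have "(\<integral>\<omega>. (inc s u i \<omega> * inc s u j \<omega> - ?d)\<^sup>2 \<partial>P) =
      (u - s)\<^sup>2 * word_moment [i, i, j, j] - ?d\<^sup>2"
    unfolding eq using m2 m4 by (simp add: prob_space power2_eq_square)
  also have "\<dots> \<le> 2 * (u - s)\<^sup>2" by (simp add: word_moment_quad)
  finally show "(\<integral>\<omega>. (inc s u i \<omega> * inc s u j \<omega> - ?d)\<^sup>2 \<partial>P) \<le> 2 * (u - s)\<^sup>2" .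
qed

text \<open>The norm is of the order of the cell length, just like the remainder of an Ito integral
  over the cell, so both kinds of error sum in the same way.\<close>

lemma mdiff_mult_covariation:
  fixes i j :: 'd
  assumes su: "0 \<le> s" "s \<le> u" and H: "past_sq s H"
  defines "Q \<equiv> \<lambda>\<omega>. inc s u i \<omega> * inc s u j \<omega> - (if i = j then u - s else 0)"
  shows "mdiff s u (\<lambda>\<omega>. H \<omega> * Q \<omega>)"
    and "(nrm (\<lambda>\<omega>. H \<omega> * Q \<omega>))\<^sup>2 \<le> (nrm H)\<^sup>2 * (2 * (u - s)\<^sup>2)"
proof -
  let ?g = "\<lambda>x. x i * x j - (if i = j then u - s else 0) :: real"
  have c: "(\<lambda>x. x k :: real) \<in> borel_measurable (Pi\<^sub>M UNIV (\<lambda>_. borel))" for k :: 'd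
    by (rule measurable_component_singleton) simp
  have g: "?g \<in> borel_measurable (Pi\<^sub>M UNIV (\<lambda>_. borel))"
    by (intro borel_measurable_diff borel_measurable_times c borel_measurable_const)
  show "mdiff s u (\<lambda>\<omega>. H \<omega> * Q \<omega>)"
    using mdiff_mult_inc(1)[OF su H g inc_covariation(2,1)[OF su]] by (simp add: Q_def)
  show "(nrm (\<lambda>\<omega>. H \<omega> * Q \<omega>))\<^sup>2 \<le> (nrm H)\<^sup>2 * (2 * (u - s)\<^sup>2)"
    using mdiff_mult_inc(2)[OF su H g inc_covariation(2,1)[OF su]]
      mult_left_mono[OF inc_covariation(3)[OF su, of i j], of "(nrm H)\<^sup>2"] by (simp add: Q_def)
qed

end

section \<open>Stochastic integrals as limits of left-point sums\<close>

lemma sum_lessThan_double: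
  fixes f :: "nat \<Rightarrow> 'b::comm_monoid_add"
  shows "(\<Sum>l<2 * n. f l) = (\<Sum>k<n. f (2 * k) + f (Suc (2 * k)))"
  by (induction n) (simp_all add: add.assoc)

text \<open>Restricts a grid on the whole time interval to a subinterval: cells outside it collapse
  to a point and contribute no increment.\<close>

definition clip :: "real \<Rightarrow> real \<Rightarrow> real \<Rightarrow> real" where
  "clip s t x = max s (min t x)"

lemma mono_clip: "x \<le> y \<Longrightarrow> clip s t x \<le> clip s t y"
  by (auto simp: clip_def)

context brownian
begin

text \<open>Only L2 regularity at single times is recorded, nothing about paths. Both integrals map
  the class into itself, which is what an induction over letters requires.\<close>

definition nice :: "real \<Rightarrow> (real \<Rightarrow> 'a \<Rightarrow> real) \<Rightarrow> bool" where
  "nice T Y \<longleftrightarrow> (\<forall>t. 0 \<le> t \<longrightarrow> t \<le> T \<longrightarrow> past_sq t (Y t)) \<and>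
     (\<exists>C\<ge>0. \<forall>s t. 0 \<le> s \<longrightarrow> s \<le> t \<longrightarrow> t \<le> T \<longrightarrow>
        nrm (Y t) \<le> C \<and> nrm (\<lambda>\<omega>. Y t \<omega> - Y s \<omega>) \<le> C * sqrt (t - s))"

lemma nice_past: "nice T Y \<Longrightarrow> 0 \<le> t \<Longrightarrow> t \<le> T \<Longrightarrow> past_sq t (Y t)"
  by (auto simp: nice_def)

lemma nice_sq: "nice T Y \<Longrightarrow> 0 \<le> t \<Longrightarrow> t \<le> T \<Longrightarrow> sq_integrable (Y t)"
  by (auto dest: nice_past past_sqD)

lemma nice_const: "nice T (\<lambda>t \<omega>. c)"
  unfolding nice_def by (auto simp: nrm_const intro!: exI[of _ "\<bar>c\<bar>"])

lemma nice_add_cmult: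
  assumes X: "nice T X" and Y: "nice T Y"
  shows "nice T (\<lambda>t \<omega>. X t \<omega> + c * Y t \<omega>)"
proof -
  obtain C where C: "0 \<le> C" "\<And>t. 0 \<le> t \<Longrightarrow> t \<le> T \<Longrightarrow> nrm (X t) \<le> C"
    "\<And>s t. 0 \<le> s \<Longrightarrow> s \<le> t \<Longrightarrow> t \<le> T \<Longrightarrow> nrm (\<lambda>\<omega>. X t \<omega> - X s \<omega>) \<le> C * sqrt (t - s)"
    using X unfolding nice_def by blast
  obtain D where D: "0 \<le> D" "\<And>t. 0 \<le> t \<Longrightarrow> t \<le> T \<Longrightarrow> nrm (Y t) \<le> D"
    "\<And>s t. 0 \<le> s \<Longrightarrow> s \<le> t \<Longrightarrow> t \<le> T \<Longrightarrow> nrm (\<lambda>\<omega>. Y t \<omega> - Y s \<omega>) \<le> D * sqrt (t - s)"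
    using Y unfolding nice_def by blast
  have sX: "sq_integrable (X t)" and sY: "sq_integrable (Y t)" if "0 \<le> t" "t \<le> T" for t
    using nice_sq that X Y by auto
  have 1: "nrm (\<lambda>\<omega>. X t \<omega> + c * Y t \<omega>) \<le> C + \<bar>c\<bar> * D" if t: "0 \<le> t" "t \<le> T" for t
  proof -
    have "nrm (\<lambda>\<omega>. X t \<omega> + c * Y t \<omega>) \<le> nrm (X t) + nrm (\<lambda>\<omega>. c * Y t \<omega>)"
      using sX[OF t] sY[OF t] by (intro nrm_triangle sq_integrable_cmult)
    then show ?thesis using C(2)[OF t] D(2)[OF t] mult_left_mono[OF D(2)[OF t], of "\<bar>c\<bar>"]
      by (simp add: nrm_cmult)
  qed
  have 2: "nrm (\<lambda>\<omega>. (X t \<omega> + c * Y t \<omega>) - (X s \<omega> + c * Y s \<omega>)) \<le> (C + \<bar>c\<bar> * D) * sqrt (t - s)"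
    if st: "0 \<le> s" "s \<le> t" "t \<le> T" for s t
  proof -
    have e: "(\<lambda>\<omega>. (X t \<omega> + c * Y t \<omega>) - (X s \<omega> + c * Y s \<omega>)) =
        (\<lambda>\<omega>. (X t \<omega> - X s \<omega>) + c * (Y t \<omega> - Y s \<omega>))" by (auto simp: algebra_simps)
    have "nrm (\<lambda>\<omega>. (X t \<omega> - X s \<omega>) + c * (Y t \<omega> - Y s \<omega>)) \<le> nrm (\<lambda>\<omega>. X t \<omega> - X s \<omega>) + nrm (\<lambda>\<omega>. c * (Y t \<omega> - Y s \<omega>))"
      using sX sY st by (intro nrm_triangle sq_integrable_cmult sq_integrable_diff) auto
    moreover have "\<bar>c\<bar> * nrm (\<lambda>\<omega>. Y t \<omega> - Y s \<omega>) \<le> \<bar>c\<bar> * (D * sqrt (t - s))"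
      using D(3)[OF st] by (intro mult_left_mono) auto
    ultimately show ?thesis using C(3)[OF st]
      unfolding e nrm_cmult distrib_right mult.assoc by linarith
  qed
  show ?thesis
    unfolding nice_def
    using nice_past[OF X] nice_past[OF Y] C(1) D(1) 1 2
    by (intro conjI exI[of _ "C + \<bar>c\<bar> * D"]) (auto intro!: past_sq_add past_sq_cmult)
qed

text \<open>Treats \<open>dB\<close> (with \<open>\<kappa> = 1\<close>) and \<open>dt\<close> (with \<open>\<kappa> x = x\<close>) together. Null intervals are exempt from the
  condition on \<open>H\<close>, so that a grid may be clipped to a subinterval.\<close>

definition integrator :: "real \<Rightarrow> (real \<Rightarrow> real) \<Rightarrow> (real \<Rightarrow> 'a \<Rightarrow> real) \<Rightarrow> bool" where
  "integrator T \<kappa> A \<longleftrightarrow> (\<forall>r N H h. mono r \<longrightarrow> 0 \<le> r 0 \<longrightarrow> r N \<le> T \<longrightarrow> 0 \<le> h \<longrightarrow>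
     (\<forall>k<N. r k < r (Suc k) \<longrightarrow> past_sq (r k) (H k) \<and> nrm (H k) \<le> h) \<longrightarrow>
     past_sq (r N) (\<lambda>\<omega>. \<Sum>k<N. H k \<omega> * (A (r (Suc k)) \<omega> - A (r k) \<omega>)) \<and>
     (nrm (\<lambda>\<omega>. \<Sum>k<N. H k \<omega> * (A (r (Suc k)) \<omega> - A (r k) \<omega>)))\<^sup>2
       \<le> \<kappa> (r N - r 0) * h\<^sup>2 * (r N - r (0::nat)))"

text \<open>Ito isometry: the summands are orthogonal, so their squared norms add up to at most
  \<open>h\<^sup>2\<close> times the length.\<close>

lemma integrator_component: "integrator T (\<lambda>_. 1) (\<lambda>t \<omega>. B t \<omega> $ i)"
  unfolding integrator_def
proof (intro allI impI)
  fix r :: "nat \<Rightarrow> real" and N H and h :: real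
  assume r: "mono r" "0 \<le> r 0" "r N \<le> T" and h: "0 \<le> h"
    and H: "\<forall>k<N. r k < r (Suc k) \<longrightarrow> past_sq (r k) (H k) \<and> nrm (H k) \<le> h"
  have r0: "0 \<le> r k" "r k \<le> r (Suc k)" for k
    using r by (auto intro: order_trans[of 0 "r 0"] monoD)
  \<comment> \<open>\<open>H k\<close> is unrestricted on null intervals; replacing it by 0 there
    changes nothing since the increment vanishes.\<close>
  define U where "U k = (\<lambda>\<omega>. (if r k < r (Suc k) then H k \<omega> else 0) * inc (r k) (r (Suc k)) i \<omega>)" for k
  have U: "mdiff (r k) (r (Suc k)) (U k) \<and> (nrm (U k))\<^sup>2 \<le> h\<^sup>2 * (r (Suc k) - r k)" if "k < N" for k
  proof (cases "r k < r (Suc k)")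
    case True
    then have p: "past_sq (r k) (H k)" "nrm (H k) \<le> h" using H that by auto
    have "(nrm (H k))\<^sup>2 * (r (Suc k) - r k) \<le> h\<^sup>2 * (r (Suc k) - r k)"
      using p(2) r0(2)[of k] by (intro mult_right_mono power_mono) auto
    then show ?thesis using mdiff_mult_inc1[OF r0 p(1), of i] True by (simp add: U_def)
  next
    case False
    then have "U k = (\<lambda>\<omega>. 0)" by (simp add: U_def)
    then show ?thesis using r0(2)[of k] by (simp add: mdiff_def nrm_const)
  qed
  have eq: "(\<Sum>k<N. H k \<omega> * (B (r (Suc k)) \<omega> $ i - B (r k) \<omega> $ i)) = (\<Sum>k<N. U k \<omega>)" for \<omega>
    using r0(2) by (intro sum.cong) (auto simp: U_def inc_def not_less dest: antisym)
  have "(\<Sum>k<N. (nrm (U k))\<^sup>2) \<le> (\<Sum>k<N. h\<^sup>2 * (r (Suc k) - r k))"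
    using U by (intro sum_mono) auto
  also have "\<dots> = h\<^sup>2 * (r N - r 0)"
    by (simp only: sum_distrib_left[symmetric] sum_lessThan_telescope)
  finally show "past_sq (r N) (\<lambda>\<omega>. \<Sum>k<N. H k \<omega> * (B (r (Suc k)) \<omega> $ i - B (r k) \<omega> $ i)) \<and>
     (nrm (\<lambda>\<omega>. \<Sum>k<N. H k \<omega> * (B (r (Suc k)) \<omega> $ i - B (r k) \<omega> $ i)))\<^sup>2 \<le> 1 * h\<^sup>2 * (r N - r 0)"
    using mdiff_orthogonal[OF r(1), of N U] U unfolding eq by simp
qed

text \<open>Without orthogonality the triangle inequality gives the square of the length; one of its
  two factors is the value of \<open>\<kappa>\<close>.\<close>

lemma integrator_time: "integrator T (\<lambda>x. x) (\<lambda>t \<omega>. t)"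
  unfolding integrator_def
proof (intro allI impI)
  fix r :: "nat \<Rightarrow> real" and N H and h :: real
  assume r: "mono r" "0 \<le> r 0" "r N \<le> T" and h: "0 \<le> h"
    and H: "\<forall>k<N. r k < r (Suc k) \<longrightarrow> past_sq (r k) (H k) \<and> nrm (H k) \<le> h"
  have r0: "0 \<le> r k" "r k \<le> r (Suc k)" for k
    using r by (auto intro: order_trans[of 0 "r 0"] monoD)
  define U where "U k = (\<lambda>\<omega>. (r (Suc k) - r k) * (if r k < r (Suc k) then H k \<omega> else 0))" for k
  have U: "past_sq (r N) (U k) \<and> nrm (U k) \<le> h * (r (Suc k) - r k)" if "k < N" for k
  proof (cases "r k < r (Suc k)")
    case True
    then have p: "past_sq (r k) (H k)" "nrm (H k) \<le> h" using H that by auto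
    have "r k \<le> r N" using r(1) that by (auto intro: monoD)
    then have "past_sq (r N) (H k)" using p(1) past_sq_mono by blast
    moreover have "(r (Suc k) - r k) * nrm (H k) \<le> (r (Suc k) - r k) * h"
      using p(2) r0(2)[of k] by (intro mult_left_mono) auto
    moreover have "U k = (\<lambda>\<omega>. (r (Suc k) - r k) * H k \<omega>)" using True by (simp add: U_def)
    ultimately show ?thesis using r0(2)[of k] by (simp add: past_sq_cmult nrm_cmult mult.commute[of h])
  next
    case False
    then have "U k = (\<lambda>\<omega>. 0)" by (simp add: U_def)
    then show ?thesis using r0(2)[of k] h by (simp add: nrm_const)
  qed
  have eq: "(\<Sum>k<N. H k \<omega> * (r (Suc k) - r k)) = (\<Sum>k<N. U k \<omega>)" for \<omega>
    using r0(2) by (intro sum.cong) (auto simp: U_def not_less dest: antisym)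
  have "nrm (\<lambda>\<omega>. \<Sum>k<N. U k \<omega>) \<le> (\<Sum>k<N. nrm (U k))"
    using U by (intro nrm_sum_le) (auto dest: past_sqD)
  also have "\<dots> \<le> (\<Sum>k<N. h * (r (Suc k) - r k))"
    using U by (intro sum_mono) auto
  also have "\<dots> = h * (r N - r 0)"
    by (simp only: sum_distrib_left[symmetric] sum_lessThan_telescope)
  finally have "(nrm (\<lambda>\<omega>. \<Sum>k<N. U k \<omega>))\<^sup>2 \<le> (h * (r N - r 0))\<^sup>2"
    by (intro power_mono) auto
  then show "past_sq (r N) (\<lambda>\<omega>. \<Sum>k<N. H k \<omega> * (r (Suc k) - r k)) \<and>
     (nrm (\<lambda>\<omega>. \<Sum>k<N. H k \<omega> * (r (Suc k) - r k)))\<^sup>2 \<le> (r N - r 0) * h\<^sup>2 * (r N - r 0)"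
    unfolding eq using U by (auto simp: power_mult_distrib power2_eq_square ac_simps intro!: past_sq_sum)
qed

text \<open>Only the integrator is clipped; the integrand stays frozen at the dyadic point, even one
  before \<open>s\<close>. In this form sums over adjacent intervals add up exactly.\<close>

definition left_sum ::
    "real \<Rightarrow> (real \<Rightarrow> 'a \<Rightarrow> real) \<Rightarrow> (real \<Rightarrow> 'a \<Rightarrow> real) \<Rightarrow> nat \<Rightarrow> real \<Rightarrow> real \<Rightarrow> 'a \<Rightarrow> real" where
  "left_sum T Y A n s t \<omega> = (\<Sum>k<2 ^ n. Y (real k * T / 2 ^ n) \<omega> *
     (A (clip s t (real (Suc k) * T / 2 ^ n)) \<omega> - A (clip s t (real k * T / 2 ^ n)) \<omega>))"

lemma left_sum_additive:
  assumes "0 \<le> s" "s \<le> t" "0 < T"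
  shows "left_sum T Y A n 0 t \<omega> - left_sum T Y A n 0 s \<omega> = left_sum T Y A n s t \<omega>"
proof -
  \<comment> \<open>For nonnegative \<open>x\<close> the clippings to the three intervals are
    additive up to the constant \<open>A s\<close>, which cancels in increments.\<close>
  have "A (clip 0 t x) \<omega> - A (clip 0 s x) \<omega> = A (clip s t x) \<omega> - A s \<omega>" if "0 \<le> x" for x
    using assms that by (auto simp: clip_def max_def min_def)
  then have "A (clip 0 t y) \<omega> - A (clip 0 t x) \<omega> - (A (clip 0 s y) \<omega> - A (clip 0 s x) \<omega>) =
      A (clip s t y) \<omega> - A (clip s t x) \<omega>" if "0 \<le> x" "0 \<le> y" for x y
    using that by (smt (verit))
  moreover have "0 \<le> real k * T / 2 ^ n" for k using \<open>0 < T\<close> by simp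
  ultimately show ?thesis
    unfolding left_sum_def sum_subtractf[symmetric]
    by (simp only: right_diff_distrib[symmetric])
qed

lemma left_sum_grid:
  fixes n :: nat
  assumes "0 \<le> s" "s \<le> t" "t \<le> T" "0 < T"
  defines "r \<equiv> \<lambda>k. clip s t (real k * T / 2 ^ n)"
  shows "mono r" "r 0 = s" "r (2 ^ n) = t"
    and "\<And>k. r k < r (Suc k) \<Longrightarrow>
      r k = max s (real k * T / 2 ^ n) \<and> real k * T / 2 ^ n < t \<and> s < real (Suc k) * T / 2 ^ n"
proof -
  show "mono r" unfolding r_def
    using assms by (intro monoI mono_clip divide_right_mono mult_right_mono) auto
  show "r 0 = s" "r (2 ^ n) = t" using assms by (auto simp: r_def clip_def)
  show "r k = max s (real k * T / 2 ^ n) \<and> real k * T / 2 ^ n < t \<and> s < real (Suc k) * T / 2 ^ n"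
    if "r k < r (Suc k)" for k
    using that assms unfolding r_def clip_def by (auto simp: max_def min_def split: if_splits)
qed

lemma integrator_left_sum:
  fixes n :: nat
  assumes A: "integrator T \<kappa> A" and st: "0 \<le> s" "s \<le> t" "t \<le> T" "0 < T" and h: "0 \<le> h"
    and H: "\<And>k. k < 2 ^ n \<Longrightarrow> real k * T / 2 ^ n < t \<Longrightarrow> s < real (Suc k) * T / 2 ^ n \<Longrightarrow>
      past_sq (max s (real k * T / 2 ^ n)) (H k) \<and> nrm (H k) \<le> h"
  defines "S \<equiv> \<lambda>\<omega>. \<Sum>k<2 ^ n. H k \<omega> * 
     (A (clip s t (real (Suc k) * T / 2 ^ n)) \<omega> - A (clip s t (real k * T / 2 ^ n)) \<omega>)"
  shows "past_sq t S" "(nrm S)\<^sup>2 \<le> \<kappa> (t - s) * h\<^sup>2 * (t - s)"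
proof -
  note g = left_sum_grid[OF st, where n = n]
  have H': "\<forall>k<2^n. clip s t (real k * T / 2 ^ n) < clip s t (real (Suc k) * T / 2 ^ n) \<longrightarrow>
      past_sq (clip s t (real k * T / 2 ^ n)) (H k) \<and> nrm (H k) \<le> h"
    using g(4) H by metis
  show "past_sq t S" "(nrm S)\<^sup>2 \<le> \<kappa> (t - s) * h\<^sup>2 * (t - s)"
    using A[unfolded integrator_def, rule_format, of "\<lambda>k. clip s t (real k * T / 2 ^ n)" "2 ^ n" h H]
      g(1-3) H' st h unfolding S_def by auto
qed

text \<open>Halving the grid moves the integrand by at most \<open>C * sqrt (T / 2 ^ n)\<close> in
  L2, so the differences of consecutive sums decay geometrically. The one-step bound compares the
  integral with its leading term; its order is \<open>t - s\<close> for dB and the power 3/2 of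
  \<open>t - s\<close> for dt.\<close>

lemma integral_exists:
  assumes T: "0 < T" and A: "integrator T \<kappa> A" and Y: "nice T Y"
    and \<kappa>: "\<And>x y. 0 \<le> x \<Longrightarrow> x \<le> y \<Longrightarrow> 0 \<le> \<kappa> x \<and> \<kappa> x \<le> \<kappa> y"
  obtains Z C where "0 \<le> C" "Z 0 = (\<lambda>\<omega>. 0)" "nice T Z"
    "\<And>s t. 0 \<le> s \<Longrightarrow> s \<le> t \<Longrightarrow> t \<le> T \<Longrightarrow>
       nrm (\<lambda>\<omega>. Z t \<omega> - Z s \<omega> - Y s \<omega> * (A t \<omega> - A s \<omega>)) \<le> C * sqrt (\<kappa> (t - s)) * (t - s)"
    "\<And>s t. 0 \<le> s \<Longrightarrow> s \<le> t \<Longrightarrow> t \<le> T \<Longrightarrow> 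
       (\<lambda>n. nrm (\<lambda>\<omega>. Z t \<omega> - Z s \<omega> - left_sum T Y A n s t \<omega>)) \<longlonglongrightarrow> 0"
proof -
  let ?q = "\<lambda>n k. real k * T / 2 ^ n"
  let ?G = "left_sum T Y A"
  obtain C where C: "0 \<le> C" "\<And>t. 0 \<le> t \<Longrightarrow> t \<le> T \<Longrightarrow> nrm (Y t) \<le> C"
    "\<And>s t. 0 \<le> s \<Longrightarrow> s \<le> t \<Longrightarrow> t \<le> T \<Longrightarrow> nrm (\<lambda>\<omega>. Y t \<omega> - Y s \<omega>) \<le> C * sqrt (t - s)"
    using Y unfolding nice_def by blast
  have q0: "0 \<le> ?q n k" for n k using T by simp
  have qT: "?q n k \<le> T" if "k \<le> 2 ^ n" for n k
  proof -
    have "real k \<le> 2 ^ n" using that by (simp add: numeral_power_le_of_nat_cancel_iff of_nat_le_numeral_power_cancel_iff)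
    then show ?thesis using T by (simp add: field_simps)
  qed
  have bound: "past_sq t (?G n s t) \<and> (nrm (?G n s t))\<^sup>2 \<le> \<kappa> (t - s) * C\<^sup>2 * (t - s)"
    if st: "0 \<le> s" "s \<le> t" "t \<le> T" for n s t
  proof -
    have H: "past_sq (max s (?q n k)) (Y (?q n k)) \<and> nrm (Y (?q n k)) \<le> C" if "k < 2 ^ n" for k
      using that qT[of k n] q0[of k n] nice_past[OF Y, of "?q n k"] C(2)[of "?q n k"]
      by (auto intro: past_sq_mono)
    from integrator_left_sum[OF A st T C(1), of n "\<lambda>k. Y (?q n k)"] H show ?thesis
      unfolding left_sum_def[abs_def] by blast
  qed
  have step: "(nrm (\<lambda>\<omega>. ?G (Suc n) s t \<omega> - ?G n s t \<omega>))\<^sup>2 \<le> \<kappa> (t - s) * (C * sqrt (T / 2 ^ n))\<^sup>2 * (t - s)"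
    if st: "0 \<le> s" "s \<le> t" "t \<le> T" for n s t
  proof -
    let ?a = "\<lambda>l \<omega>. A (clip s t (?q (Suc n) (Suc l))) \<omega> - A (clip s t (?q (Suc n) l)) \<omega>"
    have qq: "?q (Suc n) (2 * k) = ?q n k" for k by simp
    have qq': "?q (Suc n) (Suc (Suc (2 * k))) = ?q n (Suc k)" for k by (simp add: field_simps)
    have half: "2 * k div 2 = k" "Suc (2 * k) div 2 = k" for k :: nat by simp_all
    \<comment> \<open>The coarse sum written on the finer grid, where cell \<open>l\<close> lies in
      the coarse cell \<open>l div 2\<close>.\<close>
    have "?G n s t \<omega> = (\<Sum>l<2 * 2 ^ n. Y (?q n (l div 2)) \<omega> * ?a l \<omega>)" for \<omega>
      unfolding sum_lessThan_double left_sum_def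
      by (intro sum.cong refl) (simp only: qq qq' half, simp add: algebra_simps)
    then have "(\<lambda>\<omega>. ?G (Suc n) s t \<omega> - ?G n s t \<omega>) =
        (\<lambda>\<omega>. \<Sum>l<2 ^ Suc n. (Y (?q (Suc n) l) \<omega> - Y (?q n (l div 2)) \<omega>) * ?a l \<omega>)"
      by (simp add: left_sum_def[of T Y A "Suc n"] left_diff_distrib sum_subtractf)
    moreover have H: "past_sq (max s (?q (Suc n) l)) (\<lambda>\<omega>. Y (?q (Suc n) l) \<omega> - Y (?q n (l div 2)) \<omega>) \<and>
        nrm (\<lambda>\<omega>. Y (?q (Suc n) l) \<omega> - Y (?q n (l div 2)) \<omega>) \<le> C * sqrt (T / 2 ^ n)"
      if "l < 2 ^ Suc n" for l
    proof -
      have l: "?q n (l div 2) \<le> ?q (Suc n) l" "?q (Suc n) l - ?q n (l div 2) \<le> T / 2 ^ n"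
      proof -
        have l2: "real (l div 2) * 2 \<le> real l" "real l \<le> real (l div 2) * 2 + 1" by linarith+
        show "?q n (l div 2) \<le> ?q (Suc n) l"
          using mult_right_mono[OF l2(1), of T] T by (simp add: field_simps)
        have "?q (Suc n) l - ?q n (l div 2) = (real l - real (l div 2) * 2) * T / 2 ^ Suc n"
          by (simp add: field_simps)
        also have "\<dots> \<le> 1 * T / 2 ^ Suc n"
          using l2 T by (intro divide_right_mono mult_right_mono) auto
        also have "\<dots> \<le> T / 2 ^ n" using T by (simp add: field_simps)
        finally show "?q (Suc n) l - ?q n (l div 2) \<le> T / 2 ^ n" .
      qed
      have lT: "?q (Suc n) l \<le> T" using that by (intro qT) simp
      have "nrm (\<lambda>\<omega>. Y (?q (Suc n) l) \<omega> - Y (?q n (l div 2)) \<omega>) \<le> C * sqrt (?q (Suc n) l - ?q n (l div 2))"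
        by (rule C(3)[OF q0 l(1) lT])
      also have "\<dots> \<le> C * sqrt (T / 2 ^ n)"
        using l(2) C(1) by (intro mult_left_mono) auto
      finally have "nrm (\<lambda>\<omega>. Y (?q (Suc n) l) \<omega> - Y (?q n (l div 2)) \<omega>) \<le> C * sqrt (T / 2 ^ n)" .
      moreover have "past_sq (max s (?q (Suc n) l)) (Y (?q (Suc n) l))"
        by (rule past_sq_mono[OF nice_past[OF Y q0 lT]]) simp
      moreover have "past_sq (max s (?q (Suc n) l)) (Y (?q n (l div 2)))"
        by (rule past_sq_mono[OF nice_past[OF Y q0]]) (use l lT in auto)
      ultimately show ?thesis by (blast intro: past_sq_diff)
    qed
    ultimately show ?thesis
      using integrator_left_sum(2)[OF A st T, of "C * sqrt (T / 2 ^ n)" "Suc n"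
          "\<lambda>l \<omega>. Y (?q (Suc n) l) \<omega> - Y (?q n (l div 2)) \<omega>"] C(1) T by simp
  qed
  \<comment> \<open>The extra \<open>T / 2 ^ n\<close> allows for the dyadic point of the cell
    containing \<open>s\<close>, which may precede \<open>s\<close> by up to one cell; it disappears
    in the limit.\<close>
  have germ: "nrm (\<lambda>\<omega>. ?G n s t \<omega> - Y s \<omega> * (A t \<omega> - A s \<omega>)) \<le>
      sqrt (\<kappa> (t - s) * (C * sqrt (t - s + T / 2 ^ n))\<^sup>2 * (t - s)) \<and>
      past_sq t (\<lambda>\<omega>. ?G n s t \<omega> - Y s \<omega> * (A t \<omega> - A s \<omega>))"
    if st: "0 \<le> s" "s \<le> t" "t \<le> T" for n s t
  proof -
    note g = left_sum_grid[OF st T, where n = n]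
    let ?a = "\<lambda>k \<omega>. A (clip s t (?q n (Suc k))) \<omega> - A (clip s t (?q n k)) \<omega>"
    have tel: "A t \<omega> - A s \<omega> = (\<Sum>k<2 ^ n. ?a k \<omega>)" for \<omega>
      using sum_lessThan_telescope[of "\<lambda>k. A (clip s t (?q n k)) \<omega>" "2 ^ n"] g(2,3) by simp
    have eq: "(\<lambda>\<omega>. ?G n s t \<omega> - Y s \<omega> * (A t \<omega> - A s \<omega>)) =
        (\<lambda>\<omega>. \<Sum>k<2 ^ n. (Y (?q n k) \<omega> - Y s \<omega>) * ?a k \<omega>)"
      unfolding tel left_sum_def sum_distrib_left unfolding left_diff_distrib sum_subtractf by (rule refl)
    have H: "past_sq (max s (?q n k)) (\<lambda>\<omega>. Y (?q n k) \<omega> - Y s \<omega>) \<and>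
        nrm (\<lambda>\<omega>. Y (?q n k) \<omega> - Y s \<omega>) \<le> C * sqrt (t - s + T / 2 ^ n)"
      if k: "k < 2 ^ n" "?q n k < t" "s < ?q n (Suc k)" for k
    proof -
      have kT: "?q n k \<le> T" using k(1) by (intro qT) simp
      have sT: "s \<le> T" using st by simp
      have near: "\<bar>?q n k - s\<bar> \<le> t - s + T / 2 ^ n"
      proof -
        have "?q n (Suc k) = ?q n k + T / 2 ^ n" by (simp add: field_simps)
        moreover have "0 \<le> T / 2 ^ n" using T by simp
        ultimately show ?thesis using k st by linarith
      qed
      have "nrm (\<lambda>\<omega>. Y (?q n k) \<omega> - Y s \<omega>) \<le> C * sqrt \<bar>?q n k - s\<bar>"
      proof (cases "s \<le> ?q n k")
        case True
        then show ?thesis using C(3)[OF st(1) True kT] by simp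
      next
        case False
        then show ?thesis using C(3)[of "?q n k" s] q0[of k n] sT
          by (simp add: nrm_diff_commute[of "Y (?q n k)"])
      qed
      also have "\<dots> \<le> C * sqrt (t - s + T / 2 ^ n)"
        using near C(1) by (intro mult_left_mono) auto
      finally have "nrm (\<lambda>\<omega>. Y (?q n k) \<omega> - Y s \<omega>) \<le> C * sqrt (t - s + T / 2 ^ n)" .
      moreover have "past_sq (max s (?q n k)) (Y (?q n k))" "past_sq (max s (?q n k)) (Y s)"
        by (rule past_sq_mono[OF nice_past[OF Y q0 kT]], simp,
            rule past_sq_mono[OF nice_past[OF Y st(1) sT]], simp)
      ultimately show ?thesis by (blast intro: past_sq_diff)
    qed
    have "0 \<le> C * sqrt (t - s + T / 2 ^ n)" using C(1) T st by simp
    from integrator_left_sum[OF A st T this, of n "\<lambda>k \<omega>. Y (?q n k) \<omega> - Y s \<omega>"] H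
    show ?thesis unfolding eq by (auto intro: real_le_rsqrt)
  qed
  \<comment> \<open>At time 0 the limit is chosen to be 0 everywhere, not only almost surely, so
    that telescoping from 0 later yields an exact identity of functions.\<close>
  have "\<exists>Z. past_sq t Z \<and> (\<lambda>n. nrm (\<lambda>\<omega>. Z \<omega> - ?G n 0 t \<omega>)) \<longlonglongrightarrow> 0 \<and> (t = 0 \<longrightarrow> Z = (\<lambda>\<omega>. 0))"
    if t: "0 \<le> t" "t \<le> T" for t
  proof (cases "t = 0")
    case True
    have "clip 0 0 x = 0" for x by (simp add: clip_def)
    then have "?G n 0 t = (\<lambda>\<omega>. 0)" for n using True by (simp add: left_sum_def fun_eq_iff)
    then show ?thesis using True by (intro exI[of _ "\<lambda>\<omega>. 0"]) (simp add: nrm_const)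
  next
    case False
    \<comment> \<open>The refinement bound in geometric form; the ratio comes from the square root
      of the cell length.\<close>
    define a where "a n = sqrt (\<kappa> t * t) * (C * sqrt T) * (1 / sqrt 2) ^ n" for n :: nat
    have "nrm (\<lambda>\<omega>. ?G (Suc n) 0 t \<omega> - ?G n 0 t \<omega>) \<le> a n" for n
    proof (rule power2_le_imp_le)
      have "(a n)\<^sup>2 = \<kappa> t * (C * sqrt (T / 2 ^ n))\<^sup>2 * t"
        using T t \<kappa>[of t t] by (simp add: a_def power_mult_distrib power_divide flip: power_mult)
          (simp add: power_mult mult.commute[of n 2])
      then show "(nrm (\<lambda>\<omega>. ?G (Suc n) 0 t \<omega> - ?G n 0 t \<omega>))\<^sup>2 \<le> (a n)\<^sup>2"
        using step[of 0 t n] t by simp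
      show "0 \<le> a n" using T t \<kappa>[of t t] C(1) by (simp add: a_def)
    qed
    moreover have "summable a"
      unfolding a_def by (intro summable_mult summable_geometric) simp
    moreover have "sq_integrable (?G n 0 t)" "?G n 0 t \<in> borel_measurable (past t)" for n
      using bound[of 0 t n] t by (auto dest: past_sqD)
    ultimately obtain Z where "Z \<in> borel_measurable (past t)" "sq_integrable Z"
      "(\<lambda>n. nrm (\<lambda>\<omega>. Z \<omega> - ?G n 0 t \<omega>)) \<longlonglongrightarrow> 0"
      using sq_integrable_complete[of "\<lambda>n. ?G n 0 t" "past t" a] subalgebra_past by blast
    then show ?thesis using False by (auto simp: past_sq_def)
  qed
  then have "\<forall>t. \<exists>Z. 0 \<le> t \<longrightarrow> t \<le> T \<longrightarrow> past_sq t Z \<and>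
      (\<lambda>n. nrm (\<lambda>\<omega>. Z \<omega> - ?G n 0 t \<omega>)) \<longlonglongrightarrow> 0 \<and> (t = 0 \<longrightarrow> Z = (\<lambda>\<omega>. 0))"
    by blast
  from choice[OF this] obtain Z where "\<forall>t. 0 \<le> t \<longrightarrow> t \<le> T \<longrightarrow> past_sq t (Z t) \<and>
      (\<lambda>n. nrm (\<lambda>\<omega>. Z t \<omega> - ?G n 0 t \<omega>)) \<longlonglongrightarrow> 0 \<and> (t = 0 \<longrightarrow> Z t = (\<lambda>\<omega>. 0))" ..
  then have Z: "\<And>t. 0 \<le> t \<Longrightarrow> t \<le> T \<Longrightarrow> past_sq t (Z t)"
    and Zlim: "\<And>t. 0 \<le> t \<Longrightarrow> t \<le> T \<Longrightarrow> (\<lambda>n. nrm (\<lambda>\<omega>. Z t \<omega> - ?G n 0 t \<omega>)) \<longlonglongrightarrow> 0"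
    and Z0: "Z 0 = (\<lambda>\<omega>. 0)"
    using T by auto
  have sqG: "sq_integrable (?G n s t)" if "0 \<le> s" "s \<le> t" "t \<le> T" for n s t
    using bound[OF that] by (auto dest: past_sqD)
  have sqZ: "sq_integrable (Z t)" if "0 \<le> t" "t \<le> T" for t
    using Z[OF that] by (auto dest: past_sqD)
  have lim: "(\<lambda>n. nrm (\<lambda>\<omega>. Z t \<omega> - Z s \<omega> - ?G n s t \<omega>)) \<longlonglongrightarrow> 0"
    if st: "0 \<le> s" "s \<le> t" "t \<le> T" for s t
  proof (rule tendsto_sandwich[OF _ _ tendsto_const])
    have t: "0 \<le> t" and s: "s \<le> T" using st by auto
    show "(\<lambda>n. nrm (\<lambda>\<omega>. Z t \<omega> - ?G n 0 t \<omega>) + nrm (\<lambda>\<omega>. Z s \<omega> - ?G n 0 s \<omega>)) \<longlonglongrightarrow> 0"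
      using tendsto_add[OF Zlim[OF t st(3)] Zlim[OF st(1) s]] by simp
    show "\<forall>\<^sub>F n in sequentially. nrm (\<lambda>\<omega>. Z t \<omega> - Z s \<omega> - ?G n s t \<omega>) \<le>
        nrm (\<lambda>\<omega>. Z t \<omega> - ?G n 0 t \<omega>) + nrm (\<lambda>\<omega>. Z s \<omega> - ?G n 0 s \<omega>)"
    proof (rule always_eventually, rule allI)
      fix n
      have "sq_integrable (\<lambda>\<omega>. Z t \<omega> - ?G n 0 t \<omega>)" "sq_integrable (\<lambda>\<omega>. Z s \<omega> - ?G n 0 s \<omega>)"
        using sqZ sqG st s t by (blast intro: sq_integrable_diff)+
      note nrm_triangle_diff[OF this]
      moreover have "(\<lambda>\<omega>. Z t \<omega> - Z s \<omega> - ?G n s t \<omega>) = (\<lambda>\<omega>. (Z t \<omega> - ?G n 0 t \<omega>) - (Z s \<omega> - ?G n 0 s \<omega>))"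
        by (simp add: algebra_simps flip: left_sum_additive[OF st(1,2) T])
      ultimately show "nrm (\<lambda>\<omega>. Z t \<omega> - Z s \<omega> - ?G n s t \<omega>) \<le>
        nrm (\<lambda>\<omega>. Z t \<omega> - ?G n 0 t \<omega>) + nrm (\<lambda>\<omega>. Z s \<omega> - ?G n 0 s \<omega>)"
        by simp
    qed
  qed simp
  define K where "K = sqrt (\<kappa> T) * C"
  have K: "0 \<le> K" using \<kappa>[of T T] T C(1) by (simp add: K_def)
  have incr: "nrm (\<lambda>\<omega>. Z t \<omega> - Z s \<omega>) \<le> K * sqrt (t - s)" if st: "0 \<le> s" "s \<le> t" "t \<le> T" for s t
  proof (rule nrm_lim_le[OF _ _ lim[OF st] _ tendsto_const])
    show "nrm (?G n s t) \<le> K * sqrt (t - s)" for n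
    proof (rule power2_le_imp_le)
      have "\<kappa> (t - s) * C\<^sup>2 * (t - s) \<le> \<kappa> T * C\<^sup>2 * (t - s)"
        using \<kappa>[of "t - s" T] st by (intro mult_right_mono) auto
      also have "\<dots> = (K * sqrt (t - s))\<^sup>2"
        using st \<kappa>[of T T] T by (simp add: K_def power_mult_distrib)
      finally show "(nrm (?G n s t))\<^sup>2 \<le> (K * sqrt (t - s))\<^sup>2" using bound[OF st, of n] by simp
      show "0 \<le> K * sqrt (t - s)" using K st by simp
    qed
  qed (use sqZ sqG st in auto)
  have niceZ: "nice T Z"
    unfolding nice_def
  proof (intro conjI exI[of _ "K * sqrt T + K"] allI impI Z)
    show "0 \<le> K * sqrt T + K" using K T by simp
    fix s t assume st: "0 \<le> s" "s \<le> t" "t \<le> T"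
    have "nrm (Z t) \<le> K * sqrt t" using incr[of 0 t] Z0 st by simp
    also have "\<dots> \<le> K * sqrt T" using K st by (intro mult_left_mono) auto
    finally show "nrm (Z t) \<le> K * sqrt T + K" using K by simp
    have "K * sqrt (t - s) \<le> (K * sqrt T + K) * sqrt (t - s)"
      using K T st by (intro mult_right_mono) auto
    then show "nrm (\<lambda>\<omega>. Z t \<omega> - Z s \<omega>) \<le> (K * sqrt T + K) * sqrt (t - s)"
      using incr[OF st] by simp
  qed
  have germZ: "nrm (\<lambda>\<omega>. Z t \<omega> - Z s \<omega> - Y s \<omega> * (A t \<omega> - A s \<omega>)) \<le> C * sqrt (\<kappa> (t - s)) * (t - s)"
    if st: "0 \<le> s" "s \<le> t" "t \<le> T" for s t
  proof (rule nrm_lim_le)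
    let ?X = "\<lambda>n \<omega>. ?G n s t \<omega> - Y s \<omega> * (A t \<omega> - A s \<omega>)"
    show sqX: "sq_integrable (?X n)" for n using germ[OF st] by (auto dest: past_sqD)
    have YA: "sq_integrable (\<lambda>\<omega>. Y s \<omega> * (A t \<omega> - A s \<omega>))"
      using sq_integrable_diff[OF sqG[OF st, of 0] sqX[of 0]] by simp
    show "sq_integrable (\<lambda>\<omega>. Z t \<omega> - Z s \<omega> - Y s \<omega> * (A t \<omega> - A s \<omega>))"
      by (intro sq_integrable_diff sqZ YA) (use st in auto)
    show "(\<lambda>n. nrm (\<lambda>\<omega>. Z t \<omega> - Z s \<omega> - Y s \<omega> * (A t \<omega> - A s \<omega>) - ?X n \<omega>)) \<longlonglongrightarrow> 0"
    proof -
      have "(\<lambda>\<omega>. Z t \<omega> - Z s \<omega> - Y s \<omega> * (A t \<omega> - A s \<omega>) - ?X n \<omega>) =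
          (\<lambda>\<omega>. Z t \<omega> - Z s \<omega> - ?G n s t \<omega>)" for n by (simp add: fun_eq_iff)
      then show ?thesis using lim[OF st] by (simp only:)
    qed
    show "nrm (?X n) \<le> sqrt (\<kappa> (t - s) * (C * sqrt (t - s + T / 2 ^ n))\<^sup>2 * (t - s))" for n
      using germ[OF st] by blast
    have "(\<lambda>n. T / 2 ^ n) \<longlonglongrightarrow> 0"
      using tendsto_mult[OF tendsto_const[of T] LIMSEQ_power_zero[of "1/2::real"]]
      by (simp add: power_one_over field_simps)
    then have "(\<lambda>n. sqrt (\<kappa> (t - s) * (C * sqrt (t - s + T / 2 ^ n))\<^sup>2 * (t - s))) \<longlonglongrightarrow>
        sqrt (\<kappa> (t - s) * (C * sqrt (t - s + 0))\<^sup>2 * (t - s))"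
      by (intro tendsto_intros)
    also have "sqrt (\<kappa> (t - s) * (C * sqrt (t - s + 0))\<^sup>2 * (t - s)) = C * sqrt (\<kappa> (t - s)) * (t - s)"
      using st C(1) by (simp add: power_mult_distrib real_sqrt_mult)
    finally show "(\<lambda>n. sqrt (\<kappa> (t - s) * (C * sqrt (t - s + T / 2 ^ n))\<^sup>2 * (t - s))) \<longlonglongrightarrow>
        C * sqrt (\<kappa> (t - s)) * (t - s)" .
  qed
  show ?thesis
    by (rule that[OF C(1) Z0 niceZ germZ lim])
qed

section \<open>Trapezoidal sums\<close>

text \<open>What distinguishes dB from dt: each cell of a left-point sum is orthogonal to the past
  at \<open>s\<close>, hence so is the limit, and its mean is 0.\<close>

lemma ito_integral_exists:
  assumes T: "0 < T" and Y: "nice T Y"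
  obtains Z C where "0 \<le> C" "Z 0 = (\<lambda>\<omega>. 0)" "nice T Z"
    "\<And>s t. 0 \<le> s \<Longrightarrow> s \<le> t \<Longrightarrow> t \<le> T \<Longrightarrow>
       mdiff s t (\<lambda>\<omega>. Z t \<omega> - Z s \<omega> - Y s \<omega> * inc s t i \<omega>)"
    "\<And>s t. 0 \<le> s \<Longrightarrow> s \<le> t \<Longrightarrow> t \<le> T \<Longrightarrow>
       nrm (\<lambda>\<omega>. Z t \<omega> - Z s \<omega> - Y s \<omega> * inc s t i \<omega>) \<le> C * (t - s)"
    "\<And>t. 0 \<le> t \<Longrightarrow> t \<le> T \<Longrightarrow> expectation (Z t) = 0"
proof -
  let ?A = "\<lambda>t \<omega>. B t \<omega> $ i"
  let ?q = "\<lambda>n k. real k * T / 2 ^ n"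
  obtain Z C where Z: "0 \<le> C" "Z 0 = (\<lambda>\<omega>. 0)" "nice T Z"
    "\<And>s t. 0 \<le> s \<Longrightarrow> s \<le> t \<Longrightarrow> t \<le> T \<Longrightarrow>
       nrm (\<lambda>\<omega>. Z t \<omega> - Z s \<omega> - Y s \<omega> * (?A t \<omega> - ?A s \<omega>)) \<le> C * sqrt 1 * (t - s)"
    "\<And>s t. 0 \<le> s \<Longrightarrow> s \<le> t \<Longrightarrow> t \<le> T \<Longrightarrow> 
       (\<lambda>n. nrm (\<lambda>\<omega>. Z t \<omega> - Z s \<omega> - left_sum T Y ?A n s t \<omega>)) \<longlonglongrightarrow> 0"
    by (rule integral_exists[OF T integrator_component[of T i] Y]) auto
  have md: "mdiff s t (\<lambda>\<omega>. Z t \<omega> - Z s \<omega>)" if st: "0 \<le> s" "s \<le> t" "t \<le> T" for s t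
  proof (rule mdiff_lim[OF _ _ Z(5)[OF st]])
    have s: "s \<le> T" and t: "0 \<le> t" using st by auto
    show "past_sq t (\<lambda>\<omega>. Z t \<omega> - Z s \<omega>)"
      using nice_past[OF Z(3) t st(3)] past_sq_mono[OF nice_past[OF Z(3) st(1) s] st(2)]
      by (rule past_sq_diff)
    show "mdiff s t (left_sum T Y ?A n s t)" for n
      unfolding left_sum_def[abs_def]
    proof (rule mdiff_sum)
      note g = left_sum_grid[OF st T, where n = n]
      fix k :: nat assume "k \<in> {..<2 ^ n}"
      then have k: "k < 2 ^ n" by simp
      let ?r = "\<lambda>k. clip s t (?q n k)"
      have r: "s \<le> ?r k" "?r k \<le> ?r (Suc k)" "?r (Suc k) \<le> t"
        using monoD[OF g(1), of 0 k] monoD[OF g(1), of k "Suc k"] monoD[OF g(1), of "Suc k" "2 ^ n"] g(2,3) k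
        by auto
      show "mdiff s t (\<lambda>\<omega>. Y (?q n k) \<omega> * (?A (?r (Suc k)) \<omega> - ?A (?r k) \<omega>))"
      proof (cases "?r k < ?r (Suc k)")
        case True
        have q: "?q n k \<le> ?r k" "?q n k \<le> T" "0 \<le> ?q n k" using g(4)[OF True] st T by auto
        have "past_sq (?r k) (Y (?q n k))"
          using past_sq_mono[OF nice_past[OF Y q(3,2)] q(1)] .
        then have "mdiff (?r k) (?r (Suc k)) (\<lambda>\<omega>. Y (?q n k) \<omega> * inc (?r k) (?r (Suc k)) i \<omega>)"
          using r st by (intro mdiff_mult_inc1) auto
        then show ?thesis using mdiff_mono r unfolding inc_def by blast
      next
        case False
        then have "?r (Suc k) = ?r k" using r by simp
        then show ?thesis by (simp add: mdiff_def)
      qed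
    qed
  qed
  have Zm: "expectation (Z t) = 0" if t: "0 \<le> t" "t \<le> T" for t
    using mdiff_integral[OF md[of 0 t]] t Z(2) by simp
  have md': "mdiff s t (\<lambda>\<omega>. Z t \<omega> - Z s \<omega> - Y s \<omega> * inc s t i \<omega>)"
    if st: "0 \<le> s" "s \<le> t" "t \<le> T" for s t
    by (rule mdiff_diff[OF md[OF st] mdiff_mult_inc1(1)[OF st(1,2) nice_past[OF Y st(1)]]])
      (use st in simp)
  show ?thesis
    using that[OF Z(1,2,3) md' _ Zm] Z(4) unfolding inc_def by simp
qed

lemma time_integral_exists:
  assumes T: "0 < T" and Y: "nice T Y"
  obtains Z C where "0 \<le> C" "Z 0 = (\<lambda>\<omega>. 0)" "nice T Z"
    "\<And>s t. 0 \<le> s \<Longrightarrow> s \<le> t \<Longrightarrow> t \<le> T \<Longrightarrow>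
       nrm (\<lambda>\<omega>. Z t \<omega> - Z s \<omega> - Y s \<omega> * (t - s)) \<le> C * sqrt (t - s) * (t - s)"
  by (rule integral_exists[OF T integrator_time[of T] Y]) auto

abbreviation trapezoid ::
    "(real \<Rightarrow> 'a \<Rightarrow> real) \<Rightarrow> 'd \<Rightarrow> (nat \<Rightarrow> real) \<Rightarrow> nat \<Rightarrow> 'a \<Rightarrow> real" where
  "trapezoid Y i r N \<omega> \<equiv>
     \<Sum>k<N. (Y (r k) \<omega> + Y (r (Suc k)) \<omega>) / 2 * inc (r k) (r (Suc k)) i \<omega>"

text \<open>A trapezoidal sum is the left-point sum plus half the products of the increments of
  \<open>Y\<close> and of component \<open>i\<close>. The hypothesis on \<open>Y\<close> replaces
  its increment by \<open>Y1\<close> times an increment of component \<open>j\<close>, and the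
  product with component \<open>i\<close> averages to the cell length if \<open>i = j\<close> and to
  0 otherwise. So \<open>X\<close> is the Ito integral of \<open>Y\<close> plus, for
  \<open>i = j\<close>, half the time integral of \<open>Y1\<close>; and \<open>Y\<close> is to
  \<open>X\<close> what \<open>Y1\<close> is to \<open>Y\<close>.\<close>

lemma trapezoid_step:
  assumes T: "0 < T" and Y: "nice T Y" and Y1: "nice T Y1" and CY: "0 \<le> CY"
    and germ: "\<And>s t. 0 \<le> s \<Longrightarrow> s \<le> t \<Longrightarrow> t \<le> T \<Longrightarrow>
       nrm (\<lambda>\<omega>. Y t \<omega> - Y s \<omega> - Y1 s \<omega> * inc s t j \<omega>) \<le> CY * (t - s)"
  obtains X C where "0 \<le> C" "nice T X"
    "\<And>s t. 0 \<le> s \<Longrightarrow> s \<le> t \<Longrightarrow> t \<le> T \<Longrightarrow>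
       nrm (\<lambda>\<omega>. X t \<omega> - X s \<omega> - Y s \<omega> * inc s t i \<omega>) \<le> C * (t - s)"
    "expectation (X 0) = 0"
    "\<And>s t. 0 \<le> s \<Longrightarrow> s \<le> t \<Longrightarrow> t \<le> T \<Longrightarrow>
       \<bar>expectation (X t) - expectation (X s) - (if i = j then expectation (Y1 s) / 2 else 0) * (t - s)\<bar>
         \<le> C * sqrt (t - s) * (t - s)"
    "\<And>r N \<delta>. mono r \<Longrightarrow> r 0 = 0 \<Longrightarrow> r N \<le> T \<Longrightarrow> 0 < \<delta> \<Longrightarrow> (\<forall>k<N. r (Suc k) - r k < \<delta>) \<Longrightarrow>
       sq_integrable (X (r N)) \<and>
       integrable P (trapezoid Y i r N) \<and>
       (\<integral>\<omega>. \<bar>trapezoid Y i r N \<omega> - X (r N) \<omega>\<bar> \<partial>P)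
         \<le> C * sqrt \<delta>"
proof -
  obtain I CI where I: "0 \<le> CI" "I 0 = (\<lambda>\<omega>. 0)" "nice T I"
    and Imd: "\<And>s t. 0 \<le> s \<Longrightarrow> s \<le> t \<Longrightarrow> t \<le> T \<Longrightarrow>
       mdiff s t (\<lambda>\<omega>. I t \<omega> - I s \<omega> - Y s \<omega> * inc s t i \<omega>)"
    and Ig: "\<And>s t. 0 \<le> s \<Longrightarrow> s \<le> t \<Longrightarrow> t \<le> T \<Longrightarrow>
       nrm (\<lambda>\<omega>. I t \<omega> - I s \<omega> - Y s \<omega> * inc s t i \<omega>) \<le> CI * (t - s)"
    and Im: "\<And>t. 0 \<le> t \<Longrightarrow> t \<le> T \<Longrightarrow> expectation (I t) = 0"
    by (rule ito_integral_exists[OF T Y, of i]) (rule that)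
  obtain D CD where D: "0 \<le> CD" "D 0 = (\<lambda>\<omega>. 0)" "nice T D"
    and Dg: "\<And>s t. 0 \<le> s \<Longrightarrow> s \<le> t \<Longrightarrow> t \<le> T \<Longrightarrow>
       nrm (\<lambda>\<omega>. D t \<omega> - D s \<omega> - Y1 s \<omega> * (t - s)) \<le> CD * sqrt (t - s) * (t - s)"
    by (rule time_integral_exists[OF T Y1]) (rule that)
  obtain C1 where C1: "0 \<le> C1" "\<And>t. 0 \<le> t \<Longrightarrow> t \<le> T \<Longrightarrow> nrm (Y1 t) \<le> C1"
    using Y1 unfolding nice_def by blast
  define c :: real where "c = (if i = j then 1/2 else 0)"
  have c: "0 \<le> c" "c \<le> 1" by (auto simp: c_def)
  define X where "X t = (\<lambda>\<omega>. I t \<omega> + c * D t \<omega>)" for t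
  have Xn: "nice T X" unfolding X_def by (rule nice_add_cmult[OF I(3) D(3)])
  have sqs: "sq_integrable (I t)" "sq_integrable (D t)" "sq_integrable (Y t)" "sq_integrable (Y1 t)"
      "sq_integrable (X t)"
    if "0 \<le> t" "t \<le> T" for t
    using that nice_sq[OF I(3)] nice_sq[OF D(3)] nice_sq[OF Y] nice_sq[OF Y1] nice_sq[OF Xn] by auto
  have sqYB: "sq_integrable (\<lambda>\<omega>. Y s \<omega> * inc s t i \<omega>)" "sq_integrable (\<lambda>\<omega>. Y1 s \<omega> * inc s t j \<omega>)"
    if st: "0 \<le> s" "s \<le> t" "t \<le> T" for s t
    using mdiffD(1)[OF mdiff_mult_inc1(1)[OF st(1,2) nice_past[OF Y st(1)], of i]]
      mdiffD(1)[OF mdiff_mult_inc1(1)[OF st(1,2) nice_past[OF Y1 st(1)], of j]] st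
    by (auto dest: past_sqD)
  have sqinc: "sq_integrable (inc s t k)" if st: "0 \<le> s" "s \<le> t" for s t k
    using inc_moment(1)[OF st, of k 2] inc_measurable[of s t k] st by (auto simp: sq_integrable_def)
  have nrminc: "nrm (inc s t k) = sqrt (t - s)" if st: "0 \<le> s" "s \<le> t" for s t k
    using inc_variance[OF st, of k] by (simp add: nrm_def)
  \<comment> \<open>The time integral is Lipschitz in L2, so the correction fits into the error of
    order \<open>t - s\<close> allowed for \<open>X\<close>.\<close>
  obtain CX where CX: "0 \<le> CX" "\<And>s t. 0 \<le> s \<Longrightarrow> s \<le> t \<Longrightarrow> t \<le> T \<Longrightarrow> nrm (\<lambda>\<omega>. D t \<omega> - D s \<omega>) \<le> CX * (t - s)"
  proof -
    have "nrm (\<lambda>\<omega>. D t \<omega> - D s \<omega>) \<le> (CD * sqrt T + C1) * (t - s)" if st: "0 \<le> s" "s \<le> t" "t \<le> T" for s t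
    proof -
      have Ds: "sq_integrable (\<lambda>\<omega>. D t \<omega> - D s \<omega> - Y1 s \<omega> * (t - s))" "sq_integrable (\<lambda>\<omega>. Y1 s \<omega> * (t - s))"
        using st sq_integrable_cmult[OF sqs(4), of s "t - s"]
        by (auto intro!: sq_integrable_diff sqs simp: mult.commute[of _ "t - s"])
      have "nrm (\<lambda>\<omega>. D t \<omega> - D s \<omega>) \<le> nrm (\<lambda>\<omega>. D t \<omega> - D s \<omega> - Y1 s \<omega> * (t - s)) + nrm (\<lambda>\<omega>. (t - s) * Y1 s \<omega>)"
        using nrm_triangle[OF Ds] by (simp add: mult.commute)
      also have "\<dots> \<le> CD * sqrt (t - s) * (t - s) + (t - s) * C1"
        using Dg[OF st] C1(2)[of s] st unfolding nrm_cmult by (intro add_mono) (auto intro: mult_left_mono)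
      also have "CD * sqrt (t - s) * (t - s) \<le> CD * sqrt T * (t - s)"
        using D(1) st by (intro mult_right_mono mult_left_mono) auto
      finally show ?thesis by (simp add: algebra_simps)
    qed
    moreover have "0 \<le> CD * sqrt T + C1" using D(1) C1(1) T by simp
    ultimately show ?thesis using that by blast
  qed
  define K where "K = CI * sqrt T + C1 * sqrt (2 * T) + CY * T + CD * T"
  define C where "C = K + CI + CX + CD"
  have pos: "0 \<le> CI * sqrt T" "0 \<le> C1 * sqrt (2 * T)" "0 \<le> CY * T" "0 \<le> CD * T"
    using I(1) C1(1) CY D(1) T by auto
  have K0: "0 \<le> K" using pos by (simp add: K_def)
  have C0: "0 \<le> C" using K0 I(1) CX(1) D(1) by (simp add: C_def)
  have Xg: "nrm (\<lambda>\<omega>. X t \<omega> - X s \<omega> - Y s \<omega> * inc s t i \<omega>) \<le> C * (t - s)"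
    if st: "0 \<le> s" "s \<le> t" "t \<le> T" for s t
  proof -
    have eq: "(\<lambda>\<omega>. X t \<omega> - X s \<omega> - Y s \<omega> * inc s t i \<omega>) =
        (\<lambda>\<omega>. (I t \<omega> - I s \<omega> - Y s \<omega> * inc s t i \<omega>) + c * (D t \<omega> - D s \<omega>))"
      by (simp add: X_def algebra_simps)
    have "nrm (\<lambda>\<omega>. X t \<omega> - X s \<omega> - Y s \<omega> * inc s t i \<omega>) \<le>
        nrm (\<lambda>\<omega>. I t \<omega> - I s \<omega> - Y s \<omega> * inc s t i \<omega>) + nrm (\<lambda>\<omega>. c * (D t \<omega> - D s \<omega>))"
      unfolding eq using st
      by (intro nrm_triangle sq_integrable_diff sq_integrable_cmult sqs sqYB) auto
    also have "\<dots> \<le> CI * (t - s) + 1 * (CX * (t - s))"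
      unfolding nrm_cmult using Ig[OF st] CX(2)[OF st] c by (intro add_mono mult_mono) auto
    also have "\<dots> \<le> C * (t - s)"
      using st K0 D(1) unfolding C_def by (simp add: distrib_right)
    finally show ?thesis .
  qed
  \<comment> \<open>The Ito part is centred, so only the correction moves the mean.\<close>
  have Xm: "\<bar>expectation (X t) - expectation (X s) - (if i = j then expectation (Y1 s) / 2 else 0) * (t - s)\<bar>
         \<le> C * sqrt (t - s) * (t - s)"
    if st: "0 \<le> s" "s \<le> t" "t \<le> T" for s t
  proof -
    have int: "integrable P (I t)" "integrable P (I s)" "integrable P (D t)" "integrable P (D s)" "integrable P (Y1 s)"
      using sqs st by (auto intro!: sq_integrable_imp_integrable)
    have EX: "expectation (X u) = c * expectation (D u)" if "0 \<le> u" "u \<le> T" for u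
      unfolding X_def using Im[OF that] sq_integrable_imp_integrable[OF sqs(1)[OF that]]
        sq_integrable_imp_integrable[OF sqs(2)[OF that]] by simp
    have sqR: "sq_integrable (\<lambda>\<omega>. D t \<omega> - D s \<omega> - (t - s) * Y1 s \<omega>)"
      using st by (intro sq_integrable_diff sq_integrable_cmult sqs) auto
    have "expectation (X t) - expectation (X s) - (if i = j then expectation (Y1 s) / 2 else 0) * (t - s) =
        c * (\<integral>\<omega>. D t \<omega> - D s \<omega> - (t - s) * Y1 s \<omega> \<partial>P)"
      using int st EX by (simp add: c_def algebra_simps)
    also have "\<bar>\<dots>\<bar> \<le> 1 * nrm (\<lambda>\<omega>. D t \<omega> - D s \<omega> - (t - s) * Y1 s \<omega>)"
      unfolding abs_mult using c abs_integral_le_nrm[OF sqR] by (intro mult_mono) auto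
    also have "\<dots> \<le> CD * sqrt (t - s) * (t - s)"
      using Dg[OF st] by (simp add: mult.commute)
    also have "\<dots> \<le> C * sqrt (t - s) * (t - s)"
      using st K0 I(1) CX(1) unfolding C_def by (intro mult_right_mono) auto
    finally show ?thesis .
  qed
  have main: "sq_integrable (X (r N)) \<and>
       integrable P (trapezoid Y i r N) \<and>
       (\<integral>\<omega>. \<bar>trapezoid Y i r N \<omega> - X (r N) \<omega>\<bar> \<partial>P)
         \<le> C * sqrt \<delta>"
    if r: "mono r" "r 0 = 0" "r N \<le> T" and \<delta>: "0 < \<delta>" and mesh': "\<forall>k<N. r (Suc k) - r k < \<delta>" for r :: "nat \<Rightarrow> real" and N \<delta>
  proof -
    have r0: "0 \<le> r k" "r k \<le> r (Suc k)" for k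
      using r monoD[OF r(1), of 0 k] monoD[OF r(1), of k "Suc k"] by auto
    have mesh: "r (Suc k) - r k < \<delta>" if "k < N" for k using mesh' that by blast
    have rT: "r k \<le> T" if "k \<le> N" for k using monoD[OF r(1) that] r(3) by simp
    let ?b = "\<lambda>k. inc (r k) (r (Suc k)) i" and ?b' = "\<lambda>k. inc (r k) (r (Suc k)) j"
    let ?\<Delta> = "\<lambda>k. r (Suc k) - r k"
    \<comment> \<open>The error on one cell splits into the remainder of the Ito integral, the
      compensated covariation, the remainder of \<open>Y\<close> and that of the time integral. The
      first two are martingale differences; the other two are small enough to be summed in
      norm.\<close>
    define RI where "RI k = (\<lambda>\<omega>. I (r (Suc k)) \<omega> - I (r k) \<omega> - Y (r k) \<omega> * ?b k \<omega>)" for k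
    define Q where "Q k = (\<lambda>\<omega>. Y1 (r k) \<omega> * (?b' k \<omega> * ?b k \<omega> - (if j = i then ?\<Delta> k else 0)))" for k
    define RY where "RY k = (\<lambda>\<omega>. Y (r (Suc k)) \<omega> - Y (r k) \<omega> - Y1 (r k) \<omega> * ?b' k \<omega>)" for k
    define RD where "RD k = (\<lambda>\<omega>. D (r (Suc k)) \<omega> - D (r k) \<omega> - ?\<Delta> k * Y1 (r k) \<omega>)" for k
    have \<Delta>0: "0 \<le> ?\<Delta> k" for k using r0(2)[of k] by simp
    have \<Delta>sum: "(\<Sum>k<N. ?\<Delta> k) \<le> T"
      using r(2,3) by (simp only: sum_lessThan_telescope)
    \<comment> \<open>Orthogonal errors of the size of the cell length cost the square root of this
      sum, which is where the rate \<open>sqrt \<delta>\<close> comes from.\<close>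
    have sq\<Delta>: "(\<Sum>k<N. (?\<Delta> k)\<^sup>2) \<le> \<delta> * T"
    proof -
      have "(\<Sum>k<N. (?\<Delta> k)\<^sup>2) \<le> (\<Sum>k<N. \<delta> * ?\<Delta> k)"
        unfolding power2_eq_square using mesh \<Delta>0 by (intro sum_mono mult_right_mono) (auto intro: less_imp_le)
      also have "\<dots> \<le> \<delta> * T" unfolding sum_distrib_left[symmetric] using \<Delta>sum \<delta> by (intro mult_left_mono) auto
      finally show ?thesis .
    qed
    have sq: "sq_integrable (RI k)" "sq_integrable (Q k)" "sq_integrable (RY k)" "sq_integrable (RD k)"
      if k: "k < N" for k
    proof -
      have kk: "r (Suc k) \<le> T" "r k \<le> T" using rT[of k] rT[of "Suc k"] k by auto
      show "sq_integrable (RI k)" "sq_integrable (RY k)" "sq_integrable (RD k)"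
        unfolding RI_def RY_def RD_def
        by (intro sq_integrable_diff sq_integrable_cmult sqs sqYB r0 kk)+
      show "sq_integrable (Q k)"
        unfolding Q_def
        using mdiffD(1)[OF mdiff_mult_covariation(1)[OF r0(1,2) nice_past[OF Y1 r0(1) kk(2)], of j i]]
        by (auto dest: past_sqD)
    qed
    have eq: "trapezoid Y i r N \<omega> - X (r N) \<omega> =
        1/2 * (\<Sum>k<N. Q k \<omega>) + 1/2 * (\<Sum>k<N. RY k \<omega> * ?b k \<omega>) - (\<Sum>k<N. RI k \<omega>) - c * (\<Sum>k<N. RD k \<omega>)" for \<omega>
    proof -
      have "X (r N) \<omega> = (\<Sum>k<N. X (r (Suc k)) \<omega> - X (r k) \<omega>)"
        using sum_lessThan_telescope[of "\<lambda>k. X (r k) \<omega>" N] I(2) D(2) r(2) by (simp add: X_def)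
      then show ?thesis
        unfolding sum_distrib_left sum_subtractf[symmetric] sum.distrib[symmetric]
        by (simp only: sum_subtractf[symmetric])
          (intro sum.cong refl, simp add: X_def RI_def Q_def RY_def RD_def c_def field_simps)
    qed
    \<comment> \<open>A remainder of the order of the cell length times an increment of the order of
      its square root. Cauchy-Schwarz bounds the product in L1, which is why the whole comparison is
      made in L1.\<close>
    have RYb: "integrable P (\<lambda>\<omega>. RY k \<omega> * ?b k \<omega>)"
      "(\<integral>\<omega>. \<bar>RY k \<omega> * ?b k \<omega>\<bar> \<partial>P) \<le> CY * sqrt \<delta> * ?\<Delta> k" if k: "k < N" for k
    proof -
      note s = sq(3)[OF k] sqinc[OF r0(1,2), of k i]
      show "integrable P (\<lambda>\<omega>. RY k \<omega> * ?b k \<omega>)" by (rule sq_integrable_mult[OF s])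
      have "(\<integral>\<omega>. \<bar>RY k \<omega> * ?b k \<omega>\<bar> \<partial>P) \<le> nrm (RY k) * nrm (?b k)" by (rule Cauchy_Schwarz_nrm[OF s])
      also have "\<dots> \<le> (CY * ?\<Delta> k) * sqrt \<delta>"
      proof (rule mult_mono)
        show "nrm (RY k) \<le> CY * ?\<Delta> k" unfolding RY_def
          using rT[of "Suc k"] k by (intro germ r0) auto
        show "nrm (?b k) \<le> sqrt \<delta>" using nrminc[OF r0(1,2), of k i] mesh[OF k] by simp
      qed (use CY \<Delta>0 in auto)
      finally show "(\<integral>\<omega>. \<bar>RY k \<omega> * ?b k \<omega>\<bar> \<partial>P) \<le> CY * sqrt \<delta> * ?\<Delta> k" by (simp add: mult.assoc mult.commute[of "sqrt \<delta>"])
    qed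
    have intRYb: "integrable P (\<lambda>\<omega>. \<Sum>k<N. RY k \<omega> * ?b k \<omega>)"
      using RYb(1) by (intro Bochner_Integration.integrable_sum) auto
    have b3: "(\<integral>\<omega>. \<bar>\<Sum>k<N. RY k \<omega> * ?b k \<omega>\<bar> \<partial>P) \<le> CY * T * sqrt \<delta>"
    proof -
      have "(\<integral>\<omega>. \<bar>\<Sum>k<N. RY k \<omega> * ?b k \<omega>\<bar> \<partial>P) \<le> (\<integral>\<omega>. (\<Sum>k<N. \<bar>RY k \<omega> * ?b k \<omega>\<bar>) \<partial>P)"
        using RYb(1) intRYb by (intro integral_mono Bochner_Integration.integrable_sum sum_abs integrable_abs) auto
      also have "\<dots> = (\<Sum>k<N. \<integral>\<omega>. \<bar>RY k \<omega> * ?b k \<omega>\<bar> \<partial>P)"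
        using RYb(1) by (intro Bochner_Integration.integral_sum integrable_abs) auto
      also have "\<dots> \<le> (\<Sum>k<N. CY * sqrt \<delta> * ?\<Delta> k)" using RYb(2) by (intro sum_mono) auto
      also have "\<dots> \<le> CY * sqrt \<delta> * T" unfolding sum_distrib_left[symmetric]
        using \<Delta>sum CY \<delta> by (intro mult_left_mono) auto
      finally show ?thesis by (simp add: ac_simps)
    qed
    have sumsq: "nrm (\<lambda>\<omega>. \<Sum>k<N. U k \<omega>) \<le> K' * sqrt T * sqrt \<delta>"
      if md: "\<And>k. k < N \<Longrightarrow> mdiff (r k) (r (Suc k)) (U k)"
        and le: "\<And>k. k < N \<Longrightarrow> (nrm (U k))\<^sup>2 \<le> K'\<^sup>2 * (?\<Delta> k)\<^sup>2" and K': "0 \<le> K'" for U K'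
    proof (rule power2_le_imp_le)
      have "(nrm (\<lambda>\<omega>. \<Sum>k<N. U k \<omega>))\<^sup>2 = (\<Sum>k<N. (nrm (U k))\<^sup>2)"
        using mdiff_orthogonal[OF r(1), of N U] md by blast
      also have "\<dots> \<le> (\<Sum>k<N. K'\<^sup>2 * (?\<Delta> k)\<^sup>2)" using le by (intro sum_mono) auto
      also have "\<dots> \<le> K'\<^sup>2 * (\<delta> * T)"
        unfolding sum_distrib_left[symmetric] using sq\<Delta> by (intro mult_left_mono) auto
      also have "\<dots> = (K' * sqrt T * sqrt \<delta>)\<^sup>2" using T \<delta> by (simp add: power_mult_distrib)
      finally show "(nrm (\<lambda>\<omega>. \<Sum>k<N. U k \<omega>))\<^sup>2 \<le> (K' * sqrt T * sqrt \<delta>)\<^sup>2" .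
      show "0 \<le> K' * sqrt T * sqrt \<delta>" using K' T \<delta> by simp
    qed
    have b1: "nrm (\<lambda>\<omega>. \<Sum>k<N. RI k \<omega>) \<le> CI * sqrt T * sqrt \<delta>"
    proof (rule sumsq)
      fix k assume "k < N"
      then have kk: "r (Suc k) \<le> T" using rT by auto
      show "mdiff (r k) (r (Suc k)) (RI k)" unfolding RI_def by (rule Imd[OF r0(1,2) kk])
      have "nrm (RI k) \<le> CI * ?\<Delta> k" unfolding RI_def by (rule Ig[OF r0(1,2) kk])
      then show "(nrm (RI k))\<^sup>2 \<le> CI\<^sup>2 * (?\<Delta> k)\<^sup>2"
        unfolding power_mult_distrib[symmetric] by (intro power_mono) auto
    qed (rule I)
    have b2: "nrm (\<lambda>\<omega>. \<Sum>k<N. Q k \<omega>) \<le> (C1 * sqrt 2) * sqrt T * sqrt \<delta>"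
    proof (rule sumsq)
      fix k assume "k < N"
      then have kk: "r k \<le> T" using rT by auto
      note m = mdiff_mult_covariation[OF r0(1,2) nice_past[OF Y1 r0(1) kk], of j i]
      show "mdiff (r k) (r (Suc k)) (Q k)" unfolding Q_def by (rule m(1))
      have "(nrm (Y1 (r k)))\<^sup>2 * (2 * (?\<Delta> k)\<^sup>2) \<le> C1\<^sup>2 * (2 * (?\<Delta> k)\<^sup>2)"
        using C1(2)[OF r0(1) kk] by (intro mult_right_mono power_mono) auto
      then show "(nrm (Q k))\<^sup>2 \<le> (C1 * sqrt 2)\<^sup>2 * (?\<Delta> k)\<^sup>2"
        using m(2) by (simp add: Q_def power_mult_distrib)
    qed (use C1(1) in simp)
    have b4: "nrm (\<lambda>\<omega>. \<Sum>k<N. RD k \<omega>) \<le> CD * T * sqrt \<delta>"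
    proof -
      have "nrm (\<lambda>\<omega>. \<Sum>k<N. RD k \<omega>) \<le> (\<Sum>k<N. nrm (RD k))"
        using sq(4) by (intro nrm_sum_le) auto
      also have "\<dots> \<le> (\<Sum>k<N. CD * sqrt \<delta> * ?\<Delta> k)"
      proof (rule sum_mono)
        fix k assume "k \<in> {..<N}"
        then have k: "k < N" and kk: "r (Suc k) \<le> T" using rT by auto
        have "nrm (RD k) \<le> CD * sqrt (?\<Delta> k) * ?\<Delta> k"
          using Dg[OF r0(1,2) kk] by (simp add: RD_def mult.commute[of "Y1 (r k) _"])
        also have "\<dots> \<le> CD * sqrt \<delta> * ?\<Delta> k"
          using mesh[OF k] \<Delta>0[of k] D(1) by (intro mult_right_mono mult_left_mono) auto
        finally show "nrm (RD k) \<le> CD * sqrt \<delta> * ?\<Delta> k" .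
      qed
      also have "\<dots> \<le> CD * sqrt \<delta> * T" unfolding sum_distrib_left[symmetric]
        using \<Delta>sum D(1) \<delta> by (intro mult_left_mono) auto
      finally show ?thesis by (simp add: ac_simps)
    qed
    have sqS: "sq_integrable (\<lambda>\<omega>. \<Sum>k<N. RI k \<omega>)" "sq_integrable (\<lambda>\<omega>. \<Sum>k<N. Q k \<omega>)"
        "sq_integrable (\<lambda>\<omega>. \<Sum>k<N. RD k \<omega>)"
      using sq by (auto intro!: sq_integrable_sum)
    note ints = sqS[THEN sq_integrable_imp_integrable] intRYb
    let ?W = "\<lambda>\<omega>. 1/2 * (\<Sum>k<N. Q k \<omega>) + 1/2 * (\<Sum>k<N. RY k \<omega> * ?b k \<omega>) - (\<Sum>k<N. RI k \<omega>) - c * (\<Sum>k<N. RD k \<omega>)"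
    let ?V = "\<lambda>\<omega>. \<bar>\<Sum>k<N. Q k \<omega>\<bar> + \<bar>\<Sum>k<N. RY k \<omega> * ?b k \<omega>\<bar> + \<bar>\<Sum>k<N. RI k \<omega>\<bar> + \<bar>\<Sum>k<N. RD k \<omega>\<bar>"
    have intW: "integrable P ?W"
      using ints by (intro Bochner_Integration.integrable_diff Bochner_Integration.integrable_add integrable_mult_right) auto
    have sqXN: "sq_integrable (X (r N))" using r0(1)[of N] r(3) by (intro sqs)
    have "integrable P (\<lambda>\<omega>. ?W \<omega> + X (r N) \<omega>)"
      by (intro Bochner_Integration.integrable_add intW sq_integrable_imp_integrable sqXN)
    then have int: "integrable P (trapezoid Y i r N)"
      by (simp only: eq[symmetric] diff_add_cancel)
    have "(\<integral>\<omega>. \<bar>?W \<omega>\<bar> \<partial>P) \<le> (\<integral>\<omega>. ?V \<omega> \<partial>P)"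
    proof (rule integral_mono)
      show "integrable P (\<lambda>\<omega>. \<bar>?W \<omega>\<bar>)" using intW by (rule integrable_abs)
      show "integrable P ?V"
        using ints by (intro Bochner_Integration.integrable_add integrable_abs)
      fix \<omega>
      have "\<bar>1/2 * a + 1/2 * b - d - c * e\<bar> \<le> \<bar>a\<bar> + \<bar>b\<bar> + \<bar>d\<bar> + \<bar>e\<bar>" for a b d e :: real
      proof -
        have "\<bar>c * e\<bar> \<le> 1 * \<bar>e\<bar>" unfolding abs_mult using c by (intro mult_right_mono) auto
        then show ?thesis by linarith
      qed
      then show "\<bar>?W \<omega>\<bar> \<le> ?V \<omega>" .
    qed
    also have "\<dots> = (\<integral>\<omega>. \<bar>\<Sum>k<N. Q k \<omega>\<bar> \<partial>P) + (\<integral>\<omega>. \<bar>\<Sum>k<N. RY k \<omega> * ?b k \<omega>\<bar> \<partial>P)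
        + (\<integral>\<omega>. \<bar>\<Sum>k<N. RI k \<omega>\<bar> \<partial>P) + (\<integral>\<omega>. \<bar>\<Sum>k<N. RD k \<omega>\<bar> \<partial>P)"
      using ints[THEN integrable_abs] by simp
    also have "\<dots> \<le> C1 * sqrt 2 * sqrt T * sqrt \<delta> + CY * T * sqrt \<delta> + CI * sqrt T * sqrt \<delta> + CD * T * sqrt \<delta>"
      using b1 b2 b3 b4 sqS[THEN integral_abs_le_nrm] by (intro add_mono) auto
    also have "\<dots> = K * sqrt \<delta>"
      by (simp add: K_def algebra_simps real_sqrt_mult)
    also have "\<dots> \<le> C * sqrt \<delta>"
      using I(1) CX(1) D(1) \<delta> unfolding C_def by (intro mult_right_mono) auto
    finally show ?thesis
      using sqXN int unfolding eq by blast
  qed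
  have X0: "expectation (X 0) = 0" by (simp add: X_def I(2) D(2))
  show ?thesis
    by (rule that[OF C0 Xn Xg X0 Xm main])
qed

end

section \<open>Stratonovich integrals as limits in probability\<close>

lemma uniform_partition:
  assumes "0 \<le> t" "0 < \<delta>"
  obtains ts where "is_partition 0 t ts" "mesh_less ts \<delta>"
proof -
  obtain N :: nat where N: "t / \<delta> < real N" using reals_Archimedean2 by blast
  have N0: "0 < N" using N assms by (metis divide_nonneg_pos less_le_trans not_gr_zero of_nat_0 not_less)
  have tN: "t / real N < \<delta>" using N N0 assms by (simp add: field_simps)
  let ?ts = "map (\<lambda>k. real k * (t / real N)) [0..<Suc N]"
  have "is_partition 0 t ?ts"
    unfolding is_partition_def
  proof (intro conjI)
    show "?ts \<noteq> []" by simp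
    show "hd ?ts = 0" by (simp add: hd_map del: upt_Suc)
    show "last ?ts = t" using N0 by (simp add: last_map)
    show "sorted ?ts" using assms N0
      by (auto simp: sorted_iff_nth_mono simp del: upt_Suc intro!: divide_right_mono mult_right_mono)
  qed
  moreover have "mesh_less ?ts \<delta>"
    using tN unfolding mesh_less_def by (auto simp: algebra_simps add_divide_distrib simp del: upt_Suc)
  ultimately show ?thesis by (rule that)
qed

lemma partition_points:
  assumes "is_partition s t ts" "k < length ts"
  shows "s \<le> ts ! k" "ts ! k \<le> t"
proof -
  have ne: "ts \<noteq> []" and hd: "hd ts = s" and la: "last ts = t" and so: "sorted ts"
    using assms by (auto simp: is_partition_def)
  show "s \<le> ts ! k" using sorted_nth_mono[OF so, of 0 k] assms(2) hd ne by (simp add: hd_conv_nth)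
  show "ts ! k \<le> t" using sorted_nth_mono[OF so, of k "length ts - 1"] assms(2) la ne
    by (simp add: last_conv_nth)
qed

context prob_space
begin

text \<open>Two limits in probability are compared along one partition fine enough for both.
  Measurability is essential: \<open>measure\<close> is 0 on nonmeasurable sets, where the defining
  bound would say nothing.\<close>

lemma stratonovich_integral_unique:
  assumes t: "0 \<le> t" and Z: "is_stratonovich_integral M Y X 0 t Z" "is_stratonovich_integral M Y X 0 t Z'"
    and meas: "\<And>u. 0 \<le> u \<Longrightarrow> u \<le> t \<Longrightarrow> Y u \<in> borel_measurable M \<and> X u \<in> borel_measurable M"
  shows "AE \<omega> in M. Z \<omega> = Z' \<omega>"
proof -
  have [measurable]: "Z \<in> borel_measurable M" "Z' \<in> borel_measurable M"
    using Z by (auto simp: is_stratonovich_integral_def)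
  have "prob {\<omega> \<in> space M. \<bar>Z \<omega> - Z' \<omega>\<bar> > 2 * \<epsilon>} \<le> 0" if \<epsilon>: "0 < \<epsilon>" for \<epsilon>
  proof (rule field_le_epsilon)
    fix e :: real assume e: "0 < e"
    then have e2: "0 < e / 2" by simp
    obtain \<delta> where \<delta>: "0 < \<delta>" "\<And>ts. is_partition 0 t ts \<Longrightarrow> mesh_less ts \<delta> \<Longrightarrow>
        prob {\<omega> \<in> space M. \<bar>stratonovich_sum Y X ts \<omega> - Z \<omega>\<bar> > \<epsilon>} < e / 2"
      using conjunct2[OF Z(1)[unfolded is_stratonovich_integral_def], rule_format, OF \<epsilon> e2] by blast
    obtain \<delta>' where \<delta>': "0 < \<delta>'" "\<And>ts. is_partition 0 t ts \<Longrightarrow> mesh_less ts \<delta>' \<Longrightarrow>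
        prob {\<omega> \<in> space M. \<bar>stratonovich_sum Y X ts \<omega> - Z' \<omega>\<bar> > \<epsilon>} < e / 2"
      using conjunct2[OF Z(2)[unfolded is_stratonovich_integral_def], rule_format, OF \<epsilon> e2] by blast
    obtain ts where ts: "is_partition 0 t ts" "mesh_less ts (min \<delta> \<delta>')"
      using uniform_partition[OF t, of "min \<delta> \<delta>'"] \<delta>(1) \<delta>'(1) by auto
    then have ml: "mesh_less ts \<delta>" "mesh_less ts \<delta>'" by (auto simp: mesh_less_def)
    have [measurable]: "stratonovich_sum Y X ts \<in> borel_measurable M"
      unfolding stratonovich_sum_def[abs_def]
    proof (intro borel_measurable_sum borel_measurable_times borel_measurable_divide
        borel_measurable_add borel_measurable_diff borel_measurable_const)
      fix k assume "k \<in> {..<length ts - 1}"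
      then have "k < length ts" "Suc k < length ts" by auto
      note p = partition_points[OF ts(1) this(1)] partition_points[OF ts(1) this(2)]
      show "Y (ts ! k) \<in> borel_measurable M" "Y (ts ! Suc k) \<in> borel_measurable M"
        "X (ts ! k) \<in> borel_measurable M" "X (ts ! Suc k) \<in> borel_measurable M"
        using meas p by auto
    qed
    let ?A = "{\<omega> \<in> space M. \<bar>stratonovich_sum Y X ts \<omega> - Z \<omega>\<bar> > \<epsilon>}"
    let ?B = "{\<omega> \<in> space M. \<bar>stratonovich_sum Y X ts \<omega> - Z' \<omega>\<bar> > \<epsilon>}"
    have "prob {\<omega> \<in> space M. \<bar>Z \<omega> - Z' \<omega>\<bar> > 2 * \<epsilon>} \<le> prob (?A \<union> ?B)"
      by (rule finite_measure_mono) auto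
    also have "\<dots> \<le> prob ?A + prob ?B"
      by (rule measure_Un_le) auto
    finally show "prob {\<omega> \<in> space M. \<bar>Z \<omega> - Z' \<omega>\<bar> > 2 * \<epsilon>} \<le> 0 + e"
      using \<delta>(2)[OF ts(1) ml(1)] \<delta>'(2)[OF ts(1) ml(2)] by linarith
  qed
  then have "prob {\<omega> \<in> space M. \<bar>Z \<omega> - Z' \<omega>\<bar> > 2 * \<epsilon>} = 0" if "0 < \<epsilon>" for \<epsilon>
    using that measure_nonneg[of M] by (meson antisym)
  then have "AE \<omega> in M. \<not> \<bar>Z \<omega> - Z' \<omega>\<bar> > 2 * inverse (real (Suc n))" for n
  proof -
    assume *: "\<And>\<epsilon>. 0 < \<epsilon> \<Longrightarrow> prob {\<omega> \<in> space M. \<bar>Z \<omega> - Z' \<omega>\<bar> > 2 * \<epsilon>} = 0"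
    have "AE \<omega> in M. \<omega> \<notin> {\<omega> \<in> space M. \<bar>Z \<omega> - Z' \<omega>\<bar> > 2 * inverse (real (Suc n))}"
      by (subst prob_eq_0[symmetric]) (auto intro!: *)
    then show ?thesis by (rule AE_mp) (auto intro: AE_I2)
  qed
  then have "AE \<omega> in M. \<forall>n. \<not> \<bar>Z \<omega> - Z' \<omega>\<bar> > 2 * inverse (real (Suc n))"
    by (simp add: AE_all_countable)
  then show ?thesis
  proof eventually_elim
    case (elim \<omega>)
    show ?case
    proof (rule ccontr)
      assume "Z \<omega> \<noteq> Z' \<omega>"
      then have "0 < \<bar>Z \<omega> - Z' \<omega>\<bar> / 2" by simp
      then obtain n where "inverse (real (Suc n)) < \<bar>Z \<omega> - Z' \<omega>\<bar> / 2"
        using reals_Archimedean by blast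
      then have "2 * inverse (real (Suc n)) < \<bar>Z \<omega> - Z' \<omega>\<bar>" by (simp del: of_nat_Suc)
      with elim show False by blast
    qed
  qed
qed

lemma is_stratonovich_integralI_L1:
  assumes Z: "Z \<in> borel_measurable M" and K: "0 \<le> K"
    and int: "\<And>ts \<delta>. is_partition s t ts \<Longrightarrow> 0 < \<delta> \<Longrightarrow> mesh_less ts \<delta> \<Longrightarrow>
        integrable M (\<lambda>\<omega>. stratonovich_sum Y X ts \<omega> - Z \<omega>) \<and>
        (\<integral>\<omega>. \<bar>stratonovich_sum Y X ts \<omega> - Z \<omega>\<bar> \<partial>M) \<le> K * sqrt \<delta>"
  shows "is_stratonovich_integral M Y X s t Z"
  unfolding is_stratonovich_integral_def
proof (intro conjI allI impI Z)
  fix \<epsilon> \<eta> :: real assume \<epsilon>: "0 < \<epsilon>" and \<eta>: "0 < \<eta>"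
  \<comment> \<open>Markov's inequality then gives \<open>K / (K + 1) * \<eta>\<close>; adding 1 to
    \<open>K\<close> makes this strictly less than \<open>\<eta>\<close> and covers
    \<open>K = 0\<close>.\<close>
  define \<delta> where "\<delta> = (\<epsilon> * \<eta> / (K + 1))\<^sup>2"
  have \<delta>0: "0 < \<delta>" using \<epsilon> \<eta> K by (simp add: \<delta>_def zero_less_power)
  show "\<exists>\<delta>>0. \<forall>ts. is_partition s t ts \<longrightarrow> mesh_less ts \<delta> \<longrightarrow>
        prob {\<omega> \<in> space M. \<epsilon> < \<bar>stratonovich_sum Y X ts \<omega> - Z \<omega>\<bar>} < \<eta>"
  proof (intro exI[of _ \<delta>] conjI allI impI \<delta>0)
    fix ts assume ts: "is_partition s t ts" "mesh_less ts \<delta>"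
    let ?D = "\<lambda>\<omega>. stratonovich_sum Y X ts \<omega> - Z \<omega>"
    have D: "integrable M ?D" "(\<integral>\<omega>. \<bar>?D \<omega>\<bar> \<partial>M) \<le> K * sqrt \<delta>"
      using int[OF ts(1) \<delta>0 ts(2)] by auto
    then have [measurable]: "?D \<in> borel_measurable M" by auto
    have "prob {\<omega> \<in> space M. \<epsilon> < \<bar>?D \<omega>\<bar>} \<le> prob {\<omega> \<in> space M. \<epsilon> \<le> \<bar>?D \<omega>\<bar>}"
      by (rule finite_measure_mono) auto
    also have "\<dots> \<le> (\<integral>\<omega>. \<bar>?D \<omega>\<bar> \<partial>M) / \<epsilon>"
      using D(1) \<epsilon> by (intro integral_Markov_inequality_measure[where A = "{}"]) auto
    also have "\<dots> \<le> K * sqrt \<delta> / \<epsilon>" using D(2) \<epsilon> by (simp add: divide_right_mono)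
    also have "\<dots> = K / (K + 1) * \<eta>" using \<epsilon> \<eta> K by (simp add: \<delta>_def)
    also have "\<dots> < \<eta>" using K \<eta> by (simp add: field_simps)
    finally show "prob {\<omega> \<in> space M. \<epsilon> < \<bar>?D \<omega>\<bar>} < \<eta>" .
  qed
qed

end

section \<open>Means of the iterated Stratonovich integrals\<close>

fun pair_weight :: "'d list \<Rightarrow> real" where
  "pair_weight [] = 1"
| "pair_weight [i] = 0"
| "pair_weight (i # j # w) = (if i = j then pair_weight w / 2 else 0)"

text \<open>Coefficient of \<open>exp (t / 2 * (\<Sum>i. e\<^sub>i \<otimes> e\<^sub>i))\<close>:
  only words of consecutive equal pairs occur, with weight 1/2 per pair, and the factorial is that
  of the exponential series. On odd lengths \<open>pair_weight\<close> is 0.\<close>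

definition sig_mean :: "'d list \<Rightarrow> real \<Rightarrow> real" where
  "sig_mean w t = pair_weight w * t ^ (length w div 2) / fact (length w div 2)"

lemma pair_weight_nonneg: "0 \<le> pair_weight w"
  by (induction w rule: pair_weight.induct) auto

lemma power_increment_bounds:
  fixes s t :: real
  assumes "0 \<le> s" "s \<le> t"
  shows "real (Suc n) * s ^ n * (t - s) \<le> t ^ Suc n - s ^ Suc n" (is ?lower)
    and "t ^ Suc n - s ^ Suc n \<le> real (Suc n) * t ^ n * (t - s)" (is ?upper)
proof -
  have eq: "t ^ Suc n - s ^ Suc n = (t - s) * (\<Sum>i<Suc n. t ^ i * s ^ (n - i))"
    using power_diff_sumr2[of t "Suc n" s] by (simp add: mult.commute)
  have "t ^ i * s ^ (n - i) \<le> t ^ n" "s ^ n \<le> t ^ i * s ^ (n - i)" if "i < Suc n" for i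
  proof -
    have "t ^ i * s ^ (n - i) \<le> t ^ i * t ^ (n - i)"
      using assms by (intro mult_left_mono power_mono) auto
    also have "\<dots> = t ^ n" using that by (simp flip: power_add)
    finally show "t ^ i * s ^ (n - i) \<le> t ^ n" .
    have "s ^ n = s ^ i * s ^ (n - i)" using that by (simp flip: power_add)
    also have "\<dots> \<le> t ^ i * s ^ (n - i)" using assms by (intro mult_right_mono power_mono) auto
    finally show "s ^ n \<le> t ^ i * s ^ (n - i)" .
  qed
  then have "(\<Sum>i<Suc n. t ^ i * s ^ (n - i)) \<le> real (Suc n) * t ^ n"
    "real (Suc n) * s ^ n \<le> (\<Sum>i<Suc n. t ^ i * s ^ (n - i))"
    using sum_bounded_above[of "{..<Suc n}" "\<lambda>i. t ^ i * s ^ (n - i)" "t ^ n"]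
      sum_bounded_below[of "{..<Suc n}" "s ^ n" "\<lambda>i. t ^ i * s ^ (n - i)"]
    by (simp_all del: sum.lessThan_Suc of_nat_Suc)
  then show ?lower ?upper
    using assms unfolding eq by (auto simp: mult.commute[of "t - s"] intro!: mult_right_mono simp del: sum.lessThan_Suc of_nat_Suc)
qed

text \<open>The hypothesis fixes each increment up to the power 3/2 of the step, so over
  \<open>N\<close> equal cells the total of these errors is of order \<open>1 / sqrt N\<close>. This
  recovers the integral of the power without differentiating \<open>f\<close>.\<close>

lemma integrate_power:
  fixes f :: "real \<Rightarrow> real"
  assumes f0: "f 0 = 0" and c: "0 \<le> c" and C: "0 \<le> C"
    and f: "\<And>s t. 0 \<le> s \<Longrightarrow> s \<le> t \<Longrightarrow> t \<le> T \<Longrightarrow>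
       \<bar>f t - f s - c * s ^ n / fact n * (t - s)\<bar> \<le> C * sqrt (t - s) * (t - s)"
    and t: "0 \<le> t" "t \<le> T"
  shows "f t = c * t ^ Suc n / fact (Suc n)"
proof -
  define F where "F s = c * s ^ Suc n / fact (Suc n)" for s :: real
  define g where "g s = c * s ^ n / fact n" for s :: real
  \<comment> \<open>A bound that telescopes: on an equidistant grid it sums to
    \<open>g t - g 0\<close> times the step.\<close>
  have F: "\<bar>F v - F u - g u * (v - u)\<bar> \<le> (g v - g u) * (v - u)" if uv: "0 \<le> u" "u \<le> v" for u v
  proof -
    let ?k = "c / fact (Suc n)"
    have k: "0 \<le> ?k" using c by simp
    have gk: "g x * (v - u) = ?k * (real (Suc n) * x ^ n * (v - u))" for x
    proof -
      have "?k * real (Suc n) = c / fact n" by (simp del: of_nat_Suc)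
      then have "c / fact n * x ^ n * (v - u) = (?k * real (Suc n)) * x ^ n * (v - u)" by (simp only:)
      then show ?thesis by (simp add: g_def mult.assoc del: of_nat_Suc fact_Suc)
    qed
    have Fk: "F v - F u = ?k * (v ^ Suc n - u ^ Suc n)" by (simp add: F_def right_diff_distrib diff_divide_distrib)
    have "g u * (v - u) \<le> F v - F u" "F v - F u \<le> g v * (v - u)"
      unfolding gk Fk
      by (rule mult_left_mono[OF power_increment_bounds(1)[OF uv] k],
          rule mult_left_mono[OF power_increment_bounds(2)[OF uv] k])
    then show ?thesis by (simp add: left_diff_distrib abs_le_iff)
  qed
  have "\<bar>f t - F t\<bar> \<le> C * t * sqrt t * (1 / sqrt (real N)) + g t * t * (1 / real N)" if N: "0 < N" for N :: nat
  proof -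
    let ?h = "t / real N"
    let ?u = "\<lambda>k. real k * ?h"
    have h: "0 \<le> ?h" using t by simp
    have u: "0 \<le> ?u k" "?u k \<le> ?u (Suc k)" "?u (Suc k) - ?u k = ?h" for k
      using t by (auto simp: algebra_simps add_divide_distrib)
    have uT: "?u (Suc k) \<le> T" if "k < N" for k
    proof -
      have "real (Suc k) * t \<le> real N * t" using that t by (intro mult_right_mono) auto
      then have "?u (Suc k) \<le> t" using N by (simp add: field_simps)
      then show ?thesis using t by linarith
    qed
    have uN: "?u N = t" using N by simp
    have tel: "f t - F t = (\<Sum>k<N. (f (?u (Suc k)) - F (?u (Suc k))) - (f (?u k) - F (?u k)))"
      using sum_lessThan_telescope[of "\<lambda>k. f (?u k) - F (?u k)" N] uN f0 by (simp add: F_def)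
    have "\<bar>f t - F t\<bar> \<le> (\<Sum>k<N. C * sqrt ?h * ?h + (g (?u (Suc k)) - g (?u k)) * ?h)"
      unfolding tel
    proof (rule order_trans[OF sum_abs], rule sum_mono)
      fix k assume "k \<in> {..<N}"
      then have k: "k < N" by simp
      have "\<bar>f (?u (Suc k)) - f (?u k) - g (?u k) * ?h\<bar> \<le> C * sqrt ?h * ?h"
        using f[OF u(1,2) uT[OF k]] unfolding u(3) g_def .
      moreover have "\<bar>F (?u (Suc k)) - F (?u k) - g (?u k) * ?h\<bar> \<le> (g (?u (Suc k)) - g (?u k)) * ?h"
        using F[OF u(1,2), of k] unfolding u(3) .
      ultimately show "\<bar>(f (?u (Suc k)) - F (?u (Suc k))) - (f (?u k) - F (?u k))\<bar> \<le>
          C * sqrt ?h * ?h + (g (?u (Suc k)) - g (?u k)) * ?h" by linarith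
    qed
    also have "\<dots> = real N * (C * sqrt ?h * ?h) + (g t - g 0) * ?h"
      unfolding sum.distrib sum_distrib_right[symmetric] sum_lessThan_telescope[of "\<lambda>k. g (?u k)" N] uN
      by simp
    also have "\<dots> \<le> real N * (C * sqrt ?h * ?h) + g t * ?h"
      using h c by (intro add_left_mono mult_right_mono) (auto simp: g_def)
    finally show ?thesis using N t by (simp add: real_sqrt_divide ac_simps)
  qed
  moreover have "(\<lambda>N. C * t * sqrt t * (1 / sqrt (real N)) + g t * t * (1 / real N)) \<longlonglongrightarrow>
      C * t * sqrt t * 0 + g t * t * 0"
  proof (intro tendsto_add tendsto_mult tendsto_const)
    show "(\<lambda>N. 1 / real N) \<longlonglongrightarrow> 0" by (rule lim_1_over_n)
    then have "(\<lambda>N. sqrt (1 / real N)) \<longlonglongrightarrow> sqrt 0" by (intro tendsto_intros)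
    then show "(\<lambda>N. 1 / sqrt (real N)) \<longlonglongrightarrow> 0" by (simp add: real_sqrt_divide)
  qed
  ultimately have "\<bar>f t - F t\<bar> \<le> C * t * sqrt t * 0 + g t * t * 0"
    by (intro LIMSEQ_le_const) (auto intro!: exI[of _ 1])
  then show ?thesis by (simp add: F_def)
qed

context brownian
begin

text \<open>\<open>Y1\<close> is the iterated integral of the word without its outermost letter \<open>j\<close>. It is carried along
  because the next trapezoidal correction is half the covariation of \<open>Y\<close> with the integrator.\<close>

definition word_process ::
    "real \<Rightarrow> 'd list \<Rightarrow> (real \<Rightarrow> 'a \<Rightarrow> real) \<Rightarrow> (real \<Rightarrow> 'a \<Rightarrow> real) \<Rightarrow> 'd \<Rightarrow> real \<Rightarrow> bool" where
  "word_process T v Y Y1 j CY \<longleftrightarrow> nice T Y \<and> nice T Y1 \<and> 0 \<le> CY \<and>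
    (\<forall>s t. 0 \<le> s \<longrightarrow> s \<le> t \<longrightarrow> t \<le> T \<longrightarrow>
       nrm (\<lambda>\<omega>. Y t \<omega> - Y s \<omega> - Y1 s \<omega> * inc s t j \<omega>) \<le> CY * (t - s)) \<and>
    (\<forall>t. 0 \<le> t \<longrightarrow> t \<le> T \<longrightarrow> stratonovich_iterated P B 0 v t \<in> borel_measurable P \<and>
       (AE \<omega> in P. stratonovich_iterated P B 0 v t \<omega> = Y t \<omega>) \<and>
       expectation (Y t) = sig_mean v t \<and>
       expectation (Y1 t) = (case v of [] \<Rightarrow> 0 | i # u \<Rightarrow> sig_mean u t)) \<and>
    (v \<noteq> [] \<longrightarrow> j = hd v)"

text \<open>The version selected by the choice operator is compared with the constructed process at
  fixed times and almost surely. That suffices to pass to the next letter, whose trapezoidal sums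
  sample the integrand at finitely many times.\<close>

lemma stratonovich_iterated_process:
  assumes T: "0 < T"
  shows "\<exists>Y Y1 j CY. word_process T v Y Y1 j CY"
proof (induction v)
  case Nil
  \<comment> \<open>The constant process has increment 0, so \<open>Y1 = 0\<close> fits with any
    letter; the empty word has no outermost one.\<close>
  show ?case
    unfolding word_process_def
    by (rule exI[of _ "\<lambda>t \<omega>. 1"], rule exI[of _ "\<lambda>t \<omega>. 0"], rule exI[of _ undefined], rule exI[of _ 0])
      (auto simp: nice_const nrm_const sig_mean_def prob_space)
next
  case (Cons i v)
  then obtain Y Y1 j CY where W: "word_process T v Y Y1 j CY" by blast
  then have Y: "nice T Y" "nice T Y1" "0 \<le> CY"
    and germ: "\<And>s t. 0 \<le> s \<Longrightarrow> s \<le> t \<Longrightarrow> t \<le> T \<Longrightarrow>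
       nrm (\<lambda>\<omega>. Y t \<omega> - Y s \<omega> - Y1 s \<omega> * inc s t j \<omega>) \<le> CY * (t - s)"
    and it: "\<And>t. 0 \<le> t \<Longrightarrow> t \<le> T \<Longrightarrow> stratonovich_iterated P B 0 v t \<in> borel_measurable P \<and>
       (AE \<omega> in P. stratonovich_iterated P B 0 v t \<omega> = Y t \<omega>)"
    and m: "\<And>t. 0 \<le> t \<Longrightarrow> t \<le> T \<Longrightarrow> expectation (Y t) = sig_mean v t"
    and m1: "\<And>t. 0 \<le> t \<Longrightarrow> t \<le> T \<Longrightarrow> expectation (Y1 t) = (case v of [] \<Rightarrow> 0 | i # u \<Rightarrow> sig_mean u t)"
    and j: "v \<noteq> [] \<Longrightarrow> j = hd v"
    unfolding word_process_def by blast+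
  obtain X C where X: "0 \<le> C" "nice T X"
    and Xg: "\<And>s t. 0 \<le> s \<Longrightarrow> s \<le> t \<Longrightarrow> t \<le> T \<Longrightarrow>
       nrm (\<lambda>\<omega>. X t \<omega> - X s \<omega> - Y s \<omega> * inc s t i \<omega>) \<le> C * (t - s)"
    and X0: "expectation (X 0) = 0"
    and Xm: "\<And>s t. 0 \<le> s \<Longrightarrow> s \<le> t \<Longrightarrow> t \<le> T \<Longrightarrow>
       \<bar>expectation (X t) - expectation (X s) - (if i = j then expectation (Y1 s) / 2 else 0) * (t - s)\<bar>
         \<le> C * sqrt (t - s) * (t - s)"
    and Xs: "\<And>r N \<delta>. mono r \<Longrightarrow> r 0 = 0 \<Longrightarrow> r N \<le> T \<Longrightarrow> 0 < \<delta> \<Longrightarrow> (\<forall>k<N. r (Suc k) - r k < \<delta>) \<Longrightarrow>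
       sq_integrable (X (r N)) \<and>
       integrable P (trapezoid Y i r N) \<and>
       (\<integral>\<omega>. \<bar>trapezoid Y i r N \<omega> - X (r N) \<omega>\<bar> \<partial>P)
         \<le> C * sqrt \<delta>"
    by (rule trapezoid_step[OF T Y, where i = i and j = j]) (rule germ, assumption+, rule that)
  let ?S = "stratonovich_iterated P B 0 v" and ?B = "\<lambda>t \<omega>. B t \<omega> $ i"
  have strat: "is_stratonovich_integral P ?S ?B 0 t (X t)" if t: "0 \<le> t" "t \<le> T" for t
  proof (rule is_stratonovich_integralI_L1[OF _ X(1)])
    show "X t \<in> borel_measurable P" using nice_sq[OF X(2) t] by (simp add: sq_integrable_def)
    fix ts \<delta> assume ts: "is_partition 0 t ts" "mesh_less ts \<delta>" and \<delta>: "0 < (\<delta>::real)"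
    define N where "N = length ts - 1"
    have len: "length ts = Suc N" using ts(1) by (cases ts) (auto simp: N_def is_partition_def)
    \<comment> \<open>\<open>min\<close> extends the list of points to a monotone sequence on all
      naturals, constant after its end.\<close>
    define r where "r k = ts ! (min k N)" for k
    have so: "sorted ts" using ts(1) by (simp add: is_partition_def)
    have "mono r" unfolding r_def by (intro monoI sorted_nth_mono[OF so]) (auto simp: len)
    moreover have "r 0 = 0" using ts(1) len by (auto simp: r_def is_partition_def hd_conv_nth[symmetric])
    moreover have rN: "r N = t" using ts(1) len by (auto simp: r_def is_partition_def last_conv_nth)
    moreover have "r (Suc k) - r k < \<delta>" if "k < N" for k
      using that ts(2) len by (auto simp: r_def mesh_less_def min_def)
    ultimately have main: "sq_integrable (X t)"
       "integrable P (trapezoid Y i r N)"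
       "(\<integral>\<omega>. \<bar>trapezoid Y i r N \<omega> - X t \<omega>\<bar> \<partial>P) \<le> C * sqrt \<delta>"
      using Xs[of r N \<delta>] t(2) \<delta> by auto
    let ?D = "\<lambda>\<omega>. trapezoid Y i r N \<omega> - X t \<omega>"
    have pts: "0 \<le> ts ! k" "ts ! k \<le> T" if "k < Suc N" for k
      using partition_points[OF ts(1), of k] that len t by auto
    have "AE \<omega> in P. \<forall>k\<in>{..<Suc N}. ?S (ts ! k) \<omega> = Y (ts ! k) \<omega>"
      using it pts by (intro AE_finite_allI) auto
    then have ae: "AE \<omega> in P. ?D \<omega> = stratonovich_sum ?S ?B ts \<omega> - X t \<omega>"
    proof eventually_elim
      case (elim \<omega>)
      show ?case
        unfolding stratonovich_sum_def len
        using elim by (auto intro!: sum.cong simp: r_def inc_def min_def)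
    qed
    have intD: "integrable P ?D"
      by (rule Bochner_Integration.integrable_diff[OF main(2) sq_integrable_imp_integrable[OF main(1)]])
    have meas: "stratonovich_sum ?S ?B ts \<in> borel_measurable P"
      unfolding stratonovich_sum_def[abs_def] len
      by (intro borel_measurable_sum borel_measurable_times borel_measurable_divide
        borel_measurable_add borel_measurable_diff borel_measurable_const component_measurable)
        (use it pts in auto)
    then have meas': "(\<lambda>\<omega>. stratonovich_sum ?S ?B ts \<omega> - X t \<omega>) \<in> borel_measurable P"
      using main(1) by (auto simp: sq_integrable_def)
    have "integrable P (\<lambda>\<omega>. stratonovich_sum ?S ?B ts \<omega> - X t \<omega>)"
      using integrable_cong_AE[OF _ meas' ae] intD by auto
    moreover have "(\<integral>\<omega>. \<bar>stratonovich_sum ?S ?B ts \<omega> - X t \<omega>\<bar> \<partial>P) = (\<integral>\<omega>. \<bar>?D \<omega>\<bar> \<partial>P)"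
      using ae intD meas' by (intro integral_cong_AE) auto
    ultimately show "integrable P (\<lambda>\<omega>. stratonovich_sum ?S ?B ts \<omega> - X t \<omega>) \<and>
        (\<integral>\<omega>. \<bar>stratonovich_sum ?S ?B ts \<omega> - X t \<omega>\<bar> \<partial>P) \<le> C * sqrt \<delta>"
      using main(3) by simp
  qed
  have itX: "stratonovich_iterated P B 0 (i # v) t \<in> borel_measurable P \<and>
      (AE \<omega> in P. stratonovich_iterated P B 0 (i # v) t \<omega> = X t \<omega>)" if t: "0 \<le> t" "t \<le> T" for t
  proof -
    \<comment> \<open>\<open>strat\<close> provides a witness, so the function picked by
      \<open>SOME\<close> has the defining property.\<close>
    have s: "is_stratonovich_integral P ?S ?B 0 t (stratonovich_integral P ?S ?B 0 t)"
      unfolding stratonovich_integral_def by (rule someI[where P = "is_stratonovich_integral P ?S ?B 0 t", OF strat[OF t]])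
    have "AE \<omega> in P. stratonovich_integral P ?S ?B 0 t \<omega> = X t \<omega>"
      by (rule stratonovich_integral_unique[OF t(1) s strat[OF t]])
        (use it t in \<open>auto intro: component_measurable\<close>)
    then show ?thesis using s by (simp add: is_stratonovich_integral_def)
  qed
  have mX: "expectation (X t) = sig_mean (i # v) t" if t: "0 \<le> t" "t \<le> T" for t
  proof -
    \<comment> \<open>The mean at \<open>i # k # u\<close> grows at half the mean at
      \<open>u\<close> when \<open>i = k\<close> and is constant otherwise, so two letters are
      consumed at once. For a one-letter word the rate is 0.\<close>
    define c where "c = (case v of [] \<Rightarrow> 0 | k # u \<Rightarrow> if i = k then pair_weight u / 2 else 0)"
    define n where "n = (length v - 1) div 2"
    have c0: "0 \<le> c" by (auto simp: c_def pair_weight_nonneg split: list.split)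
    have "(if i = j then expectation (Y1 s) / 2 else 0) = c * s ^ n / fact n" if s: "0 \<le> s" "s \<le> T" for s
      using m1[OF s] j by (cases v) (auto simp: c_def n_def sig_mean_def)
    then have "expectation (X t) = c * t ^ Suc n / fact (Suc n)"
      using Xm t
      by (intro integrate_power[where f = "\<lambda>t. \<integral>\<omega>. X t \<omega> \<partial>P" and T = T and C = C, OF X0 c0 X(1)]) auto
    also have "\<dots> = sig_mean (i # v) t"
    proof (cases v)
      case (Cons k u)
      have "Suc (Suc (length u)) div 2 = Suc (length u div 2)" by simp
      then show ?thesis using Cons by (simp add: c_def n_def sig_mean_def del: fact_Suc power_Suc)
    qed (simp add: c_def sig_mean_def)
    finally show ?thesis .
  qed
  show ?case
    unfolding word_process_def
    by (rule exI[of _ X], rule exI[of _ Y], rule exI[of _ i], rule exI[of _ C])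
      (use X Y Xg itX mX m in auto)
qed

lemma expected_signature_eq:
  assumes T: "0 < T"
  shows "expected_signature P B T w = sig_mean (rev w) T"
proof -
  obtain Y where Y: "nice T Y" "stratonovich_iterated P B 0 (rev w) T \<in> borel_measurable P"
    "AE \<omega> in P. stratonovich_iterated P B 0 (rev w) T \<omega> = Y T \<omega>" "expectation (Y T) = sig_mean (rev w) T"
    using stratonovich_iterated_process[OF T, of "rev w"] T
    unfolding word_process_def by (elim exE conjE) auto
  have "Y T \<in> borel_measurable P" using nice_sq[OF Y(1), of T] T by (simp add: sq_integrable_def)
  then show ?thesis
    unfolding expected_signature_def stratonovich_signature_def
    using Y by (subst integral_cong_AE[of _ P "Y T"]) auto
qed

end

section \<open>Piecewise linear interpolation\<close>

text \<open>Chen's identity on reversed words: the first \<open>m\<close> letters are integrated over the latest segment.\<close>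

primrec pl_sig :: "(nat \<Rightarrow> 'd \<Rightarrow> real) \<Rightarrow> nat \<Rightarrow> 'd list \<Rightarrow> real" where
  "pl_sig \<Delta> 0 v = (if v = [] then 1 else 0)"
| "pl_sig \<Delta> (Suc k) v =
     (\<Sum>m\<le>length v. prod_list (map (\<Delta> k) (take m v)) / fact m * pl_sig \<Delta> k (drop m v))"

text \<open>The iterated integral after \<open>k\<close> full segments and the fraction
  \<open>\<theta>\<close> of the next, on which the path is straight.\<close>

definition pl_poly :: "(nat \<Rightarrow> 'd \<Rightarrow> real) \<Rightarrow> nat \<Rightarrow> 'd list \<Rightarrow> real \<Rightarrow> real" where
  "pl_poly \<Delta> k v \<theta> =
     (\<Sum>m\<le>length v. \<theta> ^ m / fact m * (prod_list (map (\<Delta> k) (take m v)) * pl_sig \<Delta> k (drop m v)))"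

lemma pl_sig_Nil [simp]: "pl_sig \<Delta> k [] = 1"
  by (induction k) auto

lemma pl_poly_Nil [simp]: "pl_poly \<Delta> k [] \<theta> = 1"
  by (simp add: pl_poly_def)

lemma pl_poly_0: "pl_poly \<Delta> k v 0 = pl_sig \<Delta> k v"
  by (simp add: pl_poly_def power_0_left sum.atMost_shift)

lemma pl_poly_1: "pl_poly \<Delta> k v 1 = pl_sig \<Delta> (Suc k) v"
  by (simp add: pl_poly_def mult.assoc)

lemma pl_poly_Cons:
  "pl_poly \<Delta> k (i # v) \<theta> = pl_sig \<Delta> k (i # v) +
     (\<Sum>m\<le>length v. \<theta> ^ Suc m / fact (Suc m) *
        (\<Delta> k i * prod_list (map (\<Delta> k) (take m v)) * pl_sig \<Delta> k (drop m v)))"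
  unfolding pl_poly_def length_Cons sum.atMost_Suc_shift by (simp del: fact_Suc power_Suc)

text \<open>Differentiation strips the outermost letter, matching the recursion of
  \<open>path_iterated\<close>; the affine argument is the change of time on a segment.\<close>

lemma has_real_derivative_pl_poly:
  "((\<lambda>x. pl_poly \<Delta> k (i # v) (a * x - b)) has_real_derivative pl_poly \<Delta> k v (a * x - b) * (a * \<Delta> k i)) (at x within A)"
proof -
  have "((\<lambda>x. (a * x - b) ^ Suc m / fact (Suc m) * c) has_real_derivative (a * x - b) ^ m / fact m * c * a) (at x within A)" for m c
  proof -
    have eq: "(real (Suc m) * ((a * x - b) ^ m * a)) / fact (Suc m) * c = (a * x - b) ^ m / fact m * c * a"
      by (simp del: of_nat_Suc)
    show ?thesis
      by (rule derivative_eq_intros refl | simp del: fact_Suc of_nat_Suc power_Suc)+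
        (use eq in \<open>simp add: ac_simps del: fact_Suc of_nat_Suc power_Suc\<close>)
  qed
  then have "((\<lambda>x. pl_poly \<Delta> k (i # v) (a * x - b)) has_real_derivative
      0 + (\<Sum>m\<le>length v. (a * x - b) ^ m / fact m *
        (\<Delta> k i * prod_list (map (\<Delta> k) (take m v)) * pl_sig \<Delta> k (drop m v)) * a)) (at x within A)"
    unfolding pl_poly_Cons by (intro DERIV_add DERIV_const DERIV_sum)
  moreover have "0 + (\<Sum>m\<le>length v. (a * x - b) ^ m / fact m *
        (\<Delta> k i * prod_list (map (\<Delta> k) (take m v)) * pl_sig \<Delta> k (drop m v)) * a) =
      pl_poly \<Delta> k v (a * x - b) * (a * \<Delta> k i)"
    by (simp add: pl_poly_def sum_distrib_left sum_distrib_right ac_simps)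
  ultimately show ?thesis by (simp only:)
qed

definition grid_inc :: "real \<Rightarrow> nat \<Rightarrow> (real \<Rightarrow> real ^ 'd) \<Rightarrow> nat \<Rightarrow> 'd \<Rightarrow> real" where
  "grid_inc T M \<gamma> k l = \<gamma> ((real k + 1) * T / real M) $ l - \<gamma> (real k * T / real M) $ l"

lemma pl_interpolation_segment:
  assumes T: "0 < T" and M: "0 < M" and x: "real k * T / real M < x" "x < (real k + 1) * T / real M"
  shows "pl_interpolation T M \<gamma> x $ l =
    \<gamma> (real k * T / real M) $ l + (real M / T * x - real k) * grid_inc T M \<gamma> k l"
proof -
  have "real k < x * real M / T" "x * real M / T < real k + 1"
  proof -
    have "real k * T < x * real M" "x * real M < (real k + 1) * T"
      using x M by (simp_all add: pos_divide_less_eq pos_less_divide_eq)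
    then show "real k < x * real M / T" "x * real M / T < real k + 1"
      using T by (simp_all add: pos_divide_less_eq pos_less_divide_eq)
  qed
  then have "\<lfloor>x * real M / T\<rfloor> = int k" by (intro floor_unique) auto
  then show ?thesis by (simp add: pl_interpolation_def Let_def grid_inc_def mult.commute)
qed

lemma deriv_pl_interpolation:
  assumes T: "0 < T" and M: "0 < M" and x: "real k * T / real M < x" "x < (real k + 1) * T / real M"
  shows "deriv (\<lambda>r. pl_interpolation T M \<gamma> r $ l) x = real M / T * grid_inc T M \<gamma> k l"
proof (rule DERIV_imp_deriv)
  let ?f = "\<lambda>x. \<gamma> (real k * T / real M) $ l + (real M / T * x - real k) * grid_inc T M \<gamma> k l"
  have "(?f has_real_derivative real M / T * grid_inc T M \<gamma> k l) (at x)"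
    using T by (auto intro!: derivative_eq_intros)
  then show "((\<lambda>r. pl_interpolation T M \<gamma> r $ l) has_real_derivative real M / T * grid_inc T M \<gamma> k l) (at x)"
    by (rule has_field_derivative_transform_within_open[where S = "{real k * T / real M<..<(real k + 1) * T / real M}"])
      (use pl_interpolation_segment[OF T M, of k _ \<gamma> l] x in auto)
qed

text \<open>Letter by letter, with the fundamental theorem of calculus on each segment. The pieces
  fit since the polynomial of segment \<open>k\<close> at 1 equals that of segment
  \<open>Suc k\<close> at 0.\<close>

lemma path_iterated_pl:
  assumes T: "0 < T" and M: "0 < M"
    and u: "real k * T / real M \<le> u" "u \<le> (real k + 1) * T / real M"
  shows "path_iterated (pl_interpolation T M \<gamma>) 0 v u =
    pl_poly (grid_inc T M \<gamma>) k v (real M / T * u - real k)"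
  using u
proof (induction v arbitrary: k u)
  case (Cons i v)
  let ?\<Delta> = "grid_inc T M \<gamma>"
  let ?q = "\<lambda>k. real k * T / real M"
  let ?f = "\<lambda>u. path_iterated (pl_interpolation T M \<gamma>) 0 v u * deriv (\<lambda>r. pl_interpolation T M \<gamma> r $ i) u"
  let ?g = "\<lambda>k u. pl_poly ?\<Delta> k (i # v) (real M / T * u - real k)"
  have Suc_q: "?q (Suc k) = (real k + 1) * T / real M" for k by (simp add: field_simps)
  have q0: "real M / T * ?q k - real k = 0" for k using T M by simp
  have q1: "real M / T * ?q (Suc k) - real k = 1" for k using T M by simp
  have seg: "(?f has_integral ?g k u - ?g k (?q k)) {?q k..u}"
    if u: "?q k \<le> u" "u \<le> ?q (Suc k)" for k u
  proof -
    have "((\<lambda>x. pl_poly ?\<Delta> k v (real M / T * x - real k) * (real M / T * ?\<Delta> k i)) has_integral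
        ?g k u - ?g k (?q k)) {?q k..u}"
      by (rule fundamental_theorem_of_calculus[OF u(1)],
          unfold has_real_derivative_iff_has_vector_derivative[symmetric], rule has_real_derivative_pl_poly)
    \<comment> \<open>Kinks can sit only at grid points, where \<open>deriv\<close> may have no
      meaning; the two end points are dropped as a null set.\<close>
    then show ?thesis
    proof (rule has_integral_spike_finite[where S = "{?q k, u}", rotated 2])
      fix x assume "x \<in> {?q k..u} - {?q k, u}"
      then have x: "?q k < x" "x < (real k + 1) * T / real M" using u unfolding Suc_q by auto
      show "?f x = pl_poly ?\<Delta> k v (real M / T * x - real k) * (real M / T * ?\<Delta> k i)"
        using Cons.IH[of k x] x by (simp add: deriv_pl_interpolation[OF T M x])
    qed simp
  qed
  \<comment> \<open>The induction starts at time 0, where \<open>pl_sig\<close> over no segments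
    vanishes because the word is nonempty.\<close>
  have grid: "(?f has_integral ?g k u) {0..u}" if "?q k \<le> u" "u \<le> ?q (Suc k)" for k u
    using that
  proof (induction k arbitrary: u)
    case 0
    then show ?case using seg[of 0 u] by (simp add: pl_poly_0)
  next
    case (Suc k)
    have "?q k \<le> ?q (Suc k)" "0 \<le> ?q (Suc k)" using T M by (auto intro!: divide_right_mono)
    then have "(?f has_integral ?g k (?q (Suc k))) {0..?q (Suc k)}"
      using Suc.IH[of "?q (Suc k)"] by simp
    then have "(?f has_integral ?g k (?q (Suc k)) + (?g (Suc k) u - ?g (Suc k) (?q (Suc k)))) {0..u}"
      using seg[of "Suc k" u] Suc.prems \<open>0 \<le> ?q (Suc k)\<close> by (intro has_integral_combine) auto
    moreover have "?g k (?q (Suc k)) = ?g (Suc k) (?q (Suc k))"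
      unfolding q0 q1 pl_poly_0 pl_poly_1 by (rule refl)
    ultimately show ?case by simp
  qed
  show ?case using grid[of k u, unfolded Suc_q] Cons.prems by (simp add: integral_unique)
qed simp

lemma path_signature_pl:
  assumes T: "0 < T" and M: "0 < M"
  shows "path_signature (pl_interpolation T M \<gamma>) 0 T w = pl_sig (grid_inc T M \<gamma>) M (rev w)"
proof -
  obtain k where k: "M = Suc k" using M by (cases M) auto
  have "path_iterated (pl_interpolation T M \<gamma>) 0 (rev w) T =
      pl_poly (grid_inc T M \<gamma>) k (rev w) (real M / T * T - real k)"
    by (rule path_iterated_pl[OF T M]) (use T k in \<open>auto simp: field_simps\<close>)
  also have "real M / T * T - real k = 1" using T k by simp
  finally show ?thesis by (simp add: path_signature_def pl_poly_1 k del: pl_sig.simps)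
qed

section \<open>Averaging over independent segments\<close>

definition block_coeff :: "'d::finite list \<Rightarrow> real" where
  "block_coeff x = word_moment x / fact (length x)"

text \<open>\<open>block_coeff\<close> is the mean signature of a straight line with standard
  Gaussian increment, and this is its \<open>k\<close>-th tensor power. The length
  \<open>T / M\<close> of a segment enters later by scaling.\<close>

primrec pl_coeff :: "nat \<Rightarrow> 'd::finite list \<Rightarrow> real" where
  "pl_coeff 0 v = (if v = [] then 1 else 0)"
| "pl_coeff (Suc k) v = (\<Sum>m\<le>length v. block_coeff (take m v) * pl_coeff k (drop m v))"

context brownian
begin

text \<open>In Chen's identity the product over the last block is independent of the signature up to
  the start of that segment, so means multiply. Measurability with respect to the past is part of
  the induction for this purpose.\<close>

lemma pl_sig_moment:
  assumes T: "0 < T" and M: "0 < M"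
  defines "S \<equiv> \<lambda>k v \<omega>. pl_sig (grid_inc T M (\<lambda>u. B u \<omega>)) k v"
  shows "S k v \<in> borel_measurable (past (real k * T / real M)) \<and> integrable P (S k v) \<and>
    (\<integral>\<omega>. S k v \<omega> \<partial>P) = (T / real M) ^ (length v div 2) * pl_coeff k v"
proof (induction k arbitrary: v)
  case 0
  then show ?case by (simp add: S_def prob_space)
next
  case (Suc k)
  let ?q = "\<lambda>k. real k * T / real M"
  have q: "0 \<le> ?q k" "?q k \<le> ?q (Suc k)" using T by (auto intro!: divide_right_mono)
  have qd: "?q (Suc k) - ?q k = T / real M" by (simp add: algebra_simps add_divide_distrib)
  have gi: "grid_inc T M (\<lambda>u. B u \<omega>) k l = inc (?q k) (?q (Suc k)) l \<omega>" for l \<omega>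
    by (simp add: grid_inc_def inc_def add.commute)
  let ?p = "\<lambda>m \<omega>. prod_list (map (\<lambda>l. inc (?q k) (?q (Suc k)) l \<omega>) (take m v))"
  have S: "S (Suc k) v = (\<lambda>\<omega>. \<Sum>m\<le>length v. (S k (drop m v) \<omega> * ?p m \<omega>) / fact m)"
    by (auto simp: S_def gi[abs_def] mult.commute fun_eq_iff)
  have g: "(\<lambda>x. prod_list (map x y)) \<in> borel_measurable (Pi\<^sub>M UNIV (\<lambda>_. borel :: real measure))" for y :: "'d list"
  proof (induction y)
    case (Cons l y)
    have "(\<lambda>x. x l :: real) \<in> borel_measurable (Pi\<^sub>M UNIV (\<lambda>_. borel))"
      by (rule measurable_component_singleton) simp
    then show ?case using Cons by simp
  qed simp
  have X: "(\<lambda>\<omega> j. inc (?q k) (?q (Suc k)) j \<omega>) \<in> measurable (past (?q (Suc k))) (Pi\<^sub>M UNIV (\<lambda>_. borel))"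
    using q by (intro measurable_PiM_single') (auto simp: space_PiM intro!: inc_past)
  have pm: "?p m \<in> borel_measurable (past (?q (Suc k)))" for m
    by (rule measurable_compose[OF X g])
  have Sm: "S k (drop m v) \<in> borel_measurable (past (?q (Suc k)))" for m
    using measurable_past_mono[OF conjunct1[OF Suc.IH] q(2)] .
  note mi = past_mult_inc[OF q conjunct1[OF Suc.IH] conjunct1[OF conjunct2[OF Suc.IH]] g inc_word_moment(1)[OF q]]
  have E: "(\<integral>\<omega>. S k (drop m v) \<omega> * ?p m \<omega> \<partial>P) / fact m =
      (T / real M) ^ (length v div 2) * (block_coeff (take m v) * pl_coeff k (drop m v))"
    if m: "m \<le> length v" for m
  proof (cases "even m")
    case True
    then obtain n where n: "m = 2 * n" by (elim evenE)
    \<comment> \<open>As \<open>m\<close> is even, the rounded halves add up exactly, whatever the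
      parity of \<open>length v\<close>.\<close>
    have "(length v - m) div 2 + m div 2 = length v div 2" using m n by auto
    then have "(T / real M) ^ (length v div 2) = (T / real M) ^ ((length v - m) div 2) * (T / real M) ^ (m div 2)"
      by (simp flip: power_add)
    then show ?thesis
      using m Suc.IH[of "drop m v"] unfolding mi(2) inc_word_moment(2)[OF q] qd
      by (simp add: block_coeff_def)
  next
    case False
    then have "word_moment (take m v) = 0" using m by (intro word_moment_odd) simp
    then show ?thesis unfolding mi(2) inc_word_moment(2)[OF q] by (simp add: block_coeff_def)
  qed
  have "(\<integral>\<omega>. S (Suc k) v \<omega> \<partial>P) = (\<Sum>m\<le>length v. (\<integral>\<omega>. S k (drop m v) \<omega> * ?p m \<omega> \<partial>P) / fact m)"
    unfolding S using mi(1) by (subst Bochner_Integration.integral_sum) auto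
  also have "\<dots> = (T / real M) ^ (length v div 2) * pl_coeff (Suc k) v"
    unfolding pl_coeff.simps sum_distrib_left by (intro sum.cong refl E) simp
  finally show ?case
    unfolding S using Sm pm mi(1) by (auto intro!: borel_measurable_sum borel_measurable_divide borel_measurable_times)
qed

lemma expected_signature_pl_eq:
  assumes "0 < T" "0 < M"
  shows "expected_signature_pl P B M T w = (T / real M) ^ (length w div 2) * pl_coeff M (rev w)"
  using pl_sig_moment[OF assms, of M "rev w"]
  by (simp add: expected_signature_pl_def path_signature_pl[OF assms])

end

section \<open>Asymptotics of the coefficients\<close>

lemma block_coeff_Nil [simp]: "block_coeff [] = 1"
  by (simp add: block_coeff_def word_moment_def gauss_moment_def)

lemma block_coeff_odd: "odd (length x) \<Longrightarrow> block_coeff x = 0"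
  by (simp add: block_coeff_def word_moment_odd)

lemma block_coeff_pair: "block_coeff [i, j] = (if i = j then 1 / 2 else 0)"
  by (simp add: block_coeff_def word_moment_pair)

text \<open>The values are 3/4! and 1/4!. A Brownian path gives 1/8 to both kinds of word, so
  \<open>[i, i, i, i]\<close> is reproduced exactly.\<close>

lemma block_coeff_quad_eq:
  "block_coeff [i, i, k, l] = (if k = l then if k = i then 1 / 8 else 1 / 24 else 0)"
proof (cases "k = l")
  case True
  then show ?thesis by (simp add: block_coeff_def word_moment_quad fact_numeral)
next
  case False
  have "word_moment [i, i, k, l] = 0"
    by (rule word_moment_zero[of _ "if k = i then l else k"]) (use False in auto)
  then show ?thesis using False by (simp add: block_coeff_def)
qed

text \<open>The crossed and the nested pairing, which have coefficient 0 for Brownian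
  motion.\<close>

lemma block_coeff_quad_neq:
  assumes "i \<noteq> j"
  shows "block_coeff [i, j, k, l] = (if (k = i \<and> l = j) \<or> (k = j \<and> l = i) then 1 / 24 else 0)"
proof (cases "(k = i \<and> l = j) \<or> (k = j \<and> l = i)")
  case True
  then have "word_moment [i, j, k, l] = 1"
    unfolding word_moment_def using assms by (intro prod.neutral) (auto simp: gauss_moment_def)
  then show ?thesis using True by (simp add: block_coeff_def fact_numeral)
next
  case False
  \<comment> \<open>If \<open>k\<close> and \<open>l\<close> are both \<open>i\<close> or both
    different from it, then \<open>i\<close> occurs three times or once; otherwise \<open>i\<close>
    occurs twice and \<open>j\<close> once.\<close>
  have "word_moment [i, j, k, l] = 0"
    by (rule word_moment_zero[of _ "if (k = i) = (l = i) then i else j"]) (use False assms in auto)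
  then show ?thesis using False by (simp add: block_coeff_def)
qed

text \<open>Sum over the ways to cut the word into \<open>j\<close> nonempty blocks. Blocks of odd length contribute 0,
  which leaves few cuts when \<open>j\<close> is close to half the length.\<close>

primrec split_coeff :: "nat \<Rightarrow> 'd::finite list \<Rightarrow> real" where
  "split_coeff 0 v = (if v = [] then 1 else 0)"
| "split_coeff (Suc j) v = (\<Sum>m\<in>{1..length v}. block_coeff (take m v) * split_coeff j (drop m v))"

text \<open>Binomial theorem for a power of 1 plus a part of positive degree: each of the
  \<open>k\<close> blocks is either empty, with coefficient 1, or one of the \<open>j\<close>
  nonempty ones. Pascal's rule carries the induction.\<close>

lemma pl_coeff_binomial: "pl_coeff k v = (\<Sum>j\<le>k. real (k choose j) * split_coeff j v)"
proof (induction k arbitrary: v)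
  case (Suc k)
  have "pl_coeff (Suc k) v = pl_coeff k v + (\<Sum>m\<in>{1..length v}. block_coeff (take m v) * pl_coeff k (drop m v))"
    by (simp add: sum.atMost_shift sum.shift_bounds_Suc_ivl atLeast0AtMost[symmetric] sum.atLeast_Suc_atMost)
  also have "(\<Sum>m\<in>{1..length v}. block_coeff (take m v) * pl_coeff k (drop m v)) =
      (\<Sum>j\<le>k. real (k choose j) * split_coeff (Suc j) v)"
    unfolding Suc.IH split_coeff.simps sum_distrib_left
    by (subst sum.swap) (simp add: ac_simps)
  also have "pl_coeff k v + \<dots> = (\<Sum>j\<le>Suc k. real (Suc k choose j) * split_coeff j v)"
  proof -
    have "(\<Sum>j\<le>Suc k. real (Suc k choose j) * split_coeff j v) =
        split_coeff 0 v + (\<Sum>j\<le>k. real (Suc k choose Suc j) * split_coeff (Suc j) v)"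
      unfolding sum.atMost_Suc_shift by simp
    also have "(\<Sum>j\<le>k. real (Suc k choose Suc j) * split_coeff (Suc j) v) =
        (\<Sum>j\<le>k. real (k choose j) * split_coeff (Suc j) v) +
        (\<Sum>j\<le>k. real (k choose Suc j) * split_coeff (Suc j) v)"
      by (simp add: distrib_right sum.distrib del: split_coeff.simps)
    also have "split_coeff 0 v + (\<dots>) = (\<Sum>j\<le>k. real (k choose j) * split_coeff (Suc j) v) +
        (\<Sum>j\<le>Suc k. real (k choose j) * split_coeff j v)"
      unfolding sum.atMost_Suc_shift[of _ k] by (simp del: split_coeff.simps)
    also have "(\<Sum>j\<le>Suc k. real (k choose j) * split_coeff j v) = pl_coeff k v"
      unfolding Suc.IH by simp
    finally show ?thesis by (simp only: add.commute)
  qed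
  finally show ?case .
qed simp

lemma split_coeff_eq_0:
  "length v < 2 * j \<Longrightarrow> split_coeff j v = 0"
proof (induction j arbitrary: v)
  case (Suc j)
  have "block_coeff (take m v) * split_coeff j (drop m v) = 0" if m: "m \<in> {1..length v}" for m
  proof (cases "odd m")
    case True
    then show ?thesis using m by (simp add: block_coeff_odd)
  next
    case False
    then have "2 \<le> m" using m by (cases m) (auto elim!: oddE)
    then have "length (drop m v) < 2 * j" using Suc.prems m by auto
    then show ?thesis by (simp add: Suc.IH)
  qed
  then show ?case unfolding split_coeff.simps by (intro sum.neutral ballI)
qed simp

lemma split_coeff_odd:
  "odd (length v) \<Longrightarrow> split_coeff j v = 0"
proof (induction j arbitrary: v)
  case (Suc j)
  have "block_coeff (take m v) * split_coeff j (drop m v) = 0" if m: "m \<in> {1..length v}" for m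
  proof (cases "odd m")
    case True
    then show ?thesis using m by (simp add: block_coeff_odd)
  next
    case False
    then show ?thesis using Suc.prems m by (simp add: Suc.IH)
  qed
  then show ?case unfolding split_coeff.simps by (intro sum.neutral ballI)
qed auto

lemma pl_coeff_odd: "odd (length v) \<Longrightarrow> pl_coeff k v = 0"
  by (simp add: pl_coeff_binomial split_coeff_odd)

text \<open>Fixes the number of summands independently of \<open>k\<close>, so that limits in
  \<open>k\<close> may be taken term by term.\<close>

lemma pl_coeff_bounded:
  assumes "length v \<le> 2 * n"
  shows "pl_coeff k v = (\<Sum>j\<le>n. real (k choose j) * split_coeff j v)"
proof -
  have "pl_coeff k v = (\<Sum>j\<le>k + n. real (k choose j) * split_coeff j v)"
    unfolding pl_coeff_binomial by (intro sum.mono_neutral_left) (auto simp: binomial_eq_0)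
  also have "\<dots> = (\<Sum>j\<le>n. real (k choose j) * split_coeff j v)"
    using assms by (intro sum.mono_neutral_right) (auto simp: split_coeff_eq_0)
  finally show ?thesis .
qed

text \<open>A first block of six or more letters leaves fewer than \<open>2 * n\<close> letters for
  \<open>n\<close> blocks, each of which needs at least two.\<close>

lemma split_coeff_Suc_short:
  assumes "length v \<le> 2 * n + 4"
  shows "split_coeff (Suc n) v =
    (\<Sum>m\<in>{1..length v} \<inter> {2, 4}. block_coeff (take m v) * split_coeff n (drop m v))"
  unfolding split_coeff.simps
proof (rule sum.mono_neutral_right, simp, simp, rule ballI)
  fix m assume m: "m \<in> {1..length v} - ({1..length v} \<inter> {2, 4})"
  show "block_coeff (take m v) * split_coeff n (drop m v) = 0"
  proof (cases "odd m")
    case True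
    moreover have "length (take m v) = m" using m by auto
    ultimately have "odd (length (take m v))" by simp
    from block_coeff_odd[OF this] show ?thesis by (simp only: mult_zero_left)
  next
    case False
    then have "6 \<le> m" using m by (auto elim!: evenE)
    then have "length (drop m v) < 2 * n" using m assms by simp
    from split_coeff_eq_0[OF this] show ?thesis by (simp only: mult_zero_right)
  qed
qed

lemma split_coeff_Suc_pair:
  assumes "length v = 2 * n"
  shows "split_coeff (Suc n) (i # j # v) = block_coeff [i, j] * split_coeff n v"
proof -
  let ?v = "i # j # v"
  have "split_coeff (Suc n) ?v =
      (\<Sum>m\<in>{1..length ?v} \<inter> {2, 4}. block_coeff (take m ?v) * split_coeff n (drop m ?v))"
    using assms by (intro split_coeff_Suc_short) simp
  also have "\<dots> = (\<Sum>m\<in>{2}. block_coeff (take m ?v) * split_coeff n (drop m ?v))"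
    using assms by (intro sum.mono_neutral_right) (auto simp: split_coeff_eq_0)
  finally show ?thesis by (simp add: numeral_2_eq_2)
qed

lemma split_coeff_top:
  "length v = 2 * n \<Longrightarrow> split_coeff n v = pair_weight v"
proof (induction n arbitrary: v)
  case (Suc n)
  then obtain i j w where v: "v = i # j # w" by (auto simp: length_Suc_conv)
  then show ?case using Suc split_coeff_Suc_pair[of w n i j] by (simp add: block_coeff_pair del: split_coeff.simps)
qed simp

lemma split_coeff_Suc_quad:
  assumes "length v = 2 * n"
  shows "split_coeff (Suc n) (i # j # k # l # v) =
    block_coeff [i, j] * split_coeff n (k # l # v) + block_coeff [i, j, k, l] * split_coeff n v"
proof -
  let ?v = "i # j # k # l # v"
  have "{1..length ?v} \<inter> {2, 4} = {2, 4}" by auto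
  then have "split_coeff (Suc n) ?v = (\<Sum>m\<in>{2, 4}. block_coeff (take m ?v) * split_coeff n (drop m ?v))"
    using split_coeff_Suc_short[of ?v n] assms by simp
  then show ?thesis by (simp add: eval_nat_numeral)
qed

text \<open>Up to a factor, the coefficient of \<open>1 / M\<close> in the difference of the expected signatures, on words
  of length \<open>2 * m + 2\<close>.\<close>

definition lead_err :: "nat \<Rightarrow> 'd::finite list \<Rightarrow> real" where
  "lead_err m w = real m / 2 * pair_weight w - split_coeff m w"

text \<open>Unequal first letters kill \<open>pair_weight\<close> and every cut beginning with a
  block of two.\<close>

lemma lead_err_Suc_neq:
  assumes "length u = 2 * m" "i \<noteq> j"
  shows "lead_err (Suc m) (i # j # k # l # u) = - block_coeff [i, j, k, l] * pair_weight u"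
  using assms split_coeff_Suc_quad[OF assms(1), of i j k l] split_coeff_top[OF assms(1)]
  by (simp add: lead_err_def block_coeff_pair del: split_coeff.simps)

text \<open>The step from \<open>m\<close> to \<open>Suc m\<close> adds half of the pair weight of
  the whole word, that is 1/8 of \<open>pair_weight u\<close> if \<open>k = l\<close>. The block of
  four takes away 1/8 for \<open>k = i\<close> and 1/24 otherwise, which leaves 0 or 1/12.\<close>

lemma lead_err_Suc_eq:
  assumes "length u = 2 * m"
  shows "lead_err (Suc m) (i # i # k # l # u) =
    lead_err m (k # l # u) / 2 + (if k = l \<and> k \<noteq> i then 1 / 12 else 0) * pair_weight u"
  unfolding lead_err_def split_coeff_Suc_quad[OF assms] split_coeff_top[OF assms] block_coeff_pair
    block_coeff_quad_eq
  by (simp add: field_simps)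

lemma length_Suc_Suc_obtain:
  assumes "length w = 2 * Suc m + 2"
  obtains i j k l u where "w = i # j # k # l # u" "length u = 2 * m"
  using assms by (auto simp: length_Suc_conv)

text \<open>The positive terms in the recursion of \<open>lead_err\<close> live on words of pairs, where by this lemma
  nothing is negative. So no cancellation occurs and absolute values add up.\<close>

lemma lead_err_nonneg:
  "length w = 2 * m + 2 \<Longrightarrow> 0 < pair_weight w \<Longrightarrow> 0 \<le> lead_err m w"
proof (induction m arbitrary: w)
  case 0
  then show ?case by (auto simp: lead_err_def)
next
  case (Suc m)
  obtain i j k l u where w: "w = i # j # k # l # u" "length u = 2 * m"
    using Suc.prems(1) by (rule length_Suc_Suc_obtain)
  have ij: "i = j" and "0 < pair_weight (k # l # u)" using Suc.prems(2) w by (auto split: if_splits)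
  then have "0 \<le> lead_err m (k # l # u)" using Suc.IH[of "k # l # u"] w by simp
  then show ?case using w(1) ij pair_weight_nonneg[of u] by (simp add: lead_err_Suc_eq[OF w(2)])
qed

lemma abs_lead_err_Suc_eq:
  assumes "length u = 2 * m"
  shows "\<bar>lead_err (Suc m) (i # i # k # l # u)\<bar> =
    \<bar>lead_err m (k # l # u)\<bar> / 2 + (if k = l \<and> k \<noteq> i then 1 / 12 else 0) * pair_weight u"
proof (cases "k = l \<and> 0 < pair_weight u")
  case True
  then have "0 \<le> lead_err m (k # l # u)" using assms by (intro lead_err_nonneg) auto
  then show ?thesis using pair_weight_nonneg[of u] by (simp add: lead_err_Suc_eq[OF assms])
next
  case False
  then have "(if k = l \<and> k \<noteq> i then 1 / 12 else 0) * pair_weight u = 0"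
    using pair_weight_nonneg[of u] by (auto simp: less_le)
  then show ?thesis by (simp only: lead_err_Suc_eq[OF assms])
qed

section \<open>Sums over all words of fixed length\<close>

lemma finite_words: "finite {w :: 'd::finite list. length w = n}"
  using finite_lists_length_eq[of "UNIV :: 'd set" n] by simp

lemma sum_words_Suc:
  "(\<Sum>w | length w = Suc n. f w) = (\<Sum>i\<in>UNIV. \<Sum>w | length w = n. f (i # w :: 'd::finite list))"
proof -
  have "(\<Sum>i\<in>UNIV. \<Sum>w | length w = n. f (i # w)) = (\<Sum>p\<in>UNIV \<times> {w. length w = n}. f (fst p # snd p))"
    by (simp add: sum.cartesian_product case_prod_unfold)
  also have "\<dots> = (\<Sum>w | length w = Suc n. f w)"
    by (rule sum.reindex_bij_witness[of _ "\<lambda>w. (hd w, tl w)" "\<lambda>p. fst p # snd p"])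
      (auto simp: length_Suc_conv)
  finally show ?thesis by simp
qed

lemma sum_pair_weight:
  "(\<Sum>w | length w = 2 * m. pair_weight (w :: 'd::finite list)) = (real CARD('d) / 2) ^ m"
proof (induction m)
  case (Suc m)
  have "(\<Sum>w | length w = 2 * Suc m. pair_weight (w :: 'd list)) =
      (\<Sum>i\<in>UNIV. \<Sum>j\<in>UNIV. \<Sum>w | length w = 2 * m. pair_weight (i # j # w :: 'd list))"
    by (simp add: sum_words_Suc)
  also have "\<dots> = (\<Sum>i\<in>UNIV. \<Sum>j\<in>UNIV. if i = (j :: 'd) then (\<Sum>w | length w = 2 * m. pair_weight (w :: 'd list)) / 2 else 0)"
    by (intro sum.cong refl) (auto simp: sum_divide_distrib)
  also have "\<dots> = real CARD('d) / 2 * (\<Sum>w | length w = 2 * m. pair_weight (w :: 'd list))"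
    by simp
  finally show ?case using Suc.IH by simp
qed simp

text \<open>Each step multiplies the sum by d/2 and adds d(d-1)/12 times \<open>(d / 2) ^ m\<close>
  twice: once from words beginning with two equal pairs of distinct letters, once from those
  beginning with a crossed or nested pairing. Together this is
  \<open>(d - 1) / 3 * (d / 2) ^ Suc m\<close>.\<close>

lemma sum_lead_err:
  "(\<Sum>w | length w = 2 * m + 2. \<bar>lead_err m (w :: 'd::finite list)\<bar>) =
     real m * (real CARD('d) - 1) / 3 * (real CARD('d) / 2) ^ m"
proof (induction m)
  case 0
  have "\<bar>lead_err 0 (w :: 'd list)\<bar> = 0" if "length w = 2" for w
    using that by (auto simp: lead_err_def)
  then show ?case by simp
next
  case (Suc m)
  let ?d = "real CARD('d)"
  let ?X = "\<Sum>w | length w = 2 * m + 2. \<bar>lead_err m (w :: 'd list)\<bar>"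
  let ?Y = "(?d / 2) ^ m"
  have X: "?X = (\<Sum>k\<in>UNIV. \<Sum>l\<in>UNIV. \<Sum>u | length u = 2 * m. \<bar>lead_err m (k # l # u :: 'd list)\<bar>)"
    by (simp add: sum_words_Suc)
  have inner: "(\<Sum>k\<in>UNIV. \<Sum>l\<in>UNIV. \<Sum>u | length u = 2 * m. \<bar>lead_err (Suc m) (i # j # k # l # u :: 'd list)\<bar>) =
      (if i = j then ?X / 2 + (?d - 1) / 12 * ?Y else ?Y / 12)" for i j :: 'd
  proof (cases "i = j")
    case True
    have "(\<Sum>k\<in>UNIV. \<Sum>l\<in>UNIV. \<Sum>u | length u = 2 * m. \<bar>lead_err (Suc m) (i # j # k # l # u :: 'd list)\<bar>) =
      (\<Sum>k\<in>UNIV. \<Sum>l\<in>UNIV. \<Sum>u | length u = 2 * m. \<bar>lead_err m (k # l # u)\<bar> / 2 +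
         (if k = l \<and> k \<noteq> i then 1 / 12 else 0) * pair_weight u)"
      unfolding True by (intro sum.cong refl abs_lead_err_Suc_eq) simp
    also have "\<dots> = ?X / 2 + (\<Sum>k\<in>UNIV. \<Sum>l\<in>UNIV. (if k = l \<and> k \<noteq> i then 1 / 12 else 0) * ?Y)"
      unfolding X by (simp add: sum.distrib sum_divide_distrib sum_pair_weight flip: sum_distrib_left)
    also have "(\<Sum>k\<in>UNIV. \<Sum>l\<in>UNIV. (if k = l \<and> k \<noteq> i then 1 / 12 else 0) * ?Y) = (\<Sum>k\<in>UNIV - {i}. ?Y / 12)"
    proof -
      have "(\<Sum>l\<in>UNIV. (if k = l \<and> k \<noteq> i then 1 / 12 else 0) * ?Y) = (if k = i then 0 else ?Y / 12)" for k
      proof (cases "k = i")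
        case False
        then have "(\<Sum>l\<in>UNIV. (if k = l \<and> k \<noteq> i then 1 / 12 else 0) * ?Y) = (\<Sum>l\<in>UNIV. if k = l then ?Y / 12 else 0)"
          by (intro sum.cong) auto
        then show ?thesis using False by simp
      qed simp
      then show ?thesis by (simp add: sum.If_cases Compl_eq_Diff_UNIV)
    qed
    also have "\<dots> = (?d - 1) / 12 * ?Y" by (simp add: of_nat_diff card_Diff_singleton)
    finally show ?thesis using True by simp
  next
    case False
    have "(\<Sum>k\<in>UNIV. \<Sum>l\<in>UNIV. \<Sum>u | length u = 2 * m. \<bar>lead_err (Suc m) (i # j # k # l # u :: 'd list)\<bar>) =
      (\<Sum>k\<in>UNIV. \<Sum>l\<in>UNIV. \<Sum>u | length u = 2 * m. block_coeff [i, j, k, l] * pair_weight (u :: 'd list))"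
    proof (intro sum.cong refl)
      fix k l :: 'd and u assume "u \<in> {u :: 'd list. length u = 2 * m}"
      then show "\<bar>lead_err (Suc m) (i # j # k # l # u)\<bar> = block_coeff [i, j, k, l] * pair_weight u"
        using pair_weight_nonneg[of u]
        by (simp add: lead_err_Suc_neq[OF _ False] block_coeff_quad_neq[OF False] abs_mult)
    qed
    also have "\<dots> = (\<Sum>k\<in>UNIV. \<Sum>l\<in>UNIV. block_coeff [i, j, k, l] * ?Y)"
      by (simp add: sum_pair_weight flip: sum_distrib_left)
    also have "\<dots> = (\<Sum>k\<in>UNIV. \<Sum>l\<in>UNIV. (if k = i then if l = j then ?Y / 24 else 0 else 0) +
        (if k = j then if l = i then ?Y / 24 else 0 else 0))"
      using False by (intro sum.cong refl) (auto simp: block_coeff_quad_neq[OF False])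
    also have "\<dots> = ?Y / 24 + ?Y / 24"
    proof -
      have "(\<Sum>k\<in>UNIV. \<Sum>l\<in>UNIV. if k = a then if l = b then ?Y / 24 else 0 else 0) = ?Y / 24" for a b :: 'd
      proof -
        have "(\<Sum>l\<in>UNIV. if k = a then if l = b then ?Y / 24 else 0 else 0) = (if k = a then ?Y / 24 else 0)" for k
          by (cases "k = a") auto
        then show ?thesis by simp
      qed
      then show ?thesis by (simp only: sum.distrib)
    qed
    finally show ?thesis using False by simp
  qed
  have "(\<Sum>w | length w = 2 * Suc m + 2. \<bar>lead_err (Suc m) (w :: 'd list)\<bar>) =
      (\<Sum>i\<in>UNIV. \<Sum>j\<in>UNIV. \<Sum>k\<in>UNIV. \<Sum>l\<in>UNIV. \<Sum>u | length u = 2 * m. \<bar>lead_err (Suc m) (i # j # k # l # u :: 'd list)\<bar>)"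
    by (simp add: sum_words_Suc)
  also have "\<dots> = (\<Sum>i\<in>UNIV. \<Sum>j\<in>UNIV. if i = (j::'d) then ?X / 2 + (?d - 1) / 12 * ?Y else ?Y / 12)"
    by (simp only: inner)
  \<comment> \<open>The off-diagonal value is subtracted on the diagonal, so the double sum becomes
    a single sum plus a constant.\<close>
  also have "\<dots> = (\<Sum>i\<in>UNIV. \<Sum>j\<in>UNIV. (if i = (j::'d) then ?X / 2 + (?d - 1) / 12 * ?Y - ?Y / 12 else 0) + ?Y / 12)"
    by (intro sum.cong refl) auto
  also have "\<dots> = ?d * (?X / 2 + (?d - 1) / 12 * ?Y - ?Y / 12 + ?d * (?Y / 12))"
    by (simp add: sum.distrib distrib_left)
  also have "\<dots> = real (Suc m) * (?d - 1) / 3 * (?d / 2) ^ Suc m"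
    unfolding Suc.IH by (simp add: field_simps)
  finally show ?case .
qed

section \<open>First-order expansion in 1/M\<close>

lemma binomial_eq_prod:
  assumes "0 < M"
  shows "real (M choose j) = real M ^ j * (\<Prod>i<j. 1 - real i / real M) / fact j"
proof -
  have "real (M choose j) = (\<Prod>i<j. real M - real i) / fact j"
    by (simp add: binomial_gbinomial gbinomial_prod_rev atLeast0LessThan)
  also have "(\<Prod>i<j. real M - real i) = (\<Prod>i<j. real M * (1 - real i / real M))"
    using assms by (intro prod.cong) (auto simp: field_simps)
  also have "\<dots> = real M ^ j * (\<Prod>i<j. 1 - real i / real M)"
    by (simp add: prod.distrib)
  finally show ?thesis .
qed

lemma tendsto_falling_prod: "(\<lambda>M. \<Prod>i<j. 1 - real i / real M) \<longlonglongrightarrow> 1"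
proof -
  have "(\<lambda>M. \<Prod>i<j. 1 - real i * (1 / real M)) \<longlonglongrightarrow> (\<Prod>i<j. 1 - real i * 0)"
    by (intro tendsto_intros lim_1_over_n)
  then show ?thesis by simp
qed

text \<open>The coefficient of 1/M in the product is minus the sum 0 + 1 + ... + (j - 1).\<close>

lemma tendsto_falling_prod_second_order:
  "(\<lambda>M. real M * (1 - (\<Prod>i<j. 1 - real i / real M))) \<longlonglongrightarrow> real j * (real j - 1) / 2"
proof (induction j)
  case (Suc j)
  let ?p = "\<lambda>M. \<Prod>i<j. 1 - real i / real M"
  have "(\<lambda>M. real M * (1 - ?p M) + ?p M * real j) \<longlonglongrightarrow> real j * (real j - 1) / 2 + 1 * real j"
    by (intro tendsto_add tendsto_mult Suc tendsto_falling_prod tendsto_const)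
  moreover have "\<forall>\<^sub>F M in sequentially. real M * (1 - ?p M) + ?p M * real j =
      real M * (1 - (\<Prod>i<Suc j. 1 - real i / real M))"
    using eventually_gt_at_top[of 0] by eventually_elim (simp add: field_simps)
  ultimately have "(\<lambda>M. real M * (1 - (\<Prod>i<Suc j. 1 - real i / real M))) \<longlonglongrightarrow>
      real j * (real j - 1) / 2 + 1 * real j"
    by (rule Lim_transform_eventually)
  then show ?case by (simp add: field_simps)
qed simp

text \<open>After multiplication by \<open>M\<close>, the term \<open>j = Suc m\<close> leaves only
  its second order, the first cancelling the Brownian coefficient; \<open>j = m\<close> contributes
  its leading order, and smaller \<open>j\<close> keep a positive power of 1/M.\<close>

lemma coefficient_limit:
  fixes v :: "'d::finite list"
  assumes v: "length v = 2 * Suc m" and T: "0 < T"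
  shows "(\<lambda>M. real M / T * (sig_mean v T - (T / real M) ^ Suc m * pl_coeff M v))
    \<longlonglongrightarrow> T ^ m / fact m * lead_err m v"
proof -
  let ?p = "\<lambda>j M. \<Prod>i<j. 1 - real i / real M"
  \<comment> \<open>The same expression with the powers of \<open>M\<close> cancelled, valid for
    \<open>0 < M\<close>; each factor now has a limit.\<close>
  let ?R = "\<lambda>M. T ^ m * (real M * (1 - ?p (Suc m) M) / fact (Suc m) * pair_weight v
      - (?p m M / fact m * split_coeff m v + (\<Sum>j<m. ?p j M / fact j * (1 / real M) ^ (m - j) * split_coeff j v)))"
  have "?R \<longlonglongrightarrow> T ^ m * (real (Suc m) * (real (Suc m) - 1) / 2 / fact (Suc m) * pair_weight v
      - (1 / fact m * split_coeff m v + (\<Sum>j<m. 1 / fact j * 0 ^ (m - j) * split_coeff j v)))"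
    by (intro tendsto_intros tendsto_falling_prod_second_order tendsto_falling_prod lim_1_over_n) auto
  also have "(\<Sum>j<m. 1 / fact j * 0 ^ (m - j) * split_coeff j v) = 0"
    by (intro sum.neutral) (auto simp: power_0_left)
  also have "T ^ m * (real (Suc m) * (real (Suc m) - 1) / 2 / fact (Suc m) * pair_weight v
      - (1 / fact m * split_coeff m v + 0)) = T ^ m / fact m * lead_err m v"
  proof -
    have "real (Suc m) * (real (Suc m) - 1) / 2 / fact (Suc m) = real m / 2 / fact m"
      by (simp del: of_nat_Suc)
    then show ?thesis by (simp only: lead_err_def) (simp add: field_simps)
  qed
  finally have lim: "?R \<longlonglongrightarrow> T ^ m / fact m * lead_err m v" .
  show ?thesis
  proof (rule Lim_transform_eventually[OF lim])
    show "\<forall>\<^sub>F M in sequentially. ?R M = real M / T * (sig_mean v T - (T / real M) ^ Suc m * pl_coeff M v)"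
      using eventually_gt_at_top[of 0]
    proof eventually_elim
      case (elim M)
      have M: "0 < real M" using elim by simp
      have term_j: "real (M choose j) / real M ^ Suc m * real M = ?p j M / fact j * (1 / real M) ^ (m - j)"
        if "j \<le> m" for j
      proof -
        have "real M ^ Suc m = real M ^ j * real M ^ (m - j) * real M"
          using that by (simp flip: power_add)
        then show ?thesis using M unfolding binomial_eq_prod[OF elim] by (simp add: power_one_over field_simps)
      qed
      have top: "real (M choose Suc m) / real M ^ Suc m = ?p (Suc m) M / fact (Suc m)"
        using M unfolding binomial_eq_prod[OF elim] by (simp del: fact_Suc power_Suc prod.lessThan_Suc)
      have "pl_coeff M v = (\<Sum>j\<le>Suc m. real (M choose j) * split_coeff j v)"
        using v by (intro pl_coeff_bounded) simp
      also have "\<dots> = real (M choose Suc m) * pair_weight v + (\<Sum>j\<le>m. real (M choose j) * split_coeff j v)"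
        using split_coeff_top[OF v] by (simp del: split_coeff.simps)
      finally have pc: "real M / T * ((T / real M) ^ Suc m * pl_coeff M v) =
          T ^ m * (real M * (real (M choose Suc m) / real M ^ Suc m) * pair_weight v +
            (\<Sum>j\<le>m. real (M choose j) / real M ^ Suc m * real M * split_coeff j v))"
      proof -
        assume eq: "pl_coeff M v = real (M choose Suc m) * pair_weight v + (\<Sum>j\<le>m. real (M choose j) * split_coeff j v)"
        have "real M / T * (T / real M) ^ Suc m = T ^ m * (real M / real M ^ Suc m)"
          using T M by (simp add: power_divide field_simps)
        then have "real M / T * ((T / real M) ^ Suc m * pl_coeff M v) = T ^ m * (real M / real M ^ Suc m) * pl_coeff M v"
          by (simp only: mult.assoc[symmetric])
        then show ?thesis unfolding eq
          by (simp add: distrib_left sum_distrib_left sum_divide_distrib ac_simps del: power_Suc)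
      qed
      have "(\<Sum>j\<le>m. real (M choose j) / real M ^ Suc m * real M * split_coeff j v) =
          (\<Sum>j\<le>m. ?p j M / fact j * (1 / real M) ^ (m - j) * split_coeff j v)"
        using term_j by (intro sum.cong) auto
      also have "\<dots> = ?p m M / fact m * split_coeff m v +
          (\<Sum>j<m. ?p j M / fact j * (1 / real M) ^ (m - j) * split_coeff j v)"
        by (simp add: lessThan_Suc_atMost[symmetric])
      finally have pc': "real M / T * ((T / real M) ^ Suc m * pl_coeff M v) =
          T ^ m * (real M * (?p (Suc m) M / fact (Suc m)) * pair_weight v +
            (?p m M / fact m * split_coeff m v +
          (\<Sum>j<m. ?p j M / fact j * (1 / real M) ^ (m - j) * split_coeff j v)))"
        unfolding pc top by (simp only:)
      have sm: "real M / T * sig_mean v T = T ^ m * (real M * (1 / fact (Suc m)) * pair_weight v)"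
        using T v by (simp add: sig_mean_def del: fact_Suc)
      show ?case
        unfolding right_diff_distrib[of "real M / T"] pc' sm
        by (simp add: algebra_simps diff_divide_distrib del: fact_Suc prod.lessThan_Suc)
    qed
  qed
qed

section \<open>The projective norm\<close>

lemma sum_words_prod:
  fixes f :: "nat \<Rightarrow> 'd::finite \<Rightarrow> real"
  shows "(\<Sum>w | length w = n. \<Prod>k<n. f k (w ! k)) = (\<Prod>k<n. \<Sum>j\<in>UNIV. f k j)"
proof (induction n arbitrary: f)
  case (Suc n)
  show ?case
    unfolding sum_words_Suc prod.lessThan_Suc_shift comp_def nth_Cons_0 nth_Cons_Suc
      sum_distrib_left[symmetric] Suc.IH[of "\<lambda>k. f (Suc k)"]
    by (simp add: sum_distrib_right)
qed simp

text \<open>The absolute coefficients of a pure tensor sum to the product of the l1 norms of its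
  factors; the triangle inequality does the rest.\<close>

lemma sum_abs_le_projective:
  fixes x :: "nat \<Rightarrow> nat \<Rightarrow> real ^ 'd::finite"
  shows "(\<Sum>w | length w = n. \<bar>\<Sum>i<m. pure_tensor n (x i) w\<bar>) \<le> (\<Sum>i<m. \<Prod>k<n. l1_norm (x i k))"
proof -
  have "(\<Sum>w | length w = n. \<bar>\<Sum>i<m. pure_tensor n (x i) w\<bar>) \<le>
      (\<Sum>w | length w = n. \<Sum>i<m. \<bar>pure_tensor n (x i) w\<bar>)"
    by (intro sum_mono sum_abs)
  also have "\<dots> = (\<Sum>w | length w = n. \<Sum>i<m. \<Prod>k<n. \<bar>x i k $ (w ! k)\<bar>)"
    by (intro sum.cong refl) (auto simp: pure_tensor_def abs_prod)
  also have "\<dots> = (\<Sum>i<m. \<Prod>k<n. l1_norm (x i k))"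
    unfolding l1_norm_def
    by (subst sum.swap) (intro sum.cong refl sum_words_prod[where f = "\<lambda>k j. \<bar>x _ k $ j\<bar>"])
  finally show ?thesis .
qed

text \<open>The infimum is attained by the expansion over basis words, each basis vector having l1
  norm 1.\<close>

lemma projective_norm_eq:
  fixes a :: "'d::finite list \<Rightarrow> real"
  assumes n: "0 < n" and a: "\<And>w. length w \<noteq> n \<Longrightarrow> a w = 0"
  shows "projective_norm n a = (\<Sum>w | length w = n. \<bar>a w\<bar>)"
  unfolding projective_norm_def
proof (rule cInf_eq_minimum)
  let ?W = "{w :: 'd list. length w = n}"
  obtain e where e: "bij_betw e {..<card ?W} ?W"
    using ex_bij_betw_nat_finite[OF finite_words[of n]] by (auto simp: atLeast0LessThan)
  \<comment> \<open>The whole coefficient is put on factor 0, which exists because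
    \<open>0 < n\<close>; the other factors have norm 1.\<close>
  define x where "x i k = (if k = 0 then a (e i) else 1) *\<^sub>R (axis (e i ! k) 1 :: real ^ 'd)" for i k
  have len: "length (e i) = n" if "i < card ?W" for i
    using e that by (auto simp: bij_betw_def)
  have l1: "l1_norm (x i k) = (if k = 0 then \<bar>a (e i)\<bar> else 1)" for i k
    by (simp add: l1_norm_def x_def axis_def abs_mult if_distrib[of abs] if_distrib[of "(*) _"] cong: if_cong)
  have pt: "pure_tensor n (x i) w = (if w = e i then a w else 0)" if i: "i < card ?W" for i w
  proof (cases "length w = n")
    case True
    obtain n' where n': "n = Suc n'" using n by (cases n) auto
    have "pure_tensor n (x i) w = (\<Prod>k<n. (if k = 0 then a (e i) else 1) * (if w ! k = e i ! k then 1 else 0))"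
      using True by (simp add: pure_tensor_def x_def axis_def)
    also have "\<dots> = a (e i) * (\<Prod>k<n. if w ! k = e i ! k then 1 else 0)"
      unfolding prod.distrib by (simp add: n' prod.lessThan_Suc_shift del: prod.lessThan_Suc)
    also have "\<dots> = (if w = e i then a w else 0)"
    proof (cases "w = e i")
      case False
      then obtain k where "k < n" "w ! k \<noteq> e i ! k"
        using True len[OF i] nth_equalityI[of w "e i"] by auto
      then have "(\<Prod>k<n. if w ! k = e i ! k then 1 else 0 :: real) = 0"
        by (intro prod_zero) auto
      then show ?thesis using False by simp
    qed simp
    finally show ?thesis .
  next
    case False
    then show ?thesis using len[OF i] by (auto simp: pure_tensor_def)
  qed
  have repr: "a = (\<lambda>w. \<Sum>i<card ?W. pure_tensor n (x i) w)"
  proof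
    fix w
    show "a w = (\<Sum>i<card ?W. pure_tensor n (x i) w)"
    proof (cases "length w = n")
      case True
      have "(\<Sum>i<card ?W. pure_tensor n (x i) w) = (\<Sum>i<card ?W. if w = e i then a w else 0)"
        using pt by (intro sum.cong) auto
      also have "\<dots> = (\<Sum>v\<in>?W. if w = v then a w else 0)"
        by (rule sum.reindex_bij_betw[OF e])
      also have "\<dots> = a w" using True by (simp add: finite_words)
      finally show ?thesis by simp
    next
      case False
      then show ?thesis by (simp add: a pure_tensor_def)
    qed
  qed
  have "(\<Sum>i<card ?W. \<Prod>k<n. l1_norm (x i k)) = (\<Sum>i<card ?W. \<bar>a (e i)\<bar>)"
  proof (intro sum.cong refl)
    fix i
    obtain n' where n': "n = Suc n'" using n by (cases n) auto
    show "(\<Prod>k<n. l1_norm (x i k)) = \<bar>a (e i)\<bar>"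
      by (simp add: l1 n' prod.lessThan_Suc_shift del: prod.lessThan_Suc)
  qed
  also have "\<dots> = (\<Sum>w\<in>?W. \<bar>a w\<bar>)" by (rule sum.reindex_bij_betw[OF e])
  finally have "(\<Sum>i<card ?W. \<Prod>k<n. l1_norm (x i k)) = (\<Sum>w\<in>?W. \<bar>a w\<bar>)" .
  note val = this[symmetric]
  show "(\<Sum>w\<in>?W. \<bar>a w\<bar>) \<in> {\<Sum>i<m. \<Prod>k<n. l1_norm (x i k) | (m::nat) (x :: nat \<Rightarrow> nat \<Rightarrow> real ^ 'd). a = (\<lambda>w. \<Sum>i<m. pure_tensor n (x i) w)}"
    unfolding mem_Collect_eq
    by (rule exI[of _ "card ?W"], rule exI[of _ x], rule conjI[OF val repr])
  fix y assume "y \<in> {\<Sum>i<m. \<Prod>k<n. l1_norm (x i k) | (m::nat) (x :: nat \<Rightarrow> nat \<Rightarrow> real ^ 'd). a = (\<lambda>w. \<Sum>i<m. pure_tensor n (x i) w)}"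
  then obtain m and x :: "nat \<Rightarrow> nat \<Rightarrow> real ^ 'd" where y: "y = (\<Sum>i<m. \<Prod>k<n. l1_norm (x i k))"
    and ax: "a = (\<lambda>w. \<Sum>i<m. pure_tensor n (x i) w)" by blast
  show "(\<Sum>w\<in>?W. \<bar>a w\<bar>) \<le> y"
    unfolding y ax by (rule sum_abs_le_projective)
qed

section \<open>Parity, reversal of words and the two claims\<close>

lemma pair_weight_odd: "odd (length w) \<Longrightarrow> pair_weight w = 0"
  by (induction w rule: pair_weight.induct) auto

text \<open>Both expected signatures are computed on reversed words; summing over all words removes
  the reversal.\<close>

lemma sum_words_rev: "(\<Sum>w | length w = n. f (rev w)) = (\<Sum>w | length w = n. f (w :: 'd::finite list))"
  by (rule sum.reindex_bij_witness[of _ rev rev]) auto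

theorem theorem1p3:
  fixes P :: "'a measure" and B :: "real \<Rightarrow> 'a \<Rightarrow> real ^ 'd" and T :: real
  assumes "CARD('d) \<ge> 2" and "T > 0" and "BM P B"
  shows "(\<forall>M\<ge>1.
           tensor_proj 2 (expected_signature P B T) = tensor_proj 2 (expected_signature_pl P B M T) \<and>
           (\<forall>n\<ge>1. tensor_proj (2 * n - 1) (expected_signature P B T)
                     = tensor_proj (2 * n - 1) (expected_signature_pl P B M T) \<and>
                   tensor_proj (2 * n - 1) (expected_signature_pl P B M T) = (\<lambda>w. 0)))
       \<and>
         (\<forall>n\<ge>2.
           (\<lambda>M. real M / T *
              projective_norm (2 * n)
                (tensor_proj (2 * n) (expected_signature P B T)
                 - tensor_proj (2 * n) (expected_signature_pl P B M T)))
           \<longlonglongrightarrow> (real CARD('d) - 1) / (3 * fact (n - 2)) * (real CARD('d) * T / 2) ^ (n - 1))"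
proof -
  have "prob_space P" using \<open>BM P B\<close> by (auto simp: BM_def standard_BM_def)
  then interpret brownian P B using \<open>BM P B\<close> by (simp add: brownian_def brownian_axioms_def)
  note T = \<open>T > 0\<close>
  note es = expected_signature_eq[OF T] and pl = expected_signature_pl_eq[OF T]
  show ?thesis
  proof (intro conjI allI impI)
    fix M :: nat assume "1 \<le> M"
    then have M: "0 < M" by simp
    show "tensor_proj 2 (expected_signature P B T) = tensor_proj 2 (expected_signature_pl P B M T)"
    proof
      fix w :: "'d list"
      show "tensor_proj 2 (expected_signature P B T) w = tensor_proj 2 (expected_signature_pl P B M T) w"
      proof (cases "length w = 2")
        case True
        then have l: "length (rev w) = 2 * 1" by simp
        \<comment> \<open>In degree two the only contributions are \<open>M\<close> single blocks,
          each scaled by \<open>T / M\<close>, so \<open>M\<close> cancels and equality is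
          exact.\<close>
        have "pl_coeff M (rev w) = split_coeff 0 (rev w) + real M * split_coeff 1 (rev w)"
          using pl_coeff_bounded[of "rev w" 1 M] l by (simp del: split_coeff.simps)
        also have "split_coeff 0 (rev w) = 0" using l by auto
        finally show ?thesis
          using True M split_coeff_top[OF l] by (simp add: tensor_proj_def es pl[OF M] sig_mean_def del: split_coeff.simps)
      qed (simp add: tensor_proj_def)
    qed
    fix n :: nat assume "1 \<le> n"
    then have odd: "odd (2 * n - 1)" by simp
    show 0: "tensor_proj (2 * n - 1) (expected_signature_pl P B M T) = (\<lambda>w. 0)"
      using odd by (auto simp: tensor_proj_def pl[OF M] pl_coeff_odd fun_eq_iff)
    show "tensor_proj (2 * n - 1) (expected_signature P B T) = tensor_proj (2 * n - 1) (expected_signature_pl P B M T)"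
      unfolding 0 using odd by (auto simp: tensor_proj_def es sig_mean_def pair_weight_odd fun_eq_iff)
  next
    fix n :: nat assume n: "2 \<le> n"
    let ?L = "(real CARD('d) - 1) / (3 * fact (n - 2)) * (real CARD('d) * T / 2) ^ (n - 1)"
    define m where "m = n - 1"
    have nm: "n = Suc m" "n - 2 = m - 1" "0 < m" using n by (auto simp: m_def)
    let ?a = "\<lambda>M. tensor_proj (2 * n) (expected_signature P B T) - tensor_proj (2 * n) (expected_signature_pl P B M T)"
    let ?g = "\<lambda>M v. real M / T * (sig_mean v T - (T / real M) ^ Suc m * pl_coeff M v)"
    have "(\<lambda>M. \<Sum>w | length w = 2 * n. \<bar>?g M (w :: 'd list)\<bar>) \<longlonglongrightarrow>
        (\<Sum>w | length w = 2 * n. \<bar>T ^ m / fact m * lead_err m (w :: 'd list)\<bar>)"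
      by (intro tendsto_sum tendsto_rabs coefficient_limit T) (simp add: nm)
    also have "(\<Sum>w | length w = 2 * n. \<bar>T ^ m / fact m * lead_err m (w :: 'd list)\<bar>) =
        T ^ m / fact m * (\<Sum>w | length w = 2 * m + 2. \<bar>lead_err m (w :: 'd list)\<bar>)"
      using T by (simp add: abs_mult nm sum_distrib_left)
    also have "\<dots> = ?L"
    proof -
      \<comment> \<open>The factor \<open>real m\<close> from \<open>sum_lead_err\<close> lowers
        \<open>fact m\<close> to \<open>fact (m - 1)\<close>, which is
        \<open>fact (n - 2)\<close>.\<close>
      have "fact m = real m * fact (m - 1)" using nm(3) by (simp add: fact_reduce)
      then show ?thesis
        using nm(3) unfolding sum_lead_err nm(2) m_def[symmetric]
        by (simp add: power_mult_distrib power_divide field_simps)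
    qed
    finally have lim: "(\<lambda>M. \<Sum>w | length w = 2 * n. \<bar>?g M (w :: 'd list)\<bar>) \<longlonglongrightarrow>
        ?L" .
    show "(\<lambda>M. real M / T * projective_norm (2 * n) (?a M)) \<longlonglongrightarrow>
        ?L"
    proof (rule Lim_transform_eventually[OF lim])
      show "\<forall>\<^sub>F M in sequentially. (\<Sum>w | length w = 2 * n. \<bar>?g M (w :: 'd list)\<bar>) = real M / T * projective_norm (2 * n) (?a M)"
        using eventually_gt_at_top[of 0]
      proof eventually_elim
        case (elim M)
        have "projective_norm (2 * n) (?a M) = (\<Sum>w | length w = 2 * n. \<bar>?a M w\<bar>)"
          using n by (intro projective_norm_eq) (auto simp: tensor_proj_def)
        also have "\<dots> = (\<Sum>w | length w = 2 * n. \<bar>sig_mean (rev w) T - (T / real M) ^ Suc m * pl_coeff M (rev w :: 'd list)\<bar>)"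
          by (intro sum.cong refl) (simp add: tensor_proj_def es pl[OF elim] nm)
        also have "\<dots> = (\<Sum>w | length w = 2 * n. \<bar>sig_mean w T - (T / real M) ^ Suc m * pl_coeff M (w :: 'd list)\<bar>)"
          by (rule sum_words_rev)
        finally show ?case using T by (simp add: abs_mult sum_distrib_left)
      qed
    qed
  qed
qed

end
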